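(* Let $R$ and $R'$ be nonzero commutative rings, let $A$ be an Azumaya algebra of constant rank over $R$, let $A'$ be an Azumaya algebra of constant rank over $R'$, and let $\phi: A \to A'$ be a ring homomorphism. Then: (1) The rank of $A$ is less than or equal to the rank of $A'$. (2) If furthermore the ranks of $A$ and $A'$ are equal and $R'$ is reduced, then $\phi$ sends the center of $A$ into the center of $A'$, i.e. $\phi(Z(A)) \subset Z(A')$.
   Context: Rings are associative with unit and ring homomorphisms preserve the unit; $\phi$ is not assumed to be linear over any base ring. $Z(A)$ denotes the center of $A$. An Azumaya algebra over a commutative ring $R$ is an $R$-algebra $A$ (not necessarily commutative) which is a finitely generated faithful $R$-module such that for each maximal ideal $\mathfrak{m}$ of $R$ the quotient $A/\mathfrak{m}A$ is a central simple $R/\mathfrak{m}$-algebra. It is a standard fact that then $A$ is a finitely generated projective $R$-module with center $R\cdot 1_A \cong R$. For each prime $\mathfrak{p}$ of $R$, $A \otimes_R R_{\mathfrak{p}}$ is a free $R_{\mathfrak{p}}$-module of finite rank $r_{\mathfrak{p}}(A)$, called the rank of $A$ at $\mathfrak{p}$. $A$ has constant rank $r$ if $r_{\mathfrak{p}}(A) = r$ for every $\mathfrak{p} \in \mathrm{Spec}(R)$; then $r$ is called the rank of $A$. A ring is reduced if it has no nonzero nilpotent elements. *)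

theory Defs
  imports
    "HOL-Algebra.QuotRing"
    "HOL-Algebra.Generated_Groups"
    "HOL-Algebra.Free_Abelian_Groups"
    "Jordan_Normal_Form.Missing_VectorSpace"
begin

text \<open>
  The notions \<^const>\<open>module.span\<close> and \<^const>\<open>module.lin_dep\<close> are those of the AFP entry
  VectorSpace; they are stated there for modules over an arbitrary commutative ring.
\<close>


subsection \<open>Rings\<close>

definition ring_center :: "('a, 'm) ring_scheme \<Rightarrow> 'a set"
  where "ring_center A =
    {z \<in> carrier A. \<forall>x \<in> carrier A. z \<otimes>\<^bsub>A\<^esub> x = x \<otimes>\<^bsub>A\<^esub> z}"

definition reduced_ring :: "('a, 'm) ring_scheme \<Rightarrow> bool"
  where "reduced_ring R \<longleftrightarrow>
    (\<forall>x \<in> carrier R. (\<exists>n::nat. x [^]\<^bsub>R\<^esub> n = \<zero>\<^bsub>R\<^esub>) \<longrightarrow> x = \<zero>\<^bsub>R\<^esub>)"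

definition simple_ring :: "('a, 'm) ring_scheme \<Rightarrow> bool"
  where "simple_ring A \<longleftrightarrow> ring A \<and> \<one>\<^bsub>A\<^esub> \<noteq> \<zero>\<^bsub>A\<^esub> \<and>
    (\<forall>I. ideal I A \<longrightarrow> I = {\<zero>\<^bsub>A\<^esub>} \<or> I = carrier A)"


subsection \<open>Modules and algebras\<close>

definition fin_gen_module :: "('r, 'm) ring_scheme \<Rightarrow> ('r, 'a, 'n) module_scheme \<Rightarrow> bool"
  where "fin_gen_module R M \<longleftrightarrow> module R M \<and>
    (\<exists>S. finite S \<and> S \<subseteq> carrier M \<and> module.span R M S = carrier M)"

definition faithful_module :: "('r, 'm) ring_scheme \<Rightarrow> ('r, 'a, 'n) module_scheme \<Rightarrow> bool"
  where "faithful_module R M \<longleftrightarrow> module R M \<and>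
    (\<forall>r \<in> carrier R. (\<forall>x \<in> carrier M. r \<odot>\<^bsub>M\<^esub> x = \<zero>\<^bsub>M\<^esub>) \<longrightarrow> r = \<zero>\<^bsub>R\<^esub>)"

definition free_module_of_rank ::
    "('r, 'm) ring_scheme \<Rightarrow> ('r, 'a, 'n) module_scheme \<Rightarrow> nat \<Rightarrow> bool"
  where "free_module_of_rank R M n \<longleftrightarrow> module R M \<and>
    (\<exists>B. finite B \<and> card B = n \<and> B \<subseteq> carrier M \<and>
         \<not> module.lin_dep R M B \<and> module.span R M B = carrier M)"

text \<open>
  The locale \<^locale>\<open>algebra\<close> of HOL-Algebra is restricted to commutative algebras; the
  following is its associative, not necessarily commutative, counterpart.
\<close>

locale assoc_algebra = module R A + A?: ring A for R (structure) and A (structure) +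
  assumes smult_mult_left:
      "\<lbrakk>r \<in> carrier R; x \<in> carrier A; y \<in> carrier A\<rbrakk> \<Longrightarrow>
        (r \<odot>\<^bsub>A\<^esub> x) \<otimes>\<^bsub>A\<^esub> y = r \<odot>\<^bsub>A\<^esub> (x \<otimes>\<^bsub>A\<^esub> y)"
    and smult_mult_right:
      "\<lbrakk>r \<in> carrier R; x \<in> carrier A; y \<in> carrier A\<rbrakk> \<Longrightarrow>
        x \<otimes>\<^bsub>A\<^esub> (r \<odot>\<^bsub>A\<^esub> y) = r \<odot>\<^bsub>A\<^esub> (x \<otimes>\<^bsub>A\<^esub> y)"

definition central_simple_algebra ::
    "('r, 'm) ring_scheme \<Rightarrow> ('r, 'a, 'n) module_scheme \<Rightarrow> bool"
  where "central_simple_algebra k A \<longleftrightarrow>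
    field k \<and> assoc_algebra k A \<and> fin_gen_module k A \<and> simple_ring A \<and>
    ring_center A = {c \<odot>\<^bsub>A\<^esub> \<one>\<^bsub>A\<^esub> | c. c \<in> carrier k}"

definition ideal_smult ::
    "('r, 'm) ring_scheme \<Rightarrow> ('r, 'a, 'n) module_scheme \<Rightarrow> 'r set \<Rightarrow> 'a set"
  where "ideal_smult R A I =
    module.span R A {r \<odot>\<^bsub>A\<^esub> x | r x. r \<in> I \<and> x \<in> carrier A}"

text \<open>
  The quotient \<open>A/IA\<close> as an algebra over \<open>R/I\<close>.  Its scalar multiplication is given on cosets,
  in the style of \<^const>\<open>rcoset_mult\<close>.
\<close>

definition quot_algebra ::
    "('r, 'm) ring_scheme \<Rightarrow> ('r, 'a, 'n) module_scheme \<Rightarrow> 'r set \<Rightarrow> ('r set, 'a set) module"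
  where "quot_algebra R A I = (let J = ideal_smult R A I in
    ring.extend (A Quot J)
      (module.fields (\<lambda>c X. \<Union>r\<in>c. \<Union>x\<in>X. J +>\<^bsub>A\<^esub> (r \<odot>\<^bsub>A\<^esub> x))))"


subsection \<open>Localization\<close>

definition fraction_rel :: "('r, 'm) ring_scheme \<Rightarrow> 'r set \<Rightarrow> (('r \<times> 'r) \<times> ('r \<times> 'r)) set"
  where "fraction_rel R S =
    {((r, s), (r', s')). r \<in> carrier R \<and> s \<in> S \<and> r' \<in> carrier R \<and> s' \<in> S \<and>
       (\<exists>t\<in>S. t \<otimes>\<^bsub>R\<^esub> (s' \<otimes>\<^bsub>R\<^esub> r \<ominus>\<^bsub>R\<^esub> s \<otimes>\<^bsub>R\<^esub> r') = \<zero>\<^bsub>R\<^esub>)}"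

definition fraction :: "('r, 'm) ring_scheme \<Rightarrow> 'r set \<Rightarrow> 'r \<Rightarrow> 'r \<Rightarrow> ('r \<times> 'r) set"
  where "fraction R S r s = fraction_rel R S `` {(r, s)}"

definition localization :: "('r, 'm) ring_scheme \<Rightarrow> 'r set \<Rightarrow> ('r \<times> 'r) set ring"
  where "localization R S =
    \<lparr>carrier = (carrier R \<times> S) // fraction_rel R S,
     monoid.mult = (\<lambda>X Y. \<Union>(r, s)\<in>X. \<Union>(r', s')\<in>Y. fraction R S (r \<otimes>\<^bsub>R\<^esub> r') (s \<otimes>\<^bsub>R\<^esub> s')),
     monoid.one = fraction R S \<one>\<^bsub>R\<^esub> \<one>\<^bsub>R\<^esub>,
     ring.zero = fraction R S \<zero>\<^bsub>R\<^esub> \<one>\<^bsub>R\<^esub>,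
     ring.add = (\<lambda>X Y. \<Union>(r, s)\<in>X. \<Union>(r', s')\<in>Y.
              fraction R S (s' \<otimes>\<^bsub>R\<^esub> r \<oplus>\<^bsub>R\<^esub> s \<otimes>\<^bsub>R\<^esub> r') (s \<otimes>\<^bsub>R\<^esub> s'))\<rparr>"

abbreviation local_ring_at :: "('r, 'm) ring_scheme \<Rightarrow> 'r set \<Rightarrow> ('r \<times> 'r) set ring"
  where "local_ring_at R p \<equiv> localization R (carrier R - p)"

abbreviation local_map_at :: "('r, 'm) ring_scheme \<Rightarrow> 'r set \<Rightarrow> 'r \<Rightarrow> ('r \<times> 'r) set"
  where "local_map_at R p \<equiv> (\<lambda>r. fraction R (carrier R - p) r \<one>\<^bsub>R\<^esub>)"


subsection \<open>Tensor products and base change\<close>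

text \<open>
  \<open>M \<otimes>\<^sub>R N\<close> is the free abelian group on \<open>M \<times> N\<close> modulo the subgroup generated by the
  bilinearity relations.  It is written multiplicatively, since \<^const>\<open>free_Abelian_group\<close> and
  \<^const>\<open>FactGroup\<close> are.
\<close>

definition tensor_rels ::
    "('r, 'm) ring_scheme \<Rightarrow> ('r, 'a, 'n) module_scheme \<Rightarrow> ('r, 'b, 'k) module_scheme \<Rightarrow>
      ('a \<times> 'b \<Rightarrow>\<^sub>0 int) set"
  where "tensor_rels R M N =
    {frag_of (x \<oplus>\<^bsub>M\<^esub> x', y) - frag_of (x, y) - frag_of (x', y) | x x' y.
       x \<in> carrier M \<and> x' \<in> carrier M \<and> y \<in> carrier N} \<union>
    {frag_of (x, y \<oplus>\<^bsub>N\<^esub> y') - frag_of (x, y) - frag_of (x, y') | x y y'.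
       x \<in> carrier M \<and> y \<in> carrier N \<and> y' \<in> carrier N} \<union>
    {frag_of (r \<odot>\<^bsub>M\<^esub> x, y) - frag_of (x, r \<odot>\<^bsub>N\<^esub> y) | r x y.
       r \<in> carrier R \<and> x \<in> carrier M \<and> y \<in> carrier N}"

definition tensor_null ::
    "('r, 'm) ring_scheme \<Rightarrow> ('r, 'a, 'n) module_scheme \<Rightarrow> ('r, 'b, 'k) module_scheme \<Rightarrow>
      ('a \<times> 'b \<Rightarrow>\<^sub>0 int) set"
  where "tensor_null R M N =
    generate (free_Abelian_group (carrier M \<times> carrier N)) (tensor_rels R M N)"

definition tensor_group ::
    "('r, 'm) ring_scheme \<Rightarrow> ('r, 'a, 'n) module_scheme \<Rightarrow> ('r, 'b, 'k) module_scheme \<Rightarrow>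
      ('a \<times> 'b \<Rightarrow>\<^sub>0 int) set monoid"
  where "tensor_group R M N =
    free_Abelian_group (carrier M \<times> carrier N) Mod tensor_null R M N"

definition restrict_scalars :: "('r \<Rightarrow> 's) \<Rightarrow> ('s, 'm) ring_scheme \<Rightarrow> ('r, 's) module"
  where "restrict_scalars h S =
    ring.extend (ring.truncate S) (module.fields (\<lambda>r s. h r \<otimes>\<^bsub>S\<^esub> s))"

text \<open>
  The \<open>S\<close>-module \<open>M \<otimes>\<^sub>R S\<close> for a ring homomorphism \<open>h : R \<rightarrow> S\<close>, with \<open>s (x \<otimes> y) = x \<otimes> s y\<close>.
  Only the module structure is used, so the fields for the multiplication and the unit, which
  the record type forces us to supply, are left unspecified.
\<close>

definition base_change ::
    "('r, 'm) ring_scheme \<Rightarrow> ('r, 'a, 'n) module_scheme \<Rightarrow> ('s, 'k) ring_scheme \<Rightarrow> ('r \<Rightarrow> 's) \<Rightarrow>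
      ('s, ('a \<times> 's \<Rightarrow>\<^sub>0 int) set) module"
  where "base_change R M S h = (let T = tensor_group R M (restrict_scalars h S) in
    \<lparr>carrier = carrier T, monoid.mult = undefined, monoid.one = undefined,
     ring.zero = \<one>\<^bsub>T\<^esub>, ring.add = (\<otimes>\<^bsub>T\<^esub>),
     smult = (\<lambda>s X. \<Union>f\<in>X.
       tensor_null R M (restrict_scalars h S)
         #>\<^bsub>free_Abelian_group (carrier M \<times> carrier S)\<^esub>
           frag_extend (\<lambda>(x, y). frag_of (x, s \<otimes>\<^bsub>S\<^esub> y)) f)\<rparr>)"


subsection \<open>Azumaya algebras\<close>

definition azumaya_algebra ::
    "('r, 'm) ring_scheme \<Rightarrow> ('r, 'a, 'n) module_scheme \<Rightarrow> bool"
  where "azumaya_algebra R A \<longleftrightarrow>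
    cring R \<and> assoc_algebra R A \<and> fin_gen_module R A \<and> faithful_module R A \<and>
    (\<forall>m. maximalideal m R \<longrightarrow> central_simple_algebra (R Quot m) (quot_algebra R A m))"

text \<open>
  The rank is a relation: at each prime \<open>p\<close> the \<open>R\<^sub>p\<close>-module \<open>A \<otimes>\<^sub>R R\<^sub>p\<close> is free with a basis of
  \<open>n\<close> elements.  As \<open>R\<^sub>p\<close> is a nonzero commutative ring, \<open>n\<close> is determined by \<open>A\<close> and \<open>p\<close>.
\<close>

definition has_rank_at ::
    "('r, 'm) ring_scheme \<Rightarrow> ('r, 'a, 'n) module_scheme \<Rightarrow> 'r set \<Rightarrow> nat \<Rightarrow> bool"
  where "has_rank_at R A p n \<longleftrightarrow>
    free_module_of_rank (local_ring_at R p)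
      (base_change R A (local_ring_at R p) (local_map_at R p)) n"

definition has_constant_rank ::
    "('r, 'm) ring_scheme \<Rightarrow> ('r, 'a, 'n) module_scheme \<Rightarrow> nat \<Rightarrow> bool"
  where "has_constant_rank R A n \<longleftrightarrow> (\<forall>p. primeideal p R \<longrightarrow> has_rank_at R A p n)"

end

theory Submission
  imports Defs
begin

text \<open>
  At a prime \<open>p'\<close> of \<open>R'\<close> let \<open>D\<close> be the image of \<open>A'\<close> in \<open>A' \<otimes> \<kappa>(p')\<close>, which has dimension \<open>r'\<close>.
  The kernel of \<open>A \<rightarrow> D\<close> is a proper ideal, so by Nakayama's lemma and the simplicity of the fibres
  it lies in \<open>mA\<close> for some maximal ideal \<open>m\<close> of \<open>R\<close>.  The fibre \<open>A/mA\<close> is central simple, hence elements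
  \<open>y\<^sub>1, \<dots>, y\<^sub>r\<close> of \<open>A\<close> that form a basis of it admit dual maps of the form \<open>x \<mapsto> \<Sum> a x b\<close>.  Such maps can be
  transported along \<open>\<phi>\<close>, although \<open>\<phi>\<close> is not linear, and commute with central scalars; a division-free
  elimination with them shows that the images of the \<open>y\<^sub>i\<close> in \<open>D\<close> are linearly independent, so \<open>r \<le> r'\<close>.
  If \<open>r = r'\<close>, these images span \<open>A' \<otimes> \<kappa>(p')\<close>, so the image of a central element of \<open>A\<close> commutes with
  everything modulo \<open>p'\<close>.  As \<open>A'\<close> is locally free and \<open>R'\<close> is reduced, no nonzero element of \<open>A'\<close>
  vanishes at all primes.
\<close>

subsection \<open>Fractions\<close>

text \<open>The kernel of the map from A to D lies inside mA, not the other way round, so in general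
  \<phi> induces no homomorphism from the fibre A/mA to D. The dual maps have to be lifted to A,
  where their duality holds only modulo mA and their values are elements that in general neither
  commute nor are invertible. Hence the elimination multiplies crosswise and only controls what
  happens modulo mA. Nor does p' have an obvious prime of R below it, since \<phi> need not map
  centre to centre: m has to come from the ideals of A. The coefficients of a relation come from R'
  and have no counterpart in A, but they are central in D and therefore pass through every
  transported map. For the second claim maximal ideals are not enough: an element of a reduced ring
  may lie in all of them, and a smaller prime inside a given one is needed to detect it. Residue
  fields are never constructed; a submodule saturated at the prime takes the place of the kernel of
  the map to the vector space, and all relations have their denominators cleared.\<close>

locale denominators = cring R for R (structure) +
  fixes S
  assumes S_subset: "S \<subseteq> carrier R"
    and S_one: "\<one> \<in> S"
    and S_mult: "\<lbrakk>s \<in> S; t \<in> S\<rbrakk> \<Longrightarrow> s \<otimes> t \<in> S"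
begin

lemma S_carr [simp, intro]: "s \<in> S \<Longrightarrow> s \<in> carrier R"
  using S_subset by blast

lemma minus_eq_zero_iff:
  assumes "t \<in> carrier R" "a \<in> carrier R" "b \<in> carrier R"
  shows "t \<otimes> (a \<ominus> b) = \<zero> \<longleftrightarrow> t \<otimes> a = t \<otimes> b"
proof -
  have "t \<otimes> (a \<ominus> b) = t \<otimes> a \<ominus> t \<otimes> b"
    using assms by (simp add: r_minus r_distr a_minus_def)
  then show ?thesis using assms by simp
qed

text \<open>Equations between products can be chained and rewritten by commutativity, which the
  difference in the definition obstructs.\<close>

lemma fraction_rel_iff:
  "((r, s), (r', s')) \<in> fraction_rel R S \<longleftrightarrow>
    r \<in> carrier R \<and> s \<in> S \<and> r' \<in> carrier R \<and> s' \<in> S \<and> (\<exists>t\<in>S. t \<otimes> (s' \<otimes> r) = t \<otimes> (s \<otimes> r'))"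
proof (cases "r \<in> carrier R \<and> s \<in> S \<and> r' \<in> carrier R \<and> s' \<in> S")
  case True
  then have "t \<otimes> (s' \<otimes> r \<ominus> s \<otimes> r') = \<zero> \<longleftrightarrow> t \<otimes> (s' \<otimes> r) = t \<otimes> (s \<otimes> r')" if "t \<in> S" for t
    using that by (intro minus_eq_zero_iff) auto
  with True show ?thesis by (simp add: fraction_rel_def)
qed (auto simp: fraction_rel_def)

lemma equiv_fraction_rel: "equiv (carrier R \<times> S) (fraction_rel R S)"
proof (rule equivI)
  show "fraction_rel R S \<subseteq> (carrier R \<times> S) \<times> carrier R \<times> S"
    by (auto simp: fraction_rel_def)
  show "refl_on (carrier R \<times> S) (fraction_rel R S)"
    using S_one by (auto simp: refl_on_def fraction_rel_iff)
  show "sym (fraction_rel R S)"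
    by (rule symI) (auto simp: fraction_rel_iff, metis)
  show "trans (fraction_rel R S)"
  proof (rule transI, clarsimp simp: fraction_rel_iff)
    fix r s r' s' r'' s'' t u
    assume *: "r \<in> carrier R" "s \<in> S" "r' \<in> carrier R" "s' \<in> S" "r'' \<in> carrier R" "s'' \<in> S"
       "t \<in> S" "u \<in> S" and 1: "t \<otimes> (s' \<otimes> r) = t \<otimes> (s \<otimes> r')" and 2: "u \<otimes> (s'' \<otimes> r') = u \<otimes> (s' \<otimes> r'')"
    \<comment> \<open>The witness contains the middle denominator \<open>s'\<close>, so that the two
      given relations can be applied one after the other.\<close>
    have "(t \<otimes> (u \<otimes> s')) \<otimes> (s'' \<otimes> r) = (u \<otimes> s'') \<otimes> (t \<otimes> (s' \<otimes> r))"
      using * by (simp add: m_ac)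
    also have "\<dots> = (t \<otimes> s) \<otimes> (u \<otimes> (s'' \<otimes> r'))" unfolding 1 using * by (simp add: m_ac)
    also have "\<dots> = (t \<otimes> (u \<otimes> s')) \<otimes> (s \<otimes> r'')" unfolding 2 using * by (simp add: m_ac)
    finally show "\<exists>t\<in>S. t \<otimes> (s'' \<otimes> r) = t \<otimes> (s \<otimes> r'')"
      using * S_mult by blast
  qed
qed

lemma fraction_eq_iff:
  assumes "r \<in> carrier R" "s \<in> S" "r' \<in> carrier R" "s' \<in> S"
  shows "fraction R S r s = fraction R S r' s' \<longleftrightarrow> (\<exists>t\<in>S. t \<otimes> (s' \<otimes> r) = t \<otimes> (s \<otimes> r'))"
  unfolding fraction_def
  using assms eq_equiv_class_iff[OF equiv_fraction_rel, of "(r, s)" "(r', s')"]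
  by (simp add: fraction_rel_iff)

lemma mem_fraction_iff:
  assumes "r \<in> carrier R" "s \<in> S"
  shows "(r', s') \<in> fraction R S r s \<longleftrightarrow>
    r' \<in> carrier R \<and> s' \<in> S \<and> fraction R S r s = fraction R S r' s'"
proof -
  have "(r', s') \<in> fraction R S r s \<longleftrightarrow> ((r, s), (r', s')) \<in> fraction_rel R S"
    by (simp add: fraction_def)
  then show ?thesis
    using assms by (cases "r' \<in> carrier R \<and> s' \<in> S") (simp_all add: fraction_rel_iff fraction_eq_iff, blast)
qed

lemma carrier_localization:
  "carrier (localization R S) = {fraction R S r s | r s. r \<in> carrier R \<and> s \<in> S}"
  by (auto simp: localization_def quotient_def fraction_def)

lemma fraction_closed [simp, intro]:
  "\<lbrakk>r \<in> carrier R; s \<in> S\<rbrakk> \<Longrightarrow> fraction R S r s \<in> carrier (localization R S)"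
  by (auto simp: carrier_localization)

lemma fraction_cases:
  assumes "X \<in> carrier (localization R S)"
  obtains r s where "r \<in> carrier R" "s \<in> S" "X = fraction R S r s"
  using assms by (auto simp: carrier_localization)

text \<open>The operations of \<open>localization\<close> are unions over all representatives. If
  every pair of representatives contributes the same class, the union is that class.\<close>

lemma UN_pairs_const:
  assumes "p \<in> X" "q \<in> Y" "\<And>a u b v. (a, u) \<in> X \<Longrightarrow> (b, v) \<in> Y \<Longrightarrow> f a u b v = C"
  shows "(\<Union>(a, u)\<in>X. \<Union>(b, v)\<in>Y. f a u b v) = C"
proof -
  have "(case x of (a, u) \<Rightarrow> \<Union>(b, v)\<in>Y. f a u b v) = C" if "x \<in> X" for x
    using assms(3) that by (cases x) (auto intro!: UN_constant_eq[OF assms(2)])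
  then show ?thesis
    by (intro UN_constant_eq[OF assms(1)] ballI)
qed

lemma localization_mult:
  assumes "r \<in> carrier R" "s \<in> S" "r' \<in> carrier R" "s' \<in> S"
  shows "fraction R S r s \<otimes>\<^bsub>localization R S\<^esub> fraction R S r' s' = fraction R S (r \<otimes> r') (s \<otimes> s')"
proof -
  have "fraction R S (a \<otimes> b) (u \<otimes> v) = fraction R S (r \<otimes> r') (s \<otimes> s')"
    if h: "(a, u) \<in> fraction R S r s" "(b, v) \<in> fraction R S r' s'" for a u b v
  proof -
    have cd: "a \<in> carrier R" "b \<in> carrier R" "u \<in> S" "v \<in> S"
      using h assms by (simp_all add: mem_fraction_iff)
    have "\<exists>c\<in>S. c \<otimes> (u \<otimes> r) = c \<otimes> (s \<otimes> a)" "\<exists>d\<in>S. d \<otimes> (v \<otimes> r') = d \<otimes> (s' \<otimes> b)"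
      using h assms by (auto simp: mem_fraction_iff fraction_eq_iff)
    then obtain c d where cdS: "c \<in> S" "d \<in> S" and
      e: "c \<otimes> (s \<otimes> a) = c \<otimes> (u \<otimes> r)" "d \<otimes> (s' \<otimes> b) = d \<otimes> (v \<otimes> r')"
      by metis
    note cd = cd cdS
    have "(c \<otimes> d) \<otimes> ((s \<otimes> s') \<otimes> (a \<otimes> b)) = (c \<otimes> (s \<otimes> a)) \<otimes> (d \<otimes> (s' \<otimes> b))"
      using assms cd by (simp add: m_ac)
    also have "\<dots> = (c \<otimes> d) \<otimes> ((u \<otimes> v) \<otimes> (r \<otimes> r'))"
      unfolding e using assms cd by (simp add: m_ac)
    finally show ?thesis using assms cd S_mult by (subst fraction_eq_iff) auto
  qed
  moreover have "(r, s) \<in> fraction R S r s" "(r', s') \<in> fraction R S r' s'"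
    using assms by (simp_all add: mem_fraction_iff)
  ultimately show ?thesis
    unfolding localization_def monoid.simps by (rule UN_pairs_const[rotated 2])
qed

lemma localization_add:
  assumes "r \<in> carrier R" "s \<in> S" "r' \<in> carrier R" "s' \<in> S"
  shows "fraction R S r s \<oplus>\<^bsub>localization R S\<^esub> fraction R S r' s'
    = fraction R S (s' \<otimes> r \<oplus> s \<otimes> r') (s \<otimes> s')"
proof -
  have "fraction R S (v \<otimes> a \<oplus> u \<otimes> b) (u \<otimes> v) = fraction R S (s' \<otimes> r \<oplus> s \<otimes> r') (s \<otimes> s')"
    if h: "(a, u) \<in> fraction R S r s" "(b, v) \<in> fraction R S r' s'" for a u b v
  proof -
    have cd: "a \<in> carrier R" "b \<in> carrier R" "u \<in> S" "v \<in> S"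
      using h assms by (simp_all add: mem_fraction_iff)
    have "\<exists>c\<in>S. c \<otimes> (u \<otimes> r) = c \<otimes> (s \<otimes> a)" "\<exists>d\<in>S. d \<otimes> (v \<otimes> r') = d \<otimes> (s' \<otimes> b)"
      using h assms by (auto simp: mem_fraction_iff fraction_eq_iff)
    then obtain c d where cdS: "c \<in> S" "d \<in> S" and
      e: "c \<otimes> (s \<otimes> a) = c \<otimes> (u \<otimes> r)" "d \<otimes> (s' \<otimes> b) = d \<otimes> (v \<otimes> r')"
      by metis
    note cd = cd cdS
    have "(c \<otimes> d) \<otimes> ((s \<otimes> s') \<otimes> (v \<otimes> a \<oplus> u \<otimes> b)) =
        (d \<otimes> s' \<otimes> v) \<otimes> (c \<otimes> (s \<otimes> a)) \<oplus> (c \<otimes> s \<otimes> u) \<otimes> (d \<otimes> (s' \<otimes> b))"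
      using assms cd by (simp add: m_ac r_distr)
    also have "\<dots> = (c \<otimes> d) \<otimes> ((u \<otimes> v) \<otimes> (s' \<otimes> r \<oplus> s \<otimes> r'))"
      unfolding e using assms cd by (simp add: m_ac r_distr)
    finally show ?thesis using assms cd S_mult by (subst fraction_eq_iff) auto
  qed
  moreover have "(r, s) \<in> fraction R S r s" "(r', s') \<in> fraction R S r' s'"
    using assms by (simp_all add: mem_fraction_iff)
  ultimately show ?thesis
    unfolding localization_def ring.simps by (rule UN_pairs_const[rotated 2])
qed

lemma fraction_eq_zero_iff:
  assumes "r \<in> carrier R" "s \<in> S"
  shows "fraction R S r s = \<zero>\<^bsub>localization R S\<^esub> \<longleftrightarrow> (\<exists>t\<in>S. t \<otimes> r = \<zero>)"
  unfolding localization_def using assms S_one by (simp add: fraction_eq_iff)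

lemma localization_one: "\<one>\<^bsub>localization R S\<^esub> = fraction R S \<one> \<one>"
  by (simp add: localization_def)

end

subsection \<open>Localized modules\<close>

locale denominators_module = module R M + denominators R S for R (structure) and M (structure) and S
begin

text \<open>A second model of the localized module, by fractions x/s. Unlike in the tensor product,
  equality of two elements is explicit here, so this model can detect when x \<otimes> 1
  vanishes.\<close>

definition mfrac_rel :: "(('c \<times> 'a) \<times> ('c \<times> 'a)) set"
  where "mfrac_rel = {((x, s), (y, t)). x \<in> carrier M \<and> s \<in> S \<and> y \<in> carrier M \<and> t \<in> S \<and>
    (\<exists>u\<in>S. (u \<otimes> t) \<odot>\<^bsub>M\<^esub> x = (u \<otimes> s) \<odot>\<^bsub>M\<^esub> y)}"

definition mfrac :: "'c \<Rightarrow> 'a \<Rightarrow> ('c \<times> 'a) set"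
  where "mfrac x s = mfrac_rel `` {(x, s)}"

lemma equiv_mfrac_rel: "equiv (carrier M \<times> S) mfrac_rel"
proof (rule equivI)
  show "mfrac_rel \<subseteq> (carrier M \<times> S) \<times> carrier M \<times> S"
    by (auto simp: mfrac_rel_def)
  show "refl_on (carrier M \<times> S) mfrac_rel"
    using S_one by (auto simp: refl_on_def mfrac_rel_def)
  show "sym mfrac_rel"
  proof (rule symI, clarsimp simp: mfrac_rel_def)
    fix x s y t u
    assume "u \<in> S" "(u \<otimes> t) \<odot>\<^bsub>M\<^esub> x = (u \<otimes> s) \<odot>\<^bsub>M\<^esub> y"
    then show "\<exists>u\<in>S. (u \<otimes> s) \<odot>\<^bsub>M\<^esub> y = (u \<otimes> t) \<odot>\<^bsub>M\<^esub> x"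
      by (intro bexI[of _ u]) auto
  qed
  show "trans mfrac_rel"
  proof (rule transI, clarsimp simp: mfrac_rel_def)
    fix x s y t z v a b
    assume *: "x \<in> carrier M" "s \<in> S" "y \<in> carrier M" "t \<in> S" "z \<in> carrier M" "v \<in> S"
       "a \<in> S" "b \<in> S"
      and 1: "(a \<otimes> t) \<odot>\<^bsub>M\<^esub> x = (a \<otimes> s) \<odot>\<^bsub>M\<^esub> y" and 2: "(b \<otimes> v) \<odot>\<^bsub>M\<^esub> y = (b \<otimes> t) \<odot>\<^bsub>M\<^esub> z"
    have "((a \<otimes> b \<otimes> t) \<otimes> v) \<odot>\<^bsub>M\<^esub> x = (b \<otimes> v) \<odot>\<^bsub>M\<^esub> ((a \<otimes> t) \<odot>\<^bsub>M\<^esub> x)"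
      using * by (simp add: smult_assoc1[symmetric] m_ac)
    also have "\<dots> = (a \<otimes> s) \<odot>\<^bsub>M\<^esub> ((b \<otimes> v) \<odot>\<^bsub>M\<^esub> y)"
      unfolding 1 using * by (simp add: smult_assoc1[symmetric] m_ac)
    also have "\<dots> = ((a \<otimes> b \<otimes> t) \<otimes> s) \<odot>\<^bsub>M\<^esub> z"
      unfolding 2 using * by (simp add: smult_assoc1[symmetric] m_ac)
    finally show "\<exists>u\<in>S. (u \<otimes> v) \<odot>\<^bsub>M\<^esub> x = (u \<otimes> s) \<odot>\<^bsub>M\<^esub> z"
      using * S_mult by blast
  qed
qed

lemma mfrac_eq_iff:
  assumes "x \<in> carrier M" "s \<in> S" "y \<in> carrier M" "t \<in> S"
  shows "mfrac x s = mfrac y t \<longleftrightarrow> (\<exists>u\<in>S. (u \<otimes> t) \<odot>\<^bsub>M\<^esub> x = (u \<otimes> s) \<odot>\<^bsub>M\<^esub> y)"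
  unfolding mfrac_def
  using assms eq_equiv_class_iff[OF equiv_mfrac_rel, of "(x, s)" "(y, t)"]
  by (simp add: mfrac_rel_def)

text \<open>Addition below uses a chosen representative in place of a union over all of them; by
  \<open>mfrac_add_cong\<close> the choice does not matter.\<close>

definition mfrac_rep :: "('c \<times> 'a) set \<Rightarrow> 'c \<times> 'a"
  where "mfrac_rep X = (SOME p. fst p \<in> carrier M \<and> snd p \<in> S \<and> X = mfrac (fst p) (snd p))"

lemma mfrac_rep:
  assumes "x \<in> carrier M" "s \<in> S"
  shows "fst (mfrac_rep (mfrac x s)) \<in> carrier M" "snd (mfrac_rep (mfrac x s)) \<in> S"
    "mfrac (fst (mfrac_rep (mfrac x s))) (snd (mfrac_rep (mfrac x s))) = mfrac x s"
  using someI_ex[of "\<lambda>p. fst p \<in> carrier M \<and> snd p \<in> S \<and> mfrac x s = mfrac (fst p) (snd p)"] assms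
  unfolding mfrac_rep_def by auto

text \<open>Only the additive group is built, in multiplicative notation, because it serves as the
  target of \<open>null_universal\<close>, which is a statement about abelian groups.\<close>

definition localized_group :: "('c \<times> 'a) set monoid"
  where "localized_group =
    \<lparr>carrier = {mfrac x s | x s. x \<in> carrier M \<and> s \<in> S},
     mult = (\<lambda>X Y. case mfrac_rep X of (x, s) \<Rightarrow> case mfrac_rep Y of (y, t) \<Rightarrow>
       mfrac (t \<odot>\<^bsub>M\<^esub> x \<oplus>\<^bsub>M\<^esub> s \<odot>\<^bsub>M\<^esub> y) (s \<otimes> t)),
     one = mfrac \<zero>\<^bsub>M\<^esub> \<one>\<rparr>"

lemma carrier_localized_group:
  "carrier localized_group = {mfrac x s | x s. x \<in> carrier M \<and> s \<in> S}"
  by (simp add: localized_group_def)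

lemma mfrac_closed [simp, intro]:
  "\<lbrakk>x \<in> carrier M; s \<in> S\<rbrakk> \<Longrightarrow> mfrac x s \<in> carrier localized_group"
  by (auto simp: carrier_localized_group)

lemma localized_group_cases:
  assumes "X \<in> carrier localized_group"
  obtains x s where "x \<in> carrier M" "s \<in> S" "X = mfrac x s"
  using assms by (auto simp: carrier_localized_group)

lemma one_localized_group: "\<one>\<^bsub>localized_group\<^esub> = mfrac \<zero>\<^bsub>M\<^esub> \<one>"
  by (simp add: localized_group_def)

lemma mfrac_add_cong:
  assumes "x \<in> carrier M" "s \<in> S" "y \<in> carrier M" "t \<in> S"
    "x' \<in> carrier M" "s' \<in> S" "y' \<in> carrier M" "t' \<in> S"
    "mfrac x s = mfrac x' s'" "mfrac y t = mfrac y' t'"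
  shows "mfrac (t \<odot>\<^bsub>M\<^esub> x \<oplus>\<^bsub>M\<^esub> s \<odot>\<^bsub>M\<^esub> y) (s \<otimes> t) = mfrac (t' \<odot>\<^bsub>M\<^esub> x' \<oplus>\<^bsub>M\<^esub> s' \<odot>\<^bsub>M\<^esub> y') (s' \<otimes> t')"
proof -
  obtain u v where uv: "u \<in> S" "v \<in> S" and e: "(u \<otimes> s') \<odot>\<^bsub>M\<^esub> x = (u \<otimes> s) \<odot>\<^bsub>M\<^esub> x'"
      "(v \<otimes> t') \<odot>\<^bsub>M\<^esub> y = (v \<otimes> t) \<odot>\<^bsub>M\<^esub> y'"
    using assms by (auto simp: mfrac_eq_iff)
  have "((u \<otimes> v) \<otimes> (s' \<otimes> t')) \<odot>\<^bsub>M\<^esub> (t \<odot>\<^bsub>M\<^esub> x \<oplus>\<^bsub>M\<^esub> s \<odot>\<^bsub>M\<^esub> y) =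
      (v \<otimes> t \<otimes> t') \<odot>\<^bsub>M\<^esub> ((u \<otimes> s') \<odot>\<^bsub>M\<^esub> x) \<oplus>\<^bsub>M\<^esub> (u \<otimes> s \<otimes> s') \<odot>\<^bsub>M\<^esub> ((v \<otimes> t') \<odot>\<^bsub>M\<^esub> y)"
    using assms(1-8) uv by (simp add: smult_r_distr smult_assoc1[symmetric] m_ac)
  also have "\<dots> = ((u \<otimes> v) \<otimes> (s \<otimes> t)) \<odot>\<^bsub>M\<^esub> (t' \<odot>\<^bsub>M\<^esub> x' \<oplus>\<^bsub>M\<^esub> s' \<odot>\<^bsub>M\<^esub> y')"
    unfolding e using assms(1-8) uv by (simp add: smult_r_distr smult_assoc1[symmetric] m_ac)
  finally show ?thesis
    using assms(1-8) uv S_mult by (subst mfrac_eq_iff) auto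
qed

lemma localized_group_mult:
  assumes "x \<in> carrier M" "s \<in> S" "y \<in> carrier M" "t \<in> S"
  shows "mfrac x s \<otimes>\<^bsub>localized_group\<^esub> mfrac y t = mfrac (t \<odot>\<^bsub>M\<^esub> x \<oplus>\<^bsub>M\<^esub> s \<odot>\<^bsub>M\<^esub> y) (s \<otimes> t)"
proof -
  have "mfrac x s \<otimes>\<^bsub>localized_group\<^esub> mfrac y t =
      mfrac (snd (mfrac_rep (mfrac y t)) \<odot>\<^bsub>M\<^esub> fst (mfrac_rep (mfrac x s))
        \<oplus>\<^bsub>M\<^esub> snd (mfrac_rep (mfrac x s)) \<odot>\<^bsub>M\<^esub> fst (mfrac_rep (mfrac y t)))
       (snd (mfrac_rep (mfrac x s)) \<otimes> snd (mfrac_rep (mfrac y t)))"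
    by (simp add: localized_group_def split_beta)
  also have "\<dots> = mfrac (t \<odot>\<^bsub>M\<^esub> x \<oplus>\<^bsub>M\<^esub> s \<odot>\<^bsub>M\<^esub> y) (s \<otimes> t)"
    by (rule mfrac_add_cong) (fact assms mfrac_rep[OF assms(1,2)] mfrac_rep[OF assms(3,4)])+
  finally show ?thesis .
qed

lemma mfracI:
  assumes "x \<in> carrier M" "s \<in> S" "y \<in> carrier M" "t \<in> S" "t \<odot>\<^bsub>M\<^esub> x = s \<odot>\<^bsub>M\<^esub> y"
  shows "mfrac x s = mfrac y t"
  using assms S_one by (subst mfrac_eq_iff) (auto intro!: bexI[of _ \<one>])

lemma localized_group_assoc:
  assumes "x \<in> carrier M" "s \<in> S" "y \<in> carrier M" "t \<in> S" "z \<in> carrier M" "u \<in> S"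
  shows "mfrac x s \<otimes>\<^bsub>localized_group\<^esub> mfrac y t \<otimes>\<^bsub>localized_group\<^esub> mfrac z u =
    mfrac x s \<otimes>\<^bsub>localized_group\<^esub> (mfrac y t \<otimes>\<^bsub>localized_group\<^esub> mfrac z u)"
  using assms S_mult
  by (simp add: localized_group_mult)
    (rule mfracI; simp add: smult_r_distr smult_assoc1[symmetric] m_ac M.add.m_ac)

lemma comm_group_localized_group: "comm_group localized_group"
proof (rule comm_groupI)
  fix X Y Z
  assume "X \<in> carrier localized_group" "Y \<in> carrier localized_group" "Z \<in> carrier localized_group"
  then show "X \<otimes>\<^bsub>localized_group\<^esub> Y \<otimes>\<^bsub>localized_group\<^esub> Z =
      X \<otimes>\<^bsub>localized_group\<^esub> (Y \<otimes>\<^bsub>localized_group\<^esub> Z)"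
    by (elim localized_group_cases) (simp only: localized_group_assoc)
next
  fix X Y
  assume "X \<in> carrier localized_group" "Y \<in> carrier localized_group"
  then obtain x s y t where *: "x \<in> carrier M" "s \<in> S" "y \<in> carrier M" "t \<in> S" "X = mfrac x s" "Y = mfrac y t"
    by (elim localized_group_cases)
  show "X \<otimes>\<^bsub>localized_group\<^esub> Y \<in> carrier localized_group"
    using * S_mult by (simp add: localized_group_mult)
  show "X \<otimes>\<^bsub>localized_group\<^esub> Y = Y \<otimes>\<^bsub>localized_group\<^esub> X"
    unfolding *(5,6) using *(1-4) by (simp add: localized_group_mult m_comm[of s t] M.add.m_comm)
next
  show "\<one>\<^bsub>localized_group\<^esub> \<in> carrier localized_group"
    using S_one by (simp add: one_localized_group)
next
  fix X
  assume "X \<in> carrier localized_group"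
  then obtain x s where *: "x \<in> carrier M" "s \<in> S" "X = mfrac x s"
    by (elim localized_group_cases)
  show "\<one>\<^bsub>localized_group\<^esub> \<otimes>\<^bsub>localized_group\<^esub> X = X"
    using * S_one by (simp add: one_localized_group localized_group_mult)
  have "mfrac (\<ominus>\<^bsub>M\<^esub> x) s \<otimes>\<^bsub>localized_group\<^esub> X = \<one>\<^bsub>localized_group\<^esub>"
  proof -
    have "mfrac \<zero>\<^bsub>M\<^esub> (s \<otimes> s) = mfrac \<zero>\<^bsub>M\<^esub> \<one>"
      using *(2) S_one S_mult by (intro mfracI) auto
    then show ?thesis
      using * by (simp add: one_localized_group localized_group_mult smult_r_minus M.l_neg)
  qed
  then show "\<exists>Y\<in>carrier localized_group. Y \<otimes>\<^bsub>localized_group\<^esub> X = \<one>\<^bsub>localized_group\<^esub>"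
    using * by (intro bexI[of _ "mfrac (\<ominus>\<^bsub>M\<^esub> x) s"]) auto
qed

end

subsection \<open>Extension of scalars\<close>

locale scalar_extension = module R M + L: cring L
  for R (structure) and M (structure) and L :: "('s, 'k) ring_scheme" +
  fixes h
  assumes h_closed [simp]: "r \<in> carrier R \<Longrightarrow> h r \<in> carrier L"
begin

abbreviation "rels \<equiv> tensor_rels R M (restrict_scalars h L)"
abbreviation "null \<equiv> tensor_null R M (restrict_scalars h L)"
abbreviation "G \<equiv> free_Abelian_group (carrier M \<times> carrier L)"
abbreviation "T \<equiv> base_change R M L h"

definition tens :: "'c \<Rightarrow> 's \<Rightarrow> ('c \<times> 's \<Rightarrow>\<^sub>0 int) set"
  where "tens x X = null #>\<^bsub>G\<^esub> frag_of (x, X)"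

lemma restrict_scalars_simps [simp]:
  "carrier (restrict_scalars h L) = carrier L"
  "add (restrict_scalars h L) = add L"
  "smult (restrict_scalars h L) r X = h r \<otimes>\<^bsub>L\<^esub> X"
  by (simp_all add: restrict_scalars_def ring.defs module.defs)

lemma null_eq: "null = generate G rels"
  by (simp add: tensor_null_def)

lemma rels_carrier: "rels \<subseteq> carrier G"
proof
  fix f
  assume "f \<in> rels"
  then show "f \<in> carrier G"
    using keys_diff unfolding tensor_rels_def
    by (auto dest!: subsetD[OF keys_diff] simp: keys_add)
qed

lemma subgroup_null: "subgroup null G"
  unfolding null_eq by (intro group.generate_is_subgroup group_free_Abelian_group rels_carrier)

lemma null_carrier: "f \<in> null \<Longrightarrow> f \<in> carrier G"
  by (rule subgroup.mem_carrier[OF subgroup_null])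

lemma null_0 [simp]: "0 \<in> null"
  using subgroup.one_closed[OF subgroup_null] by simp

lemma null_add: "\<lbrakk>f \<in> null; g \<in> null\<rbrakk> \<Longrightarrow> f + g \<in> null"
  using subgroup.m_closed[OF subgroup_null] by simp

lemma null_uminus: "f \<in> null \<Longrightarrow> - f \<in> null"
  using subgroup.m_inv_closed[OF subgroup_null] null_carrier by fastforce

lemma null_diff: "\<lbrakk>f \<in> null; g \<in> null\<rbrakk> \<Longrightarrow> f - g \<in> null"
  using null_add[OF _ null_uminus] by fastforce

lemma rels_null: "f \<in> rels \<Longrightarrow> f \<in> null"
  unfolding null_eq by (rule generate.incl)

lemma null_coset: "null #>\<^bsub>G\<^esub> f = (\<lambda>n. n + f) ` null"
  by (auto simp: r_coset_def)

lemma null_coset_eq_iff: "null #>\<^bsub>G\<^esub> f = null #>\<^bsub>G\<^esub> g \<longleftrightarrow> f - g \<in> null"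
proof
  assume "null #>\<^bsub>G\<^esub> f = null #>\<^bsub>G\<^esub> g"
  then have "0 + f \<in> (\<lambda>n. n + g) ` null"
    unfolding null_coset using null_0 by blast
  then show "f - g \<in> null" by auto
next
  assume fg: "f - g \<in> null"
  have "n + f \<in> (\<lambda>n. n + g) ` null" if "n \<in> null" for n
    by (rule image_eqI[of _ _ "n + (f - g)"]) (use that fg null_add in auto)
  moreover have "n + g \<in> (\<lambda>n. n + f) ` null" if "n \<in> null" for n
    by (rule image_eqI[of _ _ "n - (f - g)"]) (use that fg null_diff in auto)
  ultimately show "null #>\<^bsub>G\<^esub> f = null #>\<^bsub>G\<^esub> g"
    unfolding null_coset by blast
qed

lemma carrier_T: "carrier T = {null #>\<^bsub>G\<^esub> f | f. f \<in> carrier G}"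
  by (auto simp: base_change_def tensor_group_def FactGroup_def RCOSETS_def Let_def)

lemma tens_closed [simp, intro]: "\<lbrakk>x \<in> carrier M; X \<in> carrier L\<rbrakk> \<Longrightarrow> tens x X \<in> carrier T"
  by (force simp: carrier_T tens_def)

lemma zero_T: "\<zero>\<^bsub>T\<^esub> = null"
  by (simp add: base_change_def tensor_group_def FactGroup_def Let_def)

lemma add_T: "(null #>\<^bsub>G\<^esub> f) \<oplus>\<^bsub>T\<^esub> (null #>\<^bsub>G\<^esub> g) = null #>\<^bsub>G\<^esub> (f + g)"
proof -
  have "(null #>\<^bsub>G\<^esub> f) \<oplus>\<^bsub>T\<^esub> (null #>\<^bsub>G\<^esub> g) = (\<Union>a\<in>null. \<Union>b\<in>null. {(a + f) + (b + g)})"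
    by (auto simp: base_change_def tensor_group_def FactGroup_def Let_def set_mult_def null_coset)
  also have "\<dots> = (\<lambda>n. n + (f + g)) ` null"
  proof (intro equalityI subsetI)
    fix k
    assume "k \<in> (\<Union>a\<in>null. \<Union>b\<in>null. {(a + f) + (b + g)})"
    then obtain a b where "a \<in> null" "b \<in> null" "k = (a + b) + (f + g)"
      by (auto simp: algebra_simps)
    then show "k \<in> (\<lambda>n. n + (f + g)) ` null" using null_add by blast
  next
    fix k
    assume "k \<in> (\<lambda>n. n + (f + g)) ` null"
    then obtain a where a: "a \<in> null" "k = (a + f) + (0 + g)"
      by (auto simp: algebra_simps)
    then show "k \<in> (\<Union>a\<in>null. \<Union>b\<in>null. {(a + f) + (b + g)})"
      using null_0 by blast
  qed
  finally show ?thesis by (simp add: null_coset)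
qed

lemma frag_add_left_null:
  assumes "x \<in> carrier M" "y \<in> carrier M" "X \<in> carrier L"
  shows "frag_of (x \<oplus>\<^bsub>M\<^esub> y, X) - frag_of (x, X) - frag_of (y, X) \<in> null"
  by (rule rels_null) (use assms in \<open>force simp: tensor_rels_def\<close>)

lemma frag_add_right_null:
  assumes "x \<in> carrier M" "X \<in> carrier L" "Y \<in> carrier L"
  shows "frag_of (x, X \<oplus>\<^bsub>L\<^esub> Y) - frag_of (x, X) - frag_of (x, Y) \<in> null"
  by (rule rels_null) (use assms in \<open>force simp: tensor_rels_def\<close>)

lemma frag_smult_null:
  assumes "r \<in> carrier R" "x \<in> carrier M" "X \<in> carrier L"
  shows "frag_of (r \<odot>\<^bsub>M\<^esub> x, X) - frag_of (x, h r \<otimes>\<^bsub>L\<^esub> X) \<in> null"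
  by (rule rels_null) (use assms in \<open>force simp: tensor_rels_def\<close>)

lemma tens_add_left:
  assumes "x \<in> carrier M" "y \<in> carrier M" "X \<in> carrier L"
  shows "tens (x \<oplus>\<^bsub>M\<^esub> y) X = tens x X \<oplus>\<^bsub>T\<^esub> tens y X"
  unfolding tens_def add_T null_coset_eq_iff using frag_add_left_null[OF assms] by (simp add: algebra_simps)

lemma tens_smult_left:
  assumes "r \<in> carrier R" "x \<in> carrier M" "X \<in> carrier L"
  shows "tens (r \<odot>\<^bsub>M\<^esub> x) X = tens x (h r \<otimes>\<^bsub>L\<^esub> X)"
  unfolding tens_def null_coset_eq_iff using frag_smult_null[OF assms] .

lemma tens_zero_left:
  assumes "X \<in> carrier L"
  shows "tens \<zero>\<^bsub>M\<^esub> X = \<zero>\<^bsub>T\<^esub>"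
proof -
  have "- frag_of (\<zero>\<^bsub>M\<^esub>, X) \<in> null"
    using frag_add_left_null[OF M.zero_closed M.zero_closed assms] by simp
  then have "frag_of (\<zero>\<^bsub>M\<^esub>, X) - 0 \<in> null"
    using null_uminus by fastforce
  then have "tens \<zero>\<^bsub>M\<^esub> X = null #>\<^bsub>G\<^esub> 0"
    unfolding tens_def null_coset_eq_iff .
  then show ?thesis by (simp add: zero_T null_coset)
qed

text \<open>This makes the scalar multiplication of \<open>base_change\<close> well defined on
  cosets. Each relation is sent to a relation; for the third kind, Y is moved past
  \<open>h r\<close> by commutativity of L.\<close>

lemma frag_extend_null:
  assumes "f \<in> null" "Y \<in> carrier L"
  shows "frag_extend (\<lambda>(x, X). frag_of (x, Y \<otimes>\<^bsub>L\<^esub> X)) f \<in> null"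
  using assms(1) unfolding null_eq
proof (induction rule: generate.induct)
  case one
  then show ?case using null_0 by (simp add: null_eq)
next
  have smult: "frag_of (r \<odot>\<^bsub>M\<^esub> x, Y \<otimes>\<^bsub>L\<^esub> X) - frag_of (x, Y \<otimes>\<^bsub>L\<^esub> (h r \<otimes>\<^bsub>L\<^esub> X)) \<in> null"
    if "r \<in> carrier R" "x \<in> carrier M" "X \<in> carrier L" for r x X
    using frag_smult_null[of r x "Y \<otimes>\<^bsub>L\<^esub> X"] that assms(2) by (simp add: L.m_lcomm)
  have *: "frag_extend (\<lambda>(x, X). frag_of (x, Y \<otimes>\<^bsub>L\<^esub> X)) f \<in> null" if "f \<in> rels" for f
    using that frag_add_left_null frag_add_right_null smult assms(2)
    by (auto simp: tensor_rels_def frag_extend_diff L.r_distr)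
  case (incl f)
  then show ?case using * by (simp add: null_eq)
  case (inv f)
  then have "inv\<^bsub>G\<^esub> f = - f"
    using subsetD[OF rels_carrier inv] by simp
  then show ?case using null_uminus[OF *[OF inv]] by (simp add: null_eq frag_extend_minus)
next
  case (eng f g)
  then show ?case using null_add by (simp add: null_eq frag_extend_add)
qed

lemma smult_tens:
  assumes "x \<in> carrier M" "X \<in> carrier L" "Y \<in> carrier L"
  shows "Y \<odot>\<^bsub>T\<^esub> tens x X = tens x (Y \<otimes>\<^bsub>L\<^esub> X)"
proof -
  let ?E = "frag_extend (\<lambda>(x, X). frag_of (x, Y \<otimes>\<^bsub>L\<^esub> X))"
  have "null #>\<^bsub>G\<^esub> ?E f = tens x (Y \<otimes>\<^bsub>L\<^esub> X)" if f: "f \<in> tens x X" for f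
  proof -
    obtain n where "n \<in> null" "f = n + frag_of (x, X)"
      using f unfolding tens_def null_coset by blast
    then show ?thesis
      using frag_extend_null[OF _ assms(3)] by (simp add: tens_def null_coset_eq_iff frag_extend_add)
  qed
  moreover have "frag_of (x, X) \<in> tens x X"
    unfolding tens_def null_coset by (rule image_eqI[of _ _ 0]) simp_all
  moreover have "Y \<odot>\<^bsub>T\<^esub> tens x X = (\<Union>f\<in>tens x X. null #>\<^bsub>G\<^esub> ?E f)"
    by (simp add: base_change_def Let_def)
  ultimately show ?thesis
    by (simp only:) (rule UN_constant_eq; simp)
qed

text \<open>The universal property of the tensor product, reduced to the one consequence required: a
  balanced map sends (x, X) to the neutral element whenever the tensor of x and X is zero. The map
  extends to the free abelian group, and its kernel contains the relations, hence the subgroup they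
  generate.\<close>

lemma null_universal:
  assumes "comm_group H" "\<And>x X. \<lbrakk>x \<in> carrier M; X \<in> carrier L\<rbrakk> \<Longrightarrow> b x X \<in> carrier H"
    and "\<And>x y X. \<lbrakk>x \<in> carrier M; y \<in> carrier M; X \<in> carrier L\<rbrakk> \<Longrightarrow> b (x \<oplus>\<^bsub>M\<^esub> y) X = b x X \<otimes>\<^bsub>H\<^esub> b y X"
    and "\<And>x X Y. \<lbrakk>x \<in> carrier M; X \<in> carrier L; Y \<in> carrier L\<rbrakk> \<Longrightarrow> b x (X \<oplus>\<^bsub>L\<^esub> Y) = b x X \<otimes>\<^bsub>H\<^esub> b x Y"
    and "\<And>r x X. \<lbrakk>r \<in> carrier R; x \<in> carrier M; X \<in> carrier L\<rbrakk> \<Longrightarrow> b (r \<odot>\<^bsub>M\<^esub> x) X = b x (h r \<otimes>\<^bsub>L\<^esub> X)"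
    and "x \<in> carrier M" "X \<in> carrier L" "tens x X = \<zero>\<^bsub>T\<^esub>"
  shows "b x X = \<one>\<^bsub>H\<^esub>"
proof -
  interpret H: comm_group H by fact
  obtain \<beta> where \<beta>: "\<beta> \<in> hom G H"
      "\<And>p. p \<in> carrier M \<times> carrier L \<Longrightarrow> \<beta> (frag_of p) = (case p of (x, X) \<Rightarrow> b x X)"
    by (rule H.free_Abelian_group_universal[of "\<lambda>(x, X). b x X" "carrier M \<times> carrier L"])
      (use assms(2) in auto)
  interpret \<beta>: group_hom G H \<beta>
    by (intro group_hom.intro group_hom_axioms.intro \<beta>(1) group_free_Abelian_group H.group_axioms)
  have add: "\<beta> (f + g) = \<beta> f \<otimes>\<^bsub>H\<^esub> \<beta> g" if "f \<in> carrier G" "g \<in> carrier G" for f g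
    using \<beta>.hom_mult[OF that] by simp
  have diff0: "\<beta> (f - g) = \<one>\<^bsub>H\<^esub>" if "f \<in> carrier G" "g \<in> carrier G" "\<beta> f = \<beta> g" for f g
  proof -
    have c: "f - g \<in> carrier G" using that keys_diff[of f g] by auto
    then have "\<beta> (f - g) \<otimes>\<^bsub>H\<^esub> \<beta> g = \<beta> f" using add[OF c that(2)] by simp
    then show ?thesis using that c by (metis H.l_cancel_one' \<beta>.hom_closed H.r_cancel_one)
  qed
  have diff0': "\<beta> (f - g - k) = \<one>\<^bsub>H\<^esub>"
    if "f \<in> carrier G" "g \<in> carrier G" "k \<in> carrier G" "\<beta> f = \<beta> g \<otimes>\<^bsub>H\<^esub> \<beta> k" for f g k
  proof -
    have c: "g + k \<in> carrier G" using that keys_add[of g k] by auto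
    then have "\<beta> (f - (g + k)) = \<one>\<^bsub>H\<^esub>" using that add by (intro diff0) auto
    then show ?thesis by (simp add: algebra_simps)
  qed
  have "rels \<subseteq> kernel G H \<beta>"
  proof
    fix f
    assume f: "f \<in> rels"
    have "\<beta> f = \<one>\<^bsub>H\<^esub>"
      using f unfolding tensor_rels_def
      by (elim UnE CollectE exE conjE; hypsubst; intro diff0' diff0) (simp_all add: \<beta>(2) assms(3-5))
    then show "f \<in> kernel G H \<beta>"
      using subsetD[OF rels_carrier f] by (simp add: kernel_def)
  qed
  then have "null \<subseteq> kernel G H \<beta>"
    unfolding null_eq
    by (intro group.generate_subgroup_incl \<beta>.subgroup_kernel group_free_Abelian_group)
  moreover have "frag_of (x, X) \<in> null"
    using assms(8) null_coset_eq_iff[of "frag_of (x, X)" 0]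
    by (simp add: tens_def zero_T null_coset[of 0])
  ultimately show ?thesis
    using \<beta>(2)[of "(x, X)"] assms(6,7) by (auto simp: kernel_def)
qed

end

text \<open>The fractions \<open>y\<^sub>i/1\<close> form a basis of the localization of \<open>M\<close> at \<open>S\<close>, with denominators cleared.\<close>

definition basis_up_to ::
    "('r, 'm) ring_scheme \<Rightarrow> ('r, 'a, 'n) module_scheme \<Rightarrow> 'r set \<Rightarrow> nat \<Rightarrow> (nat \<Rightarrow> 'a) \<Rightarrow> bool"
  where "basis_up_to R M S n y \<longleftrightarrow> y \<in> {..<n} \<rightarrow> carrier M \<and>
    (\<forall>x\<in>carrier M. \<exists>t\<in>S. \<exists>c\<in>{..<n} \<rightarrow> carrier R.
      t \<odot>\<^bsub>M\<^esub> x = (\<Oplus>\<^bsub>M\<^esub>i\<in>{..<n}. c i \<odot>\<^bsub>M\<^esub> y i)) \<and>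
    (\<forall>c\<in>{..<n} \<rightarrow> carrier R. (\<Oplus>\<^bsub>M\<^esub>i\<in>{..<n}. c i \<odot>\<^bsub>M\<^esub> y i) = \<zero>\<^bsub>M\<^esub> \<longrightarrow>
      (\<forall>i<n. \<exists>t\<in>S. t \<otimes>\<^bsub>R\<^esub> c i = \<zero>\<^bsub>R\<^esub>))"

section \<open>From a free localized module to a basis with cleared denominators\<close>

context denominators_module
begin

abbreviation "RS \<equiv> localization R S"
abbreviation "frac1 \<equiv> \<lambda>r. fraction R S r \<one>"
abbreviation "MS \<equiv> base_change R M RS frac1"

text \<open>The balanced map that sends (x, a/s) to the fraction ax/s. A fraction is a class, so a
  representative has to be chosen.\<close>

definition mval :: "'c \<Rightarrow> ('a \<times> 'a) set \<Rightarrow> ('c \<times> 'a) set"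
  where "mval x X = (let p = SOME p. fst p \<in> carrier R \<and> snd p \<in> S \<and> X = fraction R S (fst p) (snd p)
    in mfrac (fst p \<odot>\<^bsub>M\<^esub> x) (snd p))"

lemma mval_fraction:
  assumes "x \<in> carrier M" "a \<in> carrier R" "s \<in> S"
  shows "mval x (fraction R S a s) = mfrac (a \<odot>\<^bsub>M\<^esub> x) s"
proof -
  define p where
    "p = (SOME p. fst p \<in> carrier R \<and> snd p \<in> S \<and> fraction R S a s = fraction R S (fst p) (snd p))"
  have p: "fst p \<in> carrier R" "snd p \<in> S" "fraction R S a s = fraction R S (fst p) (snd p)"
    using someI_ex[of "\<lambda>p. fst p \<in> carrier R \<and> snd p \<in> S \<and>
      fraction R S a s = fraction R S (fst p) (snd p)"] assms unfolding p_def by auto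
  then obtain t where t: "t \<in> S" "t \<otimes> (snd p \<otimes> a) = t \<otimes> (s \<otimes> fst p)"
    using assms fraction_eq_iff by auto
  have "(t \<otimes> snd p) \<odot>\<^bsub>M\<^esub> (a \<odot>\<^bsub>M\<^esub> x) = (t \<otimes> (snd p \<otimes> a)) \<odot>\<^bsub>M\<^esub> x"
    using assms p t(1) by (simp add: smult_assoc1)
  also have "\<dots> = (t \<otimes> s) \<odot>\<^bsub>M\<^esub> (fst p \<odot>\<^bsub>M\<^esub> x)"
    unfolding t(2) using assms p t(1) by (simp add: smult_assoc1)
  finally have "mfrac (a \<odot>\<^bsub>M\<^esub> x) s = mfrac (fst p \<odot>\<^bsub>M\<^esub> x) (snd p)"
    using assms p t(1) by (subst mfrac_eq_iff) auto
  then show ?thesis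
    by (simp add: mval_def p_def Let_def)
qed

lemma scalar_extension_fractions: "cring RS \<Longrightarrow> scalar_extension R M RS frac1"
  unfolding scalar_extension_def scalar_extension_axioms_def
  using module_axioms S_one by auto

text \<open>The balanced map \<open>mval\<close> takes (x, 1) to x/1. If the tensor vanishes, x/1 is
  zero in the explicit model, which means that some denominator kills x.\<close>

lemma tens_one_eq_zero:
  assumes "cring RS" and x: "x \<in> carrier M"
    and "scalar_extension.tens R M RS frac1 x \<one>\<^bsub>RS\<^esub> = \<zero>\<^bsub>MS\<^esub>"
  shows "\<exists>t\<in>S. t \<odot>\<^bsub>M\<^esub> x = \<zero>\<^bsub>M\<^esub>"
proof -
  interpret scalar_extension R M RS frac1
    by (rule scalar_extension_fractions[OF assms(1)])
  have "mval x \<one>\<^bsub>RS\<^esub> = \<one>\<^bsub>localized_group\<^esub>"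
  proof (rule null_universal[OF comm_group_localized_group _ _ _ _ x L.one_closed assms(3)])
    fix x X assume "x \<in> carrier M" "X \<in> carrier RS"
    then show "mval x X \<in> carrier localized_group"
      by (auto elim!: fraction_cases simp: mval_fraction)
  next
    fix x y X assume "x \<in> carrier M" "y \<in> carrier M" "X \<in> carrier RS"
    then show "mval (x \<oplus>\<^bsub>M\<^esub> y) X = mval x X \<otimes>\<^bsub>localized_group\<^esub> mval y X"
      using S_mult
      by (elim fraction_cases)
        (simp add: mval_fraction localized_group_mult, rule mfracI; simp add: smult_r_distr smult_assoc1 m_assoc)
  next
    fix x X Y assume "x \<in> carrier M" "X \<in> carrier RS" "Y \<in> carrier RS"
    then show "mval x (X \<oplus>\<^bsub>RS\<^esub> Y) = mval x X \<otimes>\<^bsub>localized_group\<^esub> mval x Y"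
      using S_mult
      by (elim fraction_cases)
        (simp add: mval_fraction localized_group_mult localization_add smult_l_distr smult_assoc1)
  next
    fix r x X assume "r \<in> carrier R" "x \<in> carrier M" "X \<in> carrier RS"
    then show "mval (r \<odot>\<^bsub>M\<^esub> x) X = mval x (frac1 r \<otimes>\<^bsub>RS\<^esub> X)"
      using S_one
      by (elim fraction_cases)
        (simp add: mval_fraction localization_mult smult_assoc1[symmetric] R.m_comm)
  qed
  then have "mfrac x \<one> = mfrac \<zero>\<^bsub>M\<^esub> \<one>"
    using x S_one by (simp add: localization_one mval_fraction one_localized_group)
  then show ?thesis
    using x S_one by (simp add: mfrac_eq_iff)
qed

lemma frac1_mult: "\<lbrakk>a \<in> carrier R; b \<in> carrier R\<rbrakk> \<Longrightarrow> frac1 a \<otimes>\<^bsub>RS\<^esub> frac1 b = frac1 (a \<otimes> b)"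
  using S_one by (simp add: localization_mult)

lemma frac1_denominator:
  "\<lbrakk>a \<in> carrier R; s \<in> S\<rbrakk> \<Longrightarrow> frac1 s \<otimes>\<^bsub>RS\<^esub> fraction R S a s = frac1 a"
  using S_one by (auto simp: localization_mult fraction_eq_iff intro!: bexI[of _ \<one>])

lemma common_denominator:
  assumes "cring RS" "finite I" "a \<in> I \<rightarrow> carrier RS"
  shows "\<exists>t\<in>S. \<exists>c\<in>I \<rightarrow> carrier R. \<forall>i\<in>I. frac1 t \<otimes>\<^bsub>RS\<^esub> a i = frac1 (c i)"
  using assms(2,3)
proof (induction I)
  case empty
  then show ?case using S_one by auto
next
  case (insert j I)
  interpret RS: cring RS by fact
  obtain t c where t: "t \<in> S" and c: "c \<in> I \<rightarrow> carrier R" "\<And>i. i \<in> I \<Longrightarrow> frac1 t \<otimes>\<^bsub>RS\<^esub> a i = frac1 (c i)"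
    using insert by auto
  obtain b u where b: "b \<in> carrier R" "u \<in> S" "a j = fraction R S b u"
    using insert.prems fraction_cases by (metis PiE insertI1)
  have tu: "frac1 (t \<otimes> u) \<otimes>\<^bsub>RS\<^esub> X = frac1 t \<otimes>\<^bsub>RS\<^esub> (frac1 u \<otimes>\<^bsub>RS\<^esub> X)"
    "frac1 (t \<otimes> u) \<otimes>\<^bsub>RS\<^esub> X = frac1 u \<otimes>\<^bsub>RS\<^esub> (frac1 t \<otimes>\<^bsub>RS\<^esub> X)" if "X \<in> carrier RS" for X
    using that t b S_one by (simp_all add: frac1_mult[symmetric] RS.m_assoc RS.m_lcomm)
  \<comment> \<open>The common denominator becomes t u: old numerators are multiplied by the new
    denominator u, the new numerator b by the old denominator t.\<close>
  define c' where "c' i = (if i = j then t \<otimes> b else u \<otimes> c i)" for i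
  have "frac1 (t \<otimes> u) \<otimes>\<^bsub>RS\<^esub> a i = frac1 (c' i)" if i: "i \<in> insert j I" for i
  proof (cases "i = j")
    case True
    then show ?thesis
      using t b by (simp add: tu(1) frac1_denominator frac1_mult c'_def)
  next
    case False
    then have "i \<in> I" using i by simp
    moreover have "a i \<in> carrier RS" using insert.prems i by auto
    moreover have "c i \<in> carrier R" using c(1) \<open>i \<in> I\<close> by auto
    ultimately show ?thesis
      using False b c(2) by (simp add: tu(2) frac1_mult c'_def)
  qed
  moreover have "c' \<in> insert j I \<rightarrow> carrier R"
    using t b funcset_mem[OF c(1)] by (auto simp: c'_def)
  ultimately show ?case
    using S_mult[OF t b(2)] by blast
qed

text \<open>Two tensors can be brought to the common denominator 1/(st) in the second factor,
  because scalars of R move across the tensor sign; there they combine into one.\<close>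

lemma tens_fraction_one:
  assumes "cring RS" "w \<in> carrier MS"
  shows "\<exists>x\<in>carrier M. \<exists>s\<in>S. w = scalar_extension.tens R M RS frac1 x (fraction R S \<one> s)"
proof -
  interpret scalar_extension R M RS frac1
    by (rule scalar_extension_fractions[OF assms(1)])
  obtain f where f: "Poly_Mapping.keys f \<subseteq> carrier M \<times> carrier RS" "w = null #>\<^bsub>G\<^esub> f"
    using assms(2) by (auto simp: carrier_T)
  have "\<exists>x\<in>carrier M. \<exists>s\<in>S. null #>\<^bsub>G\<^esub> f = tens x (fraction R S \<one> s)"
  proof (rule free_Abelian_group_induct[OF f(1)])
    have "null #>\<^bsub>G\<^esub> 0 = tens \<zero>\<^bsub>M\<^esub> (fraction R S \<one> \<one>)"
      using S_one by (subst tens_zero_left) (simp_all add: zero_T null_coset)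
    then show "\<exists>x\<in>carrier M. \<exists>s\<in>S. null #>\<^bsub>G\<^esub> 0 = tens x (fraction R S \<one> s)"
      using S_one by auto
  next
    fix f g
    assume "\<exists>x\<in>carrier M. \<exists>s\<in>S. null #>\<^bsub>G\<^esub> f = tens x (fraction R S \<one> s)"
      "\<exists>x\<in>carrier M. \<exists>s\<in>S. null #>\<^bsub>G\<^esub> g = tens x (fraction R S \<one> s)"
    then obtain x s y t where *: "x \<in> carrier M" "s \<in> S" "y \<in> carrier M" "t \<in> S"
      and f: "null #>\<^bsub>G\<^esub> f = tens x (fraction R S \<one> s)" and g: "null #>\<^bsub>G\<^esub> g = tens y (fraction R S \<one> t)"
      by auto
    let ?q = "fraction R S \<one> (s \<otimes> t)"
    have q: "?q \<in> carrier RS" using * S_mult by auto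
    have "fraction R S \<one> s = frac1 t \<otimes>\<^bsub>RS\<^esub> ?q" "fraction R S \<one> t = frac1 s \<otimes>\<^bsub>RS\<^esub> ?q"
      using * S_one S_mult by (auto simp: localization_mult fraction_eq_iff m_comm intro!: bexI[of _ \<one>])
    then have f': "null #>\<^bsub>G\<^esub> f = tens (t \<odot>\<^bsub>M\<^esub> x) ?q" and g': "null #>\<^bsub>G\<^esub> g = tens (s \<odot>\<^bsub>M\<^esub> y) ?q"
      using f g * q by (simp_all add: tens_smult_left)
    \<comment> \<open>The candidate for f - g. It is confirmed by adding g back, which needs only
      additivity of \<open>tens\<close> in the first argument.\<close>
    let ?z = "t \<odot>\<^bsub>M\<^esub> x \<ominus>\<^bsub>M\<^esub> s \<odot>\<^bsub>M\<^esub> y"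
    have "?z \<oplus>\<^bsub>M\<^esub> s \<odot>\<^bsub>M\<^esub> y = t \<odot>\<^bsub>M\<^esub> x"
      using * by (simp add: M.minus_eq M.a_assoc M.l_neg)
    then have "tens ?z ?q \<oplus>\<^bsub>T\<^esub> (null #>\<^bsub>G\<^esub> g) = null #>\<^bsub>G\<^esub> f"
      using * q unfolding f' g' by (subst tens_add_left[symmetric]) auto
    then have "null #>\<^bsub>G\<^esub> (frag_of (?z, ?q) + g) = null #>\<^bsub>G\<^esub> f"
      unfolding tens_def add_T .
    then have "null #>\<^bsub>G\<^esub> (f - g) = tens ?z ?q"
      unfolding tens_def null_coset_eq_iff
      using null_uminus[of "frag_of (?z, ?q) + g - f"] by (simp add: algebra_simps)
    then show "\<exists>x\<in>carrier M. \<exists>s\<in>S. null #>\<^bsub>G\<^esub> (f - g) = tens x (fraction R S \<one> s)"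
      using * S_mult by (intro bexI[of _ ?z] bexI[of _ "s \<otimes> t"]) auto
  next
    fix p
    assume "p \<in> carrier M \<times> carrier RS"
    then obtain x a s where p: "p = (x, fraction R S a s)" "x \<in> carrier M" "a \<in> carrier R" "s \<in> S"
      by (auto elim!: fraction_cases)
    have "fraction R S a s = frac1 a \<otimes>\<^bsub>RS\<^esub> fraction R S \<one> s"
      using p S_one by (simp add: localization_mult)
    then have "null #>\<^bsub>G\<^esub> frag_of p = tens (a \<odot>\<^bsub>M\<^esub> x) (fraction R S \<one> s)"
      using p tens_smult_left[of a x "fraction R S \<one> s"] by (simp add: tens_def)
    then show "\<exists>x\<in>carrier M. \<exists>s\<in>S. null #>\<^bsub>G\<^esub> frag_of p = tens x (fraction R S \<one> s)"
      using p by auto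
  qed
  then show ?thesis using f(2) by simp
qed

text \<open>Each basis vector is y/s for some y in M and s in S. As 1/s is a unit of the localized
  ring, the numerators y alone also form a basis.\<close>

lemma basis_up_to_denominators:
  assumes "free_module_of_rank RS MS n"
  shows "\<exists>y. basis_up_to R M S n y"
proof -
  from assms interpret MS: module RS MS
    by (simp add: free_module_of_rank_def)
  \<comment> \<open>Freeness includes the module axioms, and these contain that the localized ring
    is a commutative ring.\<close>
  have RS: "cring RS" ..
  interpret scalar_extension R M RS frac1
    by (rule scalar_extension_fractions[OF RS])
  obtain B where B: "finite B" "card B = n" "B \<subseteq> carrier MS" "\<not> MS.lin_dep B" "MS.span B = carrier MS"
    using assms by (auto simp: free_module_of_rank_def)
  obtain e where e: "bij_betw e {..<n} B"
    using ex_bij_betw_nat_finite[OF B(1)] B(2) by (auto simp: atLeast0LessThan)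
  have eB: "e i \<in> B" "e i \<in> carrier MS" if "i < n" for i
    using bij_betwE[OF e] that B(3) by auto
  have lincomb: "MS.lincomb a B = (\<Oplus>\<^bsub>MS\<^esub>i\<in>{..<n}. a (e i) \<odot>\<^bsub>MS\<^esub> e i)" if "a \<in> B \<rightarrow> carrier RS" for a
  proof -
    have "MS.lincomb a B = (\<Oplus>\<^bsub>MS\<^esub>v\<in>e ` {..<n}. a v \<odot>\<^bsub>MS\<^esub> v)"
      using e by (simp add: MS.lincomb_def bij_betw_def)
    also have "\<dots> = (\<Oplus>\<^bsub>MS\<^esub>i\<in>{..<n}. a (e i) \<odot>\<^bsub>MS\<^esub> e i)"
      using that B(3) e by (intro MS.add.finprod_reindex) (auto simp: bij_betw_def)
    finally show ?thesis .
  qed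
  have "\<forall>i. \<exists>x s. i < n \<longrightarrow> x \<in> carrier M \<and> s \<in> S \<and> e i = tens x (fraction R S \<one> s)"
    using tens_fraction_one[OF RS] eB(2) by blast
  then obtain y s where ys: "\<And>i. i < n \<Longrightarrow> y i \<in> carrier M" "\<And>i. i < n \<Longrightarrow> s i \<in> S"
    "\<And>i. i < n \<Longrightarrow> e i = tens (y i) (fraction R S \<one> (s i))"
    by metis
  define u where "u x = tens x \<one>\<^bsub>RS\<^esub>" for x
  have u_closed: "u x \<in> carrier MS" if "x \<in> carrier M" for x
    using that by (simp add: u_def)
  have u_smult: "u (c \<odot>\<^bsub>M\<^esub> x) = frac1 c \<odot>\<^bsub>MS\<^esub> u x" if "c \<in> carrier R" "x \<in> carrier M" for c x
    using that by (simp add: u_def tens_smult_left smult_tens)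
  have u_add: "u (x \<oplus>\<^bsub>M\<^esub> x') = u x \<oplus>\<^bsub>MS\<^esub> u x'" if "x \<in> carrier M" "x' \<in> carrier M" for x x'
    using that by (simp add: u_def tens_add_left)
  have u_zero: "u \<zero>\<^bsub>M\<^esub> = \<zero>\<^bsub>MS\<^esub>"
    by (simp add: u_def tens_zero_left)
  have u_sum: "u (\<Oplus>\<^bsub>M\<^esub>i\<in>I. c i \<odot>\<^bsub>M\<^esub> y i) = (\<Oplus>\<^bsub>MS\<^esub>i\<in>I. frac1 (c i) \<odot>\<^bsub>MS\<^esub> u (y i))"
    if "finite I" "I \<subseteq> {..<n}" "c \<in> I \<rightarrow> carrier R" for I c
    using that
  proof (induction I)
    case empty
    then show ?case by (simp add: u_zero)
  next
    case (insert j I)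
    have c: "c i \<in> carrier R" "y i \<in> carrier M" if "i \<in> insert j I" for i
      using insert.prems ys(1) that by auto
    have "u (\<Oplus>\<^bsub>M\<^esub>i\<in>insert j I. c i \<odot>\<^bsub>M\<^esub> y i) = u (c j \<odot>\<^bsub>M\<^esub> y j) \<oplus>\<^bsub>MS\<^esub> u (\<Oplus>\<^bsub>M\<^esub>i\<in>I. c i \<odot>\<^bsub>M\<^esub> y i)"
      using insert.hyps c by (subst M.finsum_insert) (auto intro!: u_add M.finsum_closed)
    also have "\<dots> = frac1 (c j) \<odot>\<^bsub>MS\<^esub> u (y j) \<oplus>\<^bsub>MS\<^esub> (\<Oplus>\<^bsub>MS\<^esub>i\<in>I. frac1 (c i) \<odot>\<^bsub>MS\<^esub> u (y i))"
      using insert c by (simp add: u_smult)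
    also have "\<dots> = (\<Oplus>\<^bsub>MS\<^esub>i\<in>insert j I. frac1 (c i) \<odot>\<^bsub>MS\<^esub> u (y i))"
      using insert.hyps c u_closed S_one by (subst MS.finsum_insert) auto
    finally show ?case .
  qed
  have e_u: "e i = fraction R S \<one> (s i) \<odot>\<^bsub>MS\<^esub> u (y i)" if "i < n" for i
    using ys that by (simp add: u_def smult_tens)
  have u_e: "u (y i) = frac1 (s i) \<odot>\<^bsub>MS\<^esub> e i" if "i < n" for i
    using ys that S_one by (simp add: u_def smult_tens frac1_denominator localization_one)
  show ?thesis
  proof (intro exI[of _ y], unfold basis_up_to_def, intro conjI ballI impI allI)
    show "y \<in> {..<n} \<rightarrow> carrier M"
      using ys(1) by auto
  next
    fix x
    assume x: "x \<in> carrier M"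
    have "u x \<in> MS.span B" using B(5) u_closed[OF x] by simp
    then obtain a where a: "a \<in> B \<rightarrow> carrier RS" "MS.lincomb a B = u x"
      using MS.finite_in_span[OF B(1,3)] by metis
    \<comment> \<open>Coefficients with respect to \<open>u (y i)\<close> in place of
      \<open>e i\<close>, whence the factor 1/s.\<close>
    define a' where "a' i = a (e i) \<otimes>\<^bsub>RS\<^esub> fraction R S \<one> (s i)" for i
    have ae: "a (e i) \<in> carrier RS" if "i < n" for i
      using funcset_mem[OF a(1) eB(1)[OF that]] .
    have a'i: "a' i \<in> carrier RS" if "i < n" for i
      using ae ys(2) that by (auto simp: a'_def)
    then have a': "a' \<in> {..<n} \<rightarrow> carrier RS" by auto
    obtain t c where tc: "t \<in> S" "c \<in> {..<n} \<rightarrow> carrier R" "\<And>i. i < n \<Longrightarrow> frac1 t \<otimes>\<^bsub>RS\<^esub> a' i = frac1 (c i)"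
      using common_denominator[OF RS _ a'] by auto
    have ci: "c i \<in> carrier R" if "i < n" for i
      using tc(2) that by auto
    let ?z = "\<Oplus>\<^bsub>M\<^esub>i\<in>{..<n}. c i \<odot>\<^bsub>M\<^esub> y i"
    have z: "?z \<in> carrier M" using ci ys(1) by (auto intro!: M.finsum_closed)
    have "u x = (\<Oplus>\<^bsub>MS\<^esub>i\<in>{..<n}. a' i \<odot>\<^bsub>MS\<^esub> u (y i))"
      unfolding a(2)[symmetric] lincomb[OF a(1)]
    proof (rule MS.finsum_cong')
      fix i
      assume "i \<in> {..<n}"
      then have i: "i < n" by simp
      have "a (e i) \<odot>\<^bsub>MS\<^esub> e i = a (e i) \<odot>\<^bsub>MS\<^esub> (fraction R S \<one> (s i) \<odot>\<^bsub>MS\<^esub> u (y i))"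
        using e_u[OF i] by simp
      also have "\<dots> = a' i \<odot>\<^bsub>MS\<^esub> u (y i)"
        unfolding a'_def using ae[OF i] ys(1,2)[OF i] u_closed by (simp add: MS.smult_assoc1)
      finally show "a (e i) \<odot>\<^bsub>MS\<^esub> e i = a' i \<odot>\<^bsub>MS\<^esub> u (y i)" .
    qed (use a'i ys(1) u_closed in auto)
    then have "u (t \<odot>\<^bsub>M\<^esub> x) = (\<Oplus>\<^bsub>MS\<^esub>i\<in>{..<n}. frac1 t \<odot>\<^bsub>MS\<^esub> (a' i \<odot>\<^bsub>MS\<^esub> u (y i)))"
      using x tc(1) a'i u_closed ys(1) S_one by (simp add: u_smult MS.finsum_smult)
    also have "\<dots> = (\<Oplus>\<^bsub>MS\<^esub>i\<in>{..<n}. frac1 (c i) \<odot>\<^bsub>MS\<^esub> u (y i))"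
    proof (rule MS.finsum_cong')
      show "frac1 t \<odot>\<^bsub>MS\<^esub> (a' i \<odot>\<^bsub>MS\<^esub> u (y i)) = frac1 (c i) \<odot>\<^bsub>MS\<^esub> u (y i)" if "i \<in> {..<n}" for i
        using that tc(1,3) a'i u_closed ys(1) S_one
        by (subst MS.smult_assoc1[symmetric]) auto
    qed (use ci u_closed ys(1) S_one in auto)
    also have "\<dots> = u ?z"
      using tc(2) by (simp add: u_sum)
    finally have "u (t \<odot>\<^bsub>M\<^esub> x) = u ?z" .
    moreover have "t \<odot>\<^bsub>M\<^esub> x \<ominus>\<^bsub>M\<^esub> ?z \<oplus>\<^bsub>M\<^esub> ?z = t \<odot>\<^bsub>M\<^esub> x"
      using x z tc(1) by (simp add: M.minus_eq M.a_assoc M.l_neg)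
    ultimately have "u (t \<odot>\<^bsub>M\<^esub> x \<ominus>\<^bsub>M\<^esub> ?z) \<oplus>\<^bsub>MS\<^esub> u ?z = u ?z"
      using x z tc(1) u_add[of "t \<odot>\<^bsub>M\<^esub> x \<ominus>\<^bsub>M\<^esub> ?z" ?z] by simp
    then have "u (t \<odot>\<^bsub>M\<^esub> x \<ominus>\<^bsub>M\<^esub> ?z) = \<zero>\<^bsub>MS\<^esub>"
      using x z tc(1) u_closed by (simp add: MS.add.l_cancel_one)
    \<comment> \<open>Equality of \<open>t x\<close> and \<open>?z\<close> holds only after
      localization; v is the denominator that makes it hold in M. It enters the final witnesses
      \<open>v \<otimes> t\<close> and \<open>v \<otimes> c i\<close>.\<close>
    then obtain v where v: "v \<in> S" "v \<odot>\<^bsub>M\<^esub> (t \<odot>\<^bsub>M\<^esub> x \<ominus>\<^bsub>M\<^esub> ?z) = \<zero>\<^bsub>M\<^esub>"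
      using tens_one_eq_zero[OF RS, of "t \<odot>\<^bsub>M\<^esub> x \<ominus>\<^bsub>M\<^esub> ?z"] x z tc(1) by (auto simp: u_def)
    then have "v \<odot>\<^bsub>M\<^esub> (t \<odot>\<^bsub>M\<^esub> x) \<ominus>\<^bsub>M\<^esub> v \<odot>\<^bsub>M\<^esub> ?z = \<zero>\<^bsub>M\<^esub>"
      using x z tc(1) by (simp add: M.minus_eq smult_r_distr smult_r_minus)
    then have "(v \<otimes> t) \<odot>\<^bsub>M\<^esub> x = v \<odot>\<^bsub>M\<^esub> ?z"
      using x z tc(1) v(1) by (simp add: smult_assoc1)
    also have "\<dots> = (\<Oplus>\<^bsub>M\<^esub>i\<in>{..<n}. v \<odot>\<^bsub>M\<^esub> (c i \<odot>\<^bsub>M\<^esub> y i))"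
      using v(1) ci ys(1) by (intro finsum_smult) auto
    also have "\<dots> = (\<Oplus>\<^bsub>M\<^esub>i\<in>{..<n}. (v \<otimes> c i) \<odot>\<^bsub>M\<^esub> y i)"
    proof (rule M.finsum_cong')
      show "v \<odot>\<^bsub>M\<^esub> (c i \<odot>\<^bsub>M\<^esub> y i) = (v \<otimes> c i) \<odot>\<^bsub>M\<^esub> y i" if "i \<in> {..<n}" for i
        using that v(1) ci ys(1) by (subst smult_assoc1) auto
    qed (use v(1) ci ys(1) in auto)
    finally show "\<exists>t\<in>S. \<exists>c\<in>{..<n} \<rightarrow> carrier R. t \<odot>\<^bsub>M\<^esub> x = (\<Oplus>\<^bsub>M\<^esub>i\<in>{..<n}. c i \<odot>\<^bsub>M\<^esub> y i)"
      using v(1) tc(1) ci S_mult by (intro bexI[of _ "v \<otimes> t"] bexI[of _ "\<lambda>i. v \<otimes> c i"]) auto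
  next
    fix c i
    assume c: "c \<in> {..<n} \<rightarrow> carrier R" "(\<Oplus>\<^bsub>M\<^esub>i\<in>{..<n}. c i \<odot>\<^bsub>M\<^esub> y i) = \<zero>\<^bsub>M\<^esub>" and i: "i < n"
    have ci: "c j \<in> carrier R" if "j < n" for j
      using c(1) that by auto
    \<comment> \<open>\<open>lin_dep\<close> speaks of coefficient functions on the set B, so
      indices are recovered by inverting e. The factor s appears because \<open>u (y i)\<close> is
      \<open>s i\<close> times \<open>e i\<close>.\<close>
    define a where "a v = frac1 (c (the_inv_into {..<n} e v) \<otimes> s (the_inv_into {..<n} e v))" for v
    have inv: "the_inv_into {..<n} e (e j) = j" if "j < n" for j
      using e that by (auto simp: bij_betw_def the_inv_into_f_f)
    have a: "a (e j) = frac1 (c j \<otimes> s j)" "a (e j) \<in> carrier RS" if "j < n" for j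
      using inv[OF that] ci ys(2) that S_one by (auto simp: a_def)
    have aB: "a \<in> B \<rightarrow> carrier RS"
      using e a(2) by (auto simp: bij_betw_def)
    have "MS.lincomb a B = (\<Oplus>\<^bsub>MS\<^esub>j\<in>{..<n}. frac1 (c j) \<odot>\<^bsub>MS\<^esub> u (y j))"
      unfolding lincomb[OF aB]
    proof (rule MS.finsum_cong')
      fix j
      assume "j \<in> {..<n}"
      then have j: "j < n" "c j \<in> carrier R" using c(1) by auto
      show "a (e j) \<odot>\<^bsub>MS\<^esub> e j = frac1 (c j) \<odot>\<^bsub>MS\<^esub> u (y j)"
        using j ys(2) eB(2) S_one
        by (simp add: a(1) u_e frac1_mult[symmetric] MS.smult_assoc1)
    qed (use c(1) u_closed ys(1) S_one in auto)
    also have "\<dots> = \<zero>\<^bsub>MS\<^esub>"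
      using u_sum[of "{..<n}" c] c by (simp add: u_zero)
    finally have "a (e i) = \<zero>\<^bsub>RS\<^esub>"
      using MS.lin_dep_crit[OF B(1) subset_refl aB eB(1)[OF i]] B(4) by auto
    then obtain t where "t \<in> S" "t \<otimes> (c i \<otimes> s i) = \<zero>"
      using a(1)[OF i] ci i ys(2) S_one by (auto simp: fraction_eq_zero_iff)
    then show "\<exists>t\<in>S. t \<otimes> c i = \<zero>"
      using ci i ys(2) S_mult by (intro bexI[of _ "t \<otimes> s i"]) (auto simp: m_ac)
  qed
qed

end

subsection \<open>Sandwich maps of simple rings\<close>

text \<open>A list of coefficient pairs is data that can be pushed along a ring homomorphism or
  lifted from a quotient ring by acting on the entries, as \<open>ring_hom_sandwich\<close> and
  \<open>lift_pairs\<close> do. A bare function could not be transported.\<close>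

fun sandwich :: "('a, 'm) ring_scheme \<Rightarrow> ('a \<times> 'a) list \<Rightarrow> 'a \<Rightarrow> 'a"
  where "sandwich A [] x = \<zero>\<^bsub>A\<^esub>"
  | "sandwich A ((a, b) # ps) x = a \<otimes>\<^bsub>A\<^esub> x \<otimes>\<^bsub>A\<^esub> b \<oplus>\<^bsub>A\<^esub> sandwich A ps x"

definition sandwich_map :: "('a, 'm) ring_scheme \<Rightarrow> ('a \<Rightarrow> 'a) \<Rightarrow> bool"
  where "sandwich_map A f \<longleftrightarrow>
    (\<exists>ps. set ps \<subseteq> carrier A \<times> carrier A \<and> (\<forall>x\<in>carrier A. f x = sandwich A ps x))"

context ring
begin

lemma sandwich_closed [simp, intro]:
  "\<lbrakk>set ps \<subseteq> carrier R \<times> carrier R; x \<in> carrier R\<rbrakk> \<Longrightarrow> sandwich R ps x \<in> carrier R"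
  by (induction ps) auto

lemma sandwich_append:
  "\<lbrakk>set ps \<subseteq> carrier R \<times> carrier R; set qs \<subseteq> carrier R \<times> carrier R; x \<in> carrier R\<rbrakk> \<Longrightarrow>
    sandwich R (ps @ qs) x = sandwich R ps x \<oplus> sandwich R qs x"
  by (induction ps) (auto simp: a_assoc)

lemma sandwich_left:
  "\<lbrakk>set ps \<subseteq> carrier R \<times> carrier R; x \<in> carrier R; c \<in> carrier R\<rbrakk> \<Longrightarrow>
    sandwich R (map (\<lambda>(a, b). (c \<otimes> a, b)) ps) x = c \<otimes> sandwich R ps x"
  by (induction ps) (auto simp: m_assoc r_distr)

lemma sandwich_right:
  "\<lbrakk>set ps \<subseteq> carrier R \<times> carrier R; x \<in> carrier R; c \<in> carrier R\<rbrakk> \<Longrightarrow>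
    sandwich R (map (\<lambda>(a, b). (a, b \<otimes> c)) ps) x = sandwich R ps x \<otimes> c"
  by (induction ps) (auto simp: m_assoc l_distr)

lemma sandwich_add:
  "\<lbrakk>set ps \<subseteq> carrier R \<times> carrier R; x \<in> carrier R; y \<in> carrier R\<rbrakk> \<Longrightarrow>
    sandwich R ps (x \<oplus> y) = sandwich R ps x \<oplus> sandwich R ps y"
  by (induction ps) (auto simp: l_distr r_distr a_ac)

lemma sandwich_zero: "set ps \<subseteq> carrier R \<times> carrier R \<Longrightarrow> sandwich R ps \<zero> = \<zero>"
  by (induction ps) auto

lemma sandwich_central:
  assumes "z \<in> ring_center R"
  shows "\<lbrakk>set ps \<subseteq> carrier R \<times> carrier R; x \<in> carrier R\<rbrakk> \<Longrightarrow>
    sandwich R ps (z \<otimes> x) = z \<otimes> sandwich R ps x"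
proof (induction ps)
  case (Cons p ps)
  obtain a b where p: "p = (a, b)" "a \<in> carrier R" "b \<in> carrier R"
    using Cons.prems by (cases p) auto
  have z: "z \<in> carrier R" "z \<otimes> a = a \<otimes> z"
    using assms p by (auto simp: ring_center_def)
  have "a \<otimes> (z \<otimes> x) \<otimes> b = (a \<otimes> z) \<otimes> x \<otimes> b"
    using p z(1) Cons.prems by (simp add: m_assoc)
  also have "\<dots> = z \<otimes> (a \<otimes> x \<otimes> b)"
    unfolding z(2)[symmetric] using p z(1) Cons.prems by (simp add: m_assoc)
  finally show ?case
    using Cons z(1) p by (simp add: r_distr)
qed (use assms in \<open>auto simp: ring_center_def\<close>)

lemma sandwich_finsum:
  "\<lbrakk>set ps \<subseteq> carrier R \<times> carrier R; finite I; f \<in> I \<rightarrow> carrier R\<rbrakk> \<Longrightarrow>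
    sandwich R ps (\<Oplus>i\<in>I. f i) = (\<Oplus>i\<in>I. sandwich R ps (f i))"
  by (rotate_tac 1, induction I rule: finite_induct) (auto simp: sandwich_zero sandwich_add Pi_def)

lemma sandwich_mapI: "set ps \<subseteq> carrier R \<times> carrier R \<Longrightarrow> (\<And>x. x \<in> carrier R \<Longrightarrow> f x = sandwich R ps x) \<Longrightarrow> sandwich_map R f"
  by (auto simp: sandwich_map_def)

lemma sandwich_mapE:
  assumes "sandwich_map R f"
  obtains ps where "set ps \<subseteq> carrier R \<times> carrier R" "\<And>x. x \<in> carrier R \<Longrightarrow> f x = sandwich R ps x"
  using assms by (auto simp: sandwich_map_def)

lemma sandwich_map_closed: "\<lbrakk>sandwich_map R f; x \<in> carrier R\<rbrakk> \<Longrightarrow> f x \<in> carrier R"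
  by (auto elim!: sandwich_mapE)

lemma sandwich_map_zero: "sandwich_map R f \<Longrightarrow> f \<zero> = \<zero>"
  by (auto elim!: sandwich_mapE simp: sandwich_zero)

lemma sandwich_map_id: "sandwich_map R (\<lambda>x. x)"
  by (rule sandwich_mapI[of "[(\<one>, \<one>)]"]) auto

lemma sandwich_map_null: "sandwich_map R (\<lambda>x. \<zero>)"
  by (rule sandwich_mapI[of "[]"]) auto

lemma sandwich_map_add:
  assumes "sandwich_map R f" "sandwich_map R g"
  shows "sandwich_map R (\<lambda>x. f x \<oplus> g x)"
proof -
  obtain ps qs where "set ps \<subseteq> carrier R \<times> carrier R" "\<And>x. x \<in> carrier R \<Longrightarrow> f x = sandwich R ps x"
    "set qs \<subseteq> carrier R \<times> carrier R" "\<And>x. x \<in> carrier R \<Longrightarrow> g x = sandwich R qs x"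
    using assms by (metis sandwich_map_def)
  then show ?thesis
    by (intro sandwich_mapI[of "ps @ qs"]) (auto simp: sandwich_append)
qed

lemma sandwich_map_left:
  assumes "sandwich_map R f" "c \<in> carrier R"
  shows "sandwich_map R (\<lambda>x. c \<otimes> f x)"
  using assms(1)
proof (rule sandwich_mapE)
  fix ps assume "set ps \<subseteq> carrier R \<times> carrier R" "\<And>x. x \<in> carrier R \<Longrightarrow> f x = sandwich R ps x"
  then show ?thesis
    using assms(2) sandwich_left[of ps _ c] by (intro sandwich_mapI[of "map (\<lambda>(a, b). (c \<otimes> a, b)) ps"]) auto
qed

lemma sandwich_map_right:
  assumes "sandwich_map R f" "c \<in> carrier R"
  shows "sandwich_map R (\<lambda>x. f x \<otimes> c)"
  using assms(1)
proof (rule sandwich_mapE)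
  fix ps assume "set ps \<subseteq> carrier R \<times> carrier R" "\<And>x. x \<in> carrier R \<Longrightarrow> f x = sandwich R ps x"
  then show ?thesis
    using assms(2) sandwich_right[of ps _ c] by (intro sandwich_mapI[of "map (\<lambda>(a, b). (a, b \<otimes> c)) ps"]) auto
qed

lemma sandwich_map_minus:
  assumes f: "sandwich_map R f" and g: "sandwich_map R g"
  shows "sandwich_map R (\<lambda>x. f x \<ominus> g x)"
proof -
  obtain ps where ps: "set ps \<subseteq> carrier R \<times> carrier R"
      "\<And>x. x \<in> carrier R \<Longrightarrow> f x \<oplus> (\<ominus> \<one>) \<otimes> g x = sandwich R ps x"
    using sandwich_map_add[OF f sandwich_map_left[OF g, of "\<ominus> \<one>"]] by (auto elim: sandwich_mapE)
  have "f x \<ominus> g x = sandwich R ps x" if "x \<in> carrier R" for x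
    using ps(2)[OF that] sandwich_map_closed[OF g that] by (simp add: minus_eq l_minus)
  with ps(1) show ?thesis by (rule sandwich_mapI)
qed

text \<open>Unfold the outer map along its list: each summand multiplies g x on both sides, which
  the one-sided closure rules cover.\<close>

lemma sandwich_map_comp:
  assumes f: "sandwich_map R f" and g: "sandwich_map R g"
  shows "sandwich_map R (\<lambda>x. f (g x))"
proof -
  obtain ps where ps: "set ps \<subseteq> carrier R \<times> carrier R" "\<And>x. x \<in> carrier R \<Longrightarrow> f x = sandwich R ps x"
    using f by (auto elim: sandwich_mapE)
  have "sandwich_map R (\<lambda>x. sandwich R ps (g x))"
    using ps(1)
  proof (induction ps)
    case Nil
    then show ?case by (simp add: sandwich_map_null)
  next
    case (Cons p ps)
    then show ?case
      using g by (cases p) (auto intro!: sandwich_map_add sandwich_map_left sandwich_map_right)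
  qed
  moreover have "f (g x) = sandwich R ps (g x)" if "x \<in> carrier R" for x
    using ps(2) sandwich_map_closed[OF g that] by simp
  ultimately show ?thesis
    by (auto simp: sandwich_map_def)
qed

lemma sandwich_map_finsum:
  assumes "finite I" "\<And>i. i \<in> I \<Longrightarrow> sandwich_map R (f i)"
  shows "sandwich_map R (\<lambda>x. \<Oplus>i\<in>I. f i x)"
  using assms
proof (induction I)
  case empty
  then show ?case by (simp add: sandwich_map_null)
next
  case (insert j I)
  then have "sandwich_map R (\<lambda>x. f j x \<oplus> (\<Oplus>i\<in>I. f i x))"
    by (intro sandwich_map_add) auto
  moreover have "(\<Oplus>i\<in>insert j I. f i x) = f j x \<oplus> (\<Oplus>i\<in>I. f i x)" if "x \<in> carrier R" for x
    using insert that by (intro finsum_insert) (auto intro: sandwich_map_closed)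
  ultimately show ?case
    by (auto simp: sandwich_map_def)
qed

lemma finsum_single:
  assumes "finite I" "j \<in> I" "a \<in> carrier R"
  shows "(\<Oplus>i\<in>I. if i = j then a else \<zero>) = a"
  using add.finprod_singleton_swap[OF assms(2,1), of "\<lambda>_. a"] assms(3) by simp

text \<open>The values at y of all sandwich maps form the two-sided ideal generated by y. In a
  simple ring it is everything, so it contains 1.\<close>

lemma simple_ring_sandwich_eq_one:
  assumes simple: "simple_ring R" and y: "y \<in> carrier R" "y \<noteq> \<zero>"
  shows "\<exists>f. sandwich_map R f \<and> f y = \<one>"
proof -
  let ?I = "{f y | f. sandwich_map R f}"
  have mem: "f y \<in> ?I" if "sandwich_map R f" for f
    using that by auto
  have "ideal ?I R"
  proof (rule idealI[OF ring_axioms])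
    show "subgroup ?I (add_monoid R)"
    proof (rule add.subgroupI)
      show "?I \<subseteq> carrier R"
        using y sandwich_map_closed by auto
      show "?I \<noteq> {}"
        using mem[OF sandwich_map_null] by blast
      fix a assume "a \<in> ?I"
      then obtain f where f: "sandwich_map R f" "a = f y" by auto
      have "\<ominus> a = \<zero> \<ominus> f y" using f y sandwich_map_closed by (simp add: minus_eq)
      then show "\<ominus> a \<in> ?I"
        using mem[OF sandwich_map_minus[OF sandwich_map_null f(1)]] by simp
      fix b assume "b \<in> ?I"
      then obtain g where "sandwich_map R g" "b = g y" by auto
      then show "a \<oplus> b \<in> ?I"
        using mem[OF sandwich_map_add[OF f(1)], of g] f(2) by simp
    qed
  next
    fix a x assume "a \<in> ?I" and x: "x \<in> carrier R"
    then obtain f where f: "sandwich_map R f" "a = f y" by auto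
    show "x \<otimes> a \<in> ?I" using mem[OF sandwich_map_left[OF f(1) x]] f(2) by simp
    show "a \<otimes> x \<in> ?I" using mem[OF sandwich_map_right[OF f(1) x]] f(2) by simp
  qed
  moreover have "y \<in> ?I" using mem[OF sandwich_map_id] .
  ultimately have "?I = carrier R"
    using simple y(2) unfolding simple_ring_def by blast
  then have "\<one> \<in> ?I" by simp
  then show ?thesis by auto
qed

lemma ring_center_closed: "z \<in> ring_center R \<Longrightarrow> z \<in> carrier R"
  by (simp add: ring_center_def)

text \<open>The double centralizer argument: the sandwich maps of a simple ring act densely over its centre.\<close>

lemma simple_ring_dual_sandwich_maps:
  assumes simple: "simple_ring R"
    and "finite I" "\<And>i. i \<in> I \<Longrightarrow> e i \<in> carrier R"
    and "\<And>z. \<lbrakk>z \<in> I \<rightarrow> ring_center R; (\<Oplus>i\<in>I. z i \<otimes> e i) = \<zero>\<rbrakk> \<Longrightarrow> \<forall>i\<in>I. z i = \<zero>"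
  shows "\<exists>f. \<forall>i\<in>I. sandwich_map R (f i) \<and> (\<forall>l\<in>I. f i (e l) = (if l = i then \<one> else \<zero>))"
  using assms(2-)
proof (induction I rule: finite_induct)
  case empty
  then show ?case by simp
next
  case (insert n I)
  have e: "e i \<in> carrier R" if "i \<in> I" for i
    using insert.prems(1) that by blast
  have en: "e n \<in> carrier R"
    using insert.prems(1) by blast
  have zero_center: "\<zero> \<in> ring_center R" and mone_center: "\<ominus> \<one> \<in> ring_center R"
    by (auto simp: ring_center_def l_minus r_minus)
  have sum_insert: "(\<Oplus>i\<in>insert n I. z i \<otimes> e i) = z n \<otimes> e n \<oplus> (\<Oplus>i\<in>I. z i \<otimes> e i)"
    if "\<And>i. i \<in> insert n I \<Longrightarrow> z i \<in> carrier R" for z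
    using insert.hyps that e en by (intro finsum_insert) auto
  \<comment> \<open>A relation on I extends to \<open>insert n I\<close> with coefficient 0 at
    n.\<close>
  have indep: "\<forall>i\<in>I. z i = \<zero>" if z: "z \<in> I \<rightarrow> ring_center R" "(\<Oplus>i\<in>I. z i \<otimes> e i) = \<zero>" for z
  proof -
    let ?z = "z(n := \<zero>)"
    have zc: "\<And>i. i \<in> I \<Longrightarrow> z i \<in> carrier R"
      using z(1) ring_center_closed by auto
    have "(\<Oplus>i\<in>I. ?z i \<otimes> e i) = (\<Oplus>i\<in>I. z i \<otimes> e i)"
      using insert.hyps zc e by (intro finsum_cong') auto
    then have "(\<Oplus>i\<in>insert n I. ?z i \<otimes> e i) = \<zero>"
      using z(2) zc en by (subst sum_insert) auto
    moreover have "?z \<in> insert n I \<rightarrow> ring_center R"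
      using z(1) zero_center by auto
    ultimately have "\<forall>i\<in>insert n I. ?z i = \<zero>"
      by (rule insert.prems(2)[rotated])
    then show ?thesis using insert.hyps by (auto split: if_splits)
  qed
  from insert.IH[OF e indep] obtain f
    where "\<forall>i\<in>I. sandwich_map R (f i) \<and> (\<forall>l\<in>I. f i (e l) = (if l = i then \<one> else \<zero>))" ..
  then have f: "\<And>i. i \<in> I \<Longrightarrow> sandwich_map R (f i)"
      "\<And>i l. \<lbrakk>i \<in> I; l \<in> I\<rbrakk> \<Longrightarrow> f i (e l) = (if l = i then \<one> else \<zero>)"
    by simp_all
  define w where "w i = f i (e n)" for i
  have w: "w i \<in> carrier R" if "i \<in> I" for i
    using sandwich_map_closed[OF f(1) en] that by (simp add: w_def)
  \<comment> \<open>The heart of the argument: the common kernel conditions at the earlier elements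
    must not force vanishing at \<open>e n\<close>. If they did, \<open>e n\<close> would be a
    central combination of the earlier elements.\<close>
  have "\<exists>g. sandwich_map R g \<and> (\<forall>i\<in>I. g (e i) = \<zero>) \<and> g (e n) \<noteq> \<zero>"
  proof (rule ccontr)
    assume neg: "\<nexists>g. sandwich_map R g \<and> (\<forall>i\<in>I. g (e i) = \<zero>) \<and> g (e n) \<noteq> \<zero>"
    \<comment> \<open>Correct g by its values at the \<open>e i\<close> times the dual maps. The
      corrected map vanishes at every earlier element, so by \<open>neg\<close> also at
      \<open>e n\<close>. The coefficients \<open>w i\<close> do not depend on g.\<close>
    have expand: "g (e n) = (\<Oplus>i\<in>I. g (e i) \<otimes> w i)" if g: "sandwich_map R g" for g
    proof -
      let ?h = "\<lambda>x. g x \<ominus> (\<Oplus>i\<in>I. g (e i) \<otimes> f i x)"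
      have ge: "g (e i) \<in> carrier R" if "i \<in> I" for i
        using sandwich_map_closed[OF g e[OF that]] .
      have h: "sandwich_map R ?h"
        using ge f(1) insert.hyps(1)
        by (intro sandwich_map_minus g sandwich_map_finsum sandwich_map_left) auto
      have "?h (e l) = \<zero>" if l: "l \<in> I" for l
      proof -
        have "(\<Oplus>i\<in>I. g (e i) \<otimes> f i (e l)) = (\<Oplus>i\<in>I. if i = l then g (e l) else \<zero>)"
          using ge l f(2) by (intro finsum_cong') auto
        also have "\<dots> = g (e l)"
          using insert.hyps(1) l ge by (intro finsum_single) auto
        finally show ?thesis using ge[OF l] by (simp add: r_neg minus_eq)
      qed
      with h neg have "?h (e n) = \<zero>" by (auto simp del: minus_other_side)
      moreover have "(\<Oplus>i\<in>I. g (e i) \<otimes> w i) \<in> carrier R"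
        using ge w by (intro finsum_closed) auto
      ultimately show ?thesis
        using sandwich_map_closed[OF g en] by (simp add: w_def)
    qed
    \<comment> \<open>Apply \<open>expand\<close> to \<open>f j\<close> followed by right
      multiplication with b: its value at \<open>e i\<close> is b for i = j and 0 otherwise, so the
      two sides are \<open>w j\<close> b and b \<open>w j\<close>.\<close>
    have w_center: "w j \<in> ring_center R" if j: "j \<in> I" for j
    proof -
      have "w j \<otimes> b = b \<otimes> w j" if b: "b \<in> carrier R" for b
      proof -
        have "w j \<otimes> b = (\<Oplus>i\<in>I. f j (e i) \<otimes> b \<otimes> w i)"
          using expand[OF sandwich_map_right[OF f(1)[OF j] b]] by (simp add: w_def)
        also have "\<dots> = (\<Oplus>i\<in>I. if i = j then b \<otimes> w j else \<zero>)"
          using b w j f(2) by (intro finsum_cong') auto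
        also have "\<dots> = b \<otimes> w j"
          using insert.hyps(1) j b w by (intro finsum_single) auto
        finally show ?thesis .
      qed
      then show ?thesis using w[OF j] by (auto simp: ring_center_def)
    qed
    \<comment> \<open>Apply \<open>expand\<close> to the identity: \<open>e n\<close> is the sum of
      the \<open>e i\<close> times \<open>w i\<close>. With coefficient -1 at n this is a relation
      over the centre that is not trivial.\<close>
    let ?z = "w(n := \<ominus> \<one>)"
    have "(\<Oplus>i\<in>I. ?z i \<otimes> e i) = (\<Oplus>i\<in>I. e i \<otimes> w i)"
      using insert.hyps(2) w e w_center by (intro finsum_cong') (auto simp: ring_center_def)
    also have "\<dots> = e n"
      using expand[OF sandwich_map_id] by simp
    finally have "(\<Oplus>i\<in>insert n I. ?z i \<otimes> e i) = \<zero>"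
      using w en by (subst sum_insert) (auto simp: l_minus l_neg)
    moreover have "?z \<in> insert n I \<rightarrow> ring_center R"
      using w_center mone_center by auto
    ultimately have "\<forall>i\<in>insert n I. ?z i = \<zero>"
      by (rule insert.prems(2)[rotated])
    then have "\<ominus> \<one> = \<zero>" by simp
    then have "\<one> = \<zero>" by (metis minus_minus minus_zero one_closed)
    then show False using simple by (simp add: simple_ring_def)
  qed
  then obtain g where g: "sandwich_map R g" "\<And>i. i \<in> I \<Longrightarrow> g (e i) = \<zero>" "g (e n) \<noteq> \<zero>"
    by auto
  \<comment> \<open>Simplicity provides a further sandwich map that turns the nonzero value into
    1.\<close>
  obtain h where h: "sandwich_map R h" "h (g (e n)) = \<one>"
    using simple_ring_sandwich_eq_one[OF simple _ g(3)] sandwich_map_closed[OF g(1) en] by auto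
  define k where "k x = h (g x)" for x
  have k: "sandwich_map R k" "k (e n) = \<one>" "\<And>i. i \<in> I \<Longrightarrow> k (e i) = \<zero>"
    using sandwich_map_comp[OF h(1) g(1)] h(2) g(2) sandwich_map_zero[OF h(1)]
    by (simp_all add: k_def[abs_def])
  \<comment> \<open>The correction by k removes the value \<open>w i\<close> of \<open>f i\<close>
    at \<open>e n\<close> and changes nothing at the earlier elements, where k vanishes.\<close>
  define f' where "f' i = (if i = n then k else (\<lambda>x. f i x \<ominus> w i \<otimes> k x))" for i
  have "sandwich_map R (f' i)" if "i \<in> insert n I" for i
    using that k(1) f(1) w by (auto simp: f'_def intro!: sandwich_map_minus sandwich_map_left)
  moreover have "f' i (e l) = (if l = i then \<one> else \<zero>)" if "i \<in> insert n I" "l \<in> insert n I" for i l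
    using that insert.hyps(2) k(2,3) f(2) w
    by (auto simp: f'_def minus_eq r_neg w_def[symmetric])
  ultimately show ?case
    by (intro exI[of _ f'] ballI conjI)
qed

end

section \<open>Transport of sandwich maps and elimination in a linear relation\<close>

lemma ring_hom_sandwich:
  assumes "ring A" "ring B" "h \<in> ring_hom A B"
  shows "\<lbrakk>set ps \<subseteq> carrier A \<times> carrier A; x \<in> carrier A\<rbrakk> \<Longrightarrow>
    h (sandwich A ps x) = sandwich B (map (map_prod h h) ps) (h x)"
proof (induction ps)
  case Nil
  then show ?case using ring_hom_zero[OF assms(3,1,2)] by simp
next
  case (Cons p ps)
  interpret A: ring A by fact
  obtain a b where p: "p = (a, b)" "a \<in> carrier A" "b \<in> carrier A"
    using Cons.prems by (cases p) auto
  then show ?case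
    using Cons assms(3) by (simp add: ring_hom_add ring_hom_mult)
qed

text \<open>Gaussian elimination without division: subtracting
  \<open>f\<^sub>j x\<^sub>i\<close> times \<open>x\<^sub>j\<close> from \<open>f\<^sub>j x\<^sub>j\<close> times \<open>x\<^sub>i\<close> keeps the linear relation in \<open>D\<close>, drops its \<open>j\<close>-th
  term, and does not change the images in \<open>B\<close>.\<close>

lemma no_relation_if_dual_sandwich_maps:
  assumes "ring A" "ring B" "ring D"
    and \<pi>: "\<pi> \<in> ring_hom A B" and \<psi>: "\<psi> \<in> ring_hom A D"
    and ker: "\<And>a. \<lbrakk>a \<in> carrier A; \<psi> a = \<zero>\<^bsub>D\<^esub>\<rbrakk> \<Longrightarrow> \<pi> a = \<zero>\<^bsub>B\<^esub>"
    and nontriv: "\<one>\<^bsub>B\<^esub> \<noteq> \<zero>\<^bsub>B\<^esub>"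
    and "finite I"
    and ps: "\<And>i. i \<in> I \<Longrightarrow> set (ps i) \<subseteq> carrier A \<times> carrier A"
    and dual: "\<And>i l. \<lbrakk>i \<in> I; l \<in> I\<rbrakk> \<Longrightarrow> \<pi> (sandwich A (ps i) (x l)) = (if l = i then \<one>\<^bsub>B\<^esub> else \<zero>\<^bsub>B\<^esub>)"
    and x: "\<And>i. i \<in> I \<Longrightarrow> x i \<in> carrier A"
    and \<gamma>: "\<And>i. i \<in> I \<Longrightarrow> \<gamma> i \<in> ring_center D"
    and i0: "i0 \<in> I" and reg: "\<And>d. \<lbrakk>d \<in> carrier D; \<gamma> i0 \<otimes>\<^bsub>D\<^esub> d = \<zero>\<^bsub>D\<^esub>\<rbrakk> \<Longrightarrow> d = \<zero>\<^bsub>D\<^esub>"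
  shows "(\<Oplus>\<^bsub>D\<^esub>i\<in>I. \<gamma> i \<otimes>\<^bsub>D\<^esub> \<psi> (x i)) \<noteq> \<zero>\<^bsub>D\<^esub>"
  using \<open>finite I\<close> ps dual x \<gamma> i0
\<comment> \<open>Elimination replaces the elements x but leaves the coefficient lists and the
  \<gamma> unchanged, so only x is generalized.\<close>
proof (induction I arbitrary: x rule: finite_psubset_induct)
  case (psubset I)
  interpret A: ring A by fact
  interpret B: ring B by fact
  interpret D: ring D by fact
  have \<psi>_closed: "\<psi> a \<in> carrier D" and \<pi>_closed: "\<pi> a \<in> carrier B" if "a \<in> carrier A" for a
    using that \<pi> \<psi> ring_hom_closed by metis+
  note \<psi>_simps = ring_hom_add[OF \<psi>] ring_hom_mult[OF \<psi>] ring_hom_zero[OF \<psi> \<open>ring A\<close> \<open>ring D\<close>]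
  note \<pi>_simps = ring_hom_add[OF \<pi>] ring_hom_mult[OF \<pi>] ring_hom_zero[OF \<pi> \<open>ring A\<close> \<open>ring B\<close>]
  have \<gamma>c: "\<gamma> i \<in> carrier D" if "i \<in> I" for i
    using psubset.prems(4)[OF that] by (simp add: ring_center_def)
  note x = psubset.prems(3)
  show ?case
  proof (cases "I = {i0}")
    case True
    \<comment> \<open>By \<open>ker\<close>, vanishing in D would give vanishing in B, where the
      dual map takes the value 1 on this element.\<close>
    have "\<psi> (x i0) \<noteq> \<zero>\<^bsub>D\<^esub>"
    proof
      assume "\<psi> (x i0) = \<zero>\<^bsub>D\<^esub>"
      then have "\<pi> (x i0) = \<zero>\<^bsub>B\<^esub>" using ker x True by simp
      then have "\<pi> (sandwich A (ps i0) (x i0)) = sandwich B (map (map_prod \<pi> \<pi>) (ps i0)) \<zero>\<^bsub>B\<^esub>"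
        using ring_hom_sandwich[OF \<open>ring A\<close> \<open>ring B\<close> \<pi>, of "ps i0" "x i0"] psubset.prems(1) x True by simp
      also have "\<dots> = \<zero>\<^bsub>B\<^esub>"
        using psubset.prems(1)[of i0] True \<pi>_closed by (intro B.sandwich_zero) auto
      finally show False
        using psubset.prems(2)[of i0 i0] nontriv True by simp
    qed
    then have "\<gamma> i0 \<otimes>\<^bsub>D\<^esub> \<psi> (x i0) \<noteq> \<zero>\<^bsub>D\<^esub>"
      using reg \<psi>_closed x True by auto
    then show ?thesis
      using \<gamma>c \<psi>_closed x True by simp
  next
    case False
    \<comment> \<open>The eliminated index differs from i0, so that the regular coefficient survives
      to the last step.\<close>
    then obtain j where j: "j \<in> I" "j \<noteq> i0" using psubset.prems(5) by auto
    define f where "f a = sandwich A (ps j) a" for a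
    have f_closed: "f a \<in> carrier A" if "a \<in> carrier A" for a
      using that psubset.prems(1)[OF j(1)] by (auto simp: f_def)
    define x' where "x' i = f (x j) \<otimes>\<^bsub>A\<^esub> x i \<ominus>\<^bsub>A\<^esub> f (x i) \<otimes>\<^bsub>A\<^esub> x j" for i
    have x': "x' i \<in> carrier A" if "i \<in> I" for i
      using that x j f_closed by (simp add: x'_def)
    \<comment> \<open>In B the values of f at \<open>x j\<close> and \<open>x i\<close> are 1 and 0,
      so \<open>x' i\<close> has the same image as \<open>x i\<close> and duality persists.\<close>
    have \<pi>x': "\<pi> (x' i) = \<pi> (x i)" if "i \<in> I - {j}" for i
    proof -
      have "x' i \<oplus>\<^bsub>A\<^esub> f (x i) \<otimes>\<^bsub>A\<^esub> x j = f (x j) \<otimes>\<^bsub>A\<^esub> x i"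
        using that x j f_closed by (simp add: x'_def A.minus_eq A.a_assoc A.l_neg)
      then have "\<pi> (x' i) \<oplus>\<^bsub>B\<^esub> \<pi> (f (x i)) \<otimes>\<^bsub>B\<^esub> \<pi> (x j) = \<pi> (f (x j)) \<otimes>\<^bsub>B\<^esub> \<pi> (x i)"
        using that x j f_closed x' by (metis \<pi>_simps(1,2) A.m_closed DiffD1)
      moreover have "\<pi> (f (x i)) = \<zero>\<^bsub>B\<^esub>" "\<pi> (f (x j)) = \<one>\<^bsub>B\<^esub>"
        using that psubset.prems(2)[OF j(1)] j(1) by (auto simp: f_def)
      ultimately show ?thesis using that x x' j \<pi>_closed by simp
    qed
    have "(\<Oplus>\<^bsub>D\<^esub>i\<in>I-{j}. \<gamma> i \<otimes>\<^bsub>D\<^esub> \<psi> (x' i)) \<noteq> \<zero>\<^bsub>D\<^esub>"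
    proof (rule psubset.IH)
      show "I - {j} \<subset> I" "i0 \<in> I - {j}" using j psubset.prems(5) by auto
      fix i l
      assume "i \<in> I - {j}" "l \<in> I - {j}"
      then show "\<pi> (sandwich A (ps i) (x' l)) = (if l = i then \<one>\<^bsub>B\<^esub> else \<zero>\<^bsub>B\<^esub>)"
        using psubset.prems(2)[of i l] psubset.prems(1)[of i] x x' \<pi>x'[of l]
          ring_hom_sandwich[OF \<open>ring A\<close> \<open>ring B\<close> \<pi>, of "ps i"] by auto
    qed (use psubset.prems(1,4) x' in auto)
    moreover have "(\<Oplus>\<^bsub>D\<^esub>i\<in>I-{j}. \<gamma> i \<otimes>\<^bsub>D\<^esub> \<psi> (x' i)) = \<zero>\<^bsub>D\<^esub>"
      if zero: "(\<Oplus>\<^bsub>D\<^esub>i\<in>I. \<gamma> i \<otimes>\<^bsub>D\<^esub> \<psi> (x i)) = \<zero>\<^bsub>D\<^esub>"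
    proof -
      \<comment> \<open>The same list pushed to D. It describes f through \<psi> and can also be
        applied to the relation itself, since the coefficients \<gamma> are central.\<close>
      define F where "F = sandwich D (map (map_prod \<psi> \<psi>) (ps j))"
      have Fps: "set (map (map_prod \<psi> \<psi>) (ps j)) \<subseteq> carrier D \<times> carrier D"
        using psubset.prems(1)[OF j(1)] \<psi>_closed by auto
      have \<psi>f: "\<psi> (f a) = F (\<psi> a)" if "a \<in> carrier A" for a
        unfolding f_def F_def using ring_hom_sandwich[OF \<open>ring A\<close> \<open>ring D\<close> \<psi>] psubset.prems(1)[OF j(1)] that by simp
      have F_closed: "F d \<in> carrier D" if "d \<in> carrier D" for d
        unfolding F_def using Fps that by (rule D.sandwich_closed)
      have \<psi>x': "\<psi> (x' i) \<oplus>\<^bsub>D\<^esub> F (\<psi> (x i)) \<otimes>\<^bsub>D\<^esub> \<psi> (x j) = F (\<psi> (x j)) \<otimes>\<^bsub>D\<^esub> \<psi> (x i)" if "i \<in> I" for i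
      proof -
        have "x' i \<oplus>\<^bsub>A\<^esub> f (x i) \<otimes>\<^bsub>A\<^esub> x j = f (x j) \<otimes>\<^bsub>A\<^esub> x i"
          using that x j f_closed by (simp add: x'_def A.minus_eq A.a_assoc A.l_neg)
        then have "\<psi> (x' i) \<oplus>\<^bsub>D\<^esub> \<psi> (f (x i)) \<otimes>\<^bsub>D\<^esub> \<psi> (x j) = \<psi> (f (x j)) \<otimes>\<^bsub>D\<^esub> \<psi> (x i)"
          using that x j f_closed x' by (metis \<psi>_simps(1,2) A.m_closed)
        then show ?thesis using \<psi>f x j that by simp
      qed
      define y where "y i = \<psi> (x i)" for i
      define y' where "y' i = \<psi> (x' i)" for i
      have y: "y i \<in> carrier D" "y' i \<in> carrier D" if "i \<in> I" for i
        using that x x' \<psi>_closed by (auto simp: y_def y'_def)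
      have yj: "y j \<in> carrier D" using y j by blast
      have summand: "\<gamma> i \<otimes>\<^bsub>D\<^esub> y' i \<oplus>\<^bsub>D\<^esub> F (\<gamma> i \<otimes>\<^bsub>D\<^esub> y i) \<otimes>\<^bsub>D\<^esub> y j = F (y j) \<otimes>\<^bsub>D\<^esub> (\<gamma> i \<otimes>\<^bsub>D\<^esub> y i)"
        if i: "i \<in> I" for i
      proof -
        have "F (\<gamma> i \<otimes>\<^bsub>D\<^esub> y i) = \<gamma> i \<otimes>\<^bsub>D\<^esub> F (y i)"
          unfolding F_def using psubset.prems(4)[OF i] Fps y(1)[OF i] by (rule D.sandwich_central)
        then have "\<gamma> i \<otimes>\<^bsub>D\<^esub> y' i \<oplus>\<^bsub>D\<^esub> F (\<gamma> i \<otimes>\<^bsub>D\<^esub> y i) \<otimes>\<^bsub>D\<^esub> y j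
            = \<gamma> i \<otimes>\<^bsub>D\<^esub> (y' i \<oplus>\<^bsub>D\<^esub> F (y i) \<otimes>\<^bsub>D\<^esub> y j)"
          using \<gamma>c[OF i] y[OF i] yj F_closed by (simp add: D.r_distr D.m_assoc)
        also have "\<dots> = \<gamma> i \<otimes>\<^bsub>D\<^esub> (F (y j) \<otimes>\<^bsub>D\<^esub> y i)"
          using \<psi>x'[OF i] by (simp add: y_def y'_def)
        also have "\<dots> = (\<gamma> i \<otimes>\<^bsub>D\<^esub> F (y j)) \<otimes>\<^bsub>D\<^esub> y i"
          using \<gamma>c[OF i] y[OF i] yj F_closed by (simp add: D.m_assoc)
        also have "\<gamma> i \<otimes>\<^bsub>D\<^esub> F (y j) = F (y j) \<otimes>\<^bsub>D\<^esub> \<gamma> i"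
          using psubset.prems(4)[OF i] F_closed[OF yj] by (simp add: ring_center_def)
        finally show ?thesis
          using \<gamma>c[OF i] y[OF i] yj F_closed by (simp add: D.m_assoc)
      qed
      let ?S = "\<Oplus>\<^bsub>D\<^esub>i\<in>I. \<gamma> i \<otimes>\<^bsub>D\<^esub> y' i"
      have S: "?S \<in> carrier D" using \<gamma>c y by (intro D.finsum_closed) auto
      have "(\<Oplus>\<^bsub>D\<^esub>i\<in>I. F (\<gamma> i \<otimes>\<^bsub>D\<^esub> y i) \<otimes>\<^bsub>D\<^esub> y j) = (\<Oplus>\<^bsub>D\<^esub>i\<in>I. F (\<gamma> i \<otimes>\<^bsub>D\<^esub> y i)) \<otimes>\<^bsub>D\<^esub> y j"
        using psubset.hyps \<gamma>c y yj F_closed by (intro D.finsum_ldistr[symmetric]) auto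
      also have "(\<Oplus>\<^bsub>D\<^esub>i\<in>I. F (\<gamma> i \<otimes>\<^bsub>D\<^esub> y i)) = F (\<Oplus>\<^bsub>D\<^esub>i\<in>I. \<gamma> i \<otimes>\<^bsub>D\<^esub> y i)"
        unfolding F_def using Fps psubset.hyps \<gamma>c y by (intro D.sandwich_finsum[symmetric]) auto
      also have "\<dots> = \<zero>\<^bsub>D\<^esub>"
        using zero D.sandwich_zero[OF Fps] by (simp add: y_def F_def)
      finally have 1: "(\<Oplus>\<^bsub>D\<^esub>i\<in>I. F (\<gamma> i \<otimes>\<^bsub>D\<^esub> y i) \<otimes>\<^bsub>D\<^esub> y j) = \<zero>\<^bsub>D\<^esub>"
        using yj by simp
      \<comment> \<open>Sum \<open>summand\<close> over all i. What is added on the left is F of the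
        relation times \<open>y j\<close>, and the right side is \<open>F (y j)\<close> times the
        relation; both are zero.\<close>
      have "?S = ?S \<oplus>\<^bsub>D\<^esub> (\<Oplus>\<^bsub>D\<^esub>i\<in>I. F (\<gamma> i \<otimes>\<^bsub>D\<^esub> y i) \<otimes>\<^bsub>D\<^esub> y j)"
        using S 1 by simp
      also have "\<dots> = (\<Oplus>\<^bsub>D\<^esub>i\<in>I. \<gamma> i \<otimes>\<^bsub>D\<^esub> y' i \<oplus>\<^bsub>D\<^esub> F (\<gamma> i \<otimes>\<^bsub>D\<^esub> y i) \<otimes>\<^bsub>D\<^esub> y j)"
        using \<gamma>c y yj F_closed by (intro D.finsum_addf[symmetric]) auto
      also have "\<dots> = (\<Oplus>\<^bsub>D\<^esub>i\<in>I. F (y j) \<otimes>\<^bsub>D\<^esub> (\<gamma> i \<otimes>\<^bsub>D\<^esub> y i))"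
        using \<gamma>c y yj F_closed summand by (intro D.finsum_cong') auto
      also have "\<dots> = F (y j) \<otimes>\<^bsub>D\<^esub> (\<Oplus>\<^bsub>D\<^esub>i\<in>I. \<gamma> i \<otimes>\<^bsub>D\<^esub> y i)"
        using psubset.hyps \<gamma>c y yj F_closed by (intro D.finsum_rdistr[symmetric]) auto
      also have "\<dots> = \<zero>\<^bsub>D\<^esub>"
        using zero F_closed[OF yj] by (simp add: y_def)
      finally have "?S = \<zero>\<^bsub>D\<^esub>" .
      \<comment> \<open>For i = j the crosswise difference cancels, and so the j-th term leaves the
        relation whatever its coefficient is.\<close>
      moreover have "y' j = \<zero>\<^bsub>D\<^esub>"
      proof -
        have "x' j = \<zero>\<^bsub>A\<^esub>" using x j f_closed by (simp add: x'_def A.minus_eq A.r_neg)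
        then show ?thesis by (simp add: y'_def \<psi>_simps(3))
      qed
      moreover have "?S = \<gamma> j \<otimes>\<^bsub>D\<^esub> y' j \<oplus>\<^bsub>D\<^esub> (\<Oplus>\<^bsub>D\<^esub>i\<in>I-{j}. \<gamma> i \<otimes>\<^bsub>D\<^esub> y' i)"
        using D.finsum_insert[of "I - {j}" j "\<lambda>i. \<gamma> i \<otimes>\<^bsub>D\<^esub> y' i"] psubset.hyps \<gamma>c y j
        by (auto simp: insert_absorb)
      moreover have "(\<Oplus>\<^bsub>D\<^esub>i\<in>I-{j}. \<gamma> i \<otimes>\<^bsub>D\<^esub> y' i) \<in> carrier D"
        using \<gamma>c y by (intro D.finsum_closed) auto
      ultimately show ?thesis
        using \<gamma>c[OF j(1)] by (simp add: y'_def)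
    qed
    ultimately show ?thesis by blast
  qed
qed

subsection \<open>Linear independence at a prime\<close>

context abelian_group
begin

lemma add_minus_add:
  assumes "a \<in> carrier G" "b \<in> carrier G" "c \<in> carrier G" "d \<in> carrier G"
  shows "(a \<oplus> b) \<ominus> (c \<oplus> d) = (a \<ominus> c) \<oplus> (b \<ominus> d)"
  using assms by (simp add: minus_eq minus_add a_ac)

lemma minus_add_cancel:
  assumes "a \<in> carrier G" "e \<in> carrier G" "l \<in> carrier G"
  shows "a \<ominus> (e \<oplus> l) \<oplus> e = a \<ominus> l"
proof -
  have "a \<ominus> (e \<oplus> l) \<oplus> e = (a \<ominus> l) \<oplus> (\<ominus> e \<oplus> e)"
    unfolding minus_eq minus_add[OF assms(2,3)] using assms by (simp only: a_ac a_closed a_inv_closed)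
  then show ?thesis using assms by (simp add: l_neg)
qed

lemma minus_minus_add_cancel:
  assumes "a \<in> carrier G" "b \<in> carrier G" "e \<in> carrier G" "l \<in> carrier G" "k \<in> carrier G"
  shows "(a \<ominus> (e \<oplus> l)) \<ominus> (b \<ominus> (e \<oplus> k)) = (a \<ominus> b) \<ominus> (l \<ominus> k)"
proof -
  have "(a \<ominus> (e \<oplus> l)) \<ominus> (b \<ominus> (e \<oplus> k)) = ((a \<ominus> b) \<ominus> (l \<ominus> k)) \<oplus> (\<ominus> e \<oplus> e)"
    using assms by (simp add: minus_eq minus_add a_ac del: r_neg l_neg)
  then show ?thesis using assms by (simp add: l_neg)
qed

lemma add_minus_cancel_left:
  assumes "a \<in> carrier G" "e \<in> carrier G"
  shows "(e \<oplus> a) \<ominus> e = a"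
  using assms by (simp add: minus_eq a_comm[of e a] a_assoc r_neg)

end

context module
begin

lemma submodule_minus:
  assumes "submodule R N M" "x \<in> N" "y \<in> N"
  shows "x \<ominus>\<^bsub>M\<^esub> y \<in> N"
proof -
  interpret N: submodule R N M by fact
  have y: "y \<in> carrier M" using N.subset assms(3) by blast
  have "(\<ominus> \<one>) \<odot>\<^bsub>M\<^esub> y = \<ominus>\<^bsub>M\<^esub> y"
    using y by (simp add: smult_l_minus)
  then have "\<ominus>\<^bsub>M\<^esub> y \<in> N"
    using N.smult_closed[of "\<ominus> \<one>" y] assms(3) by simp
  then show ?thesis using assms(2) by (simp add: M.minus_eq)
qed

lemma submodule_cancel:
  assumes "submodule R N M" "x \<ominus>\<^bsub>M\<^esub> y \<in> N" "y \<in> N" "x \<in> carrier M"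
  shows "x \<in> N"
proof -
  interpret N: submodule R N M by fact
  have "y \<in> carrier M" using N.subset assms(3) by blast
  then have "(x \<ominus>\<^bsub>M\<^esub> y) \<oplus>\<^bsub>M\<^esub> y = x"
    using assms(4) by (simp add: M.minus_eq M.a_assoc M.l_neg)
  then show ?thesis using N.m_closed[OF assms(2,3)] by simp
qed

lemma smult_minus: "\<lbrakk>r \<in> carrier R; x \<in> carrier M; y \<in> carrier M\<rbrakk> \<Longrightarrow> r \<odot>\<^bsub>M\<^esub> (x \<ominus>\<^bsub>M\<^esub> y) = r \<odot>\<^bsub>M\<^esub> x \<ominus>\<^bsub>M\<^esub> r \<odot>\<^bsub>M\<^esub> y"
  by (simp add: M.minus_eq smult_r_distr smult_r_minus)

lemma minus_smult: "\<lbrakk>r \<in> carrier R; s \<in> carrier R; x \<in> carrier M\<rbrakk> \<Longrightarrow> (r \<ominus> s) \<odot>\<^bsub>M\<^esub> x = r \<odot>\<^bsub>M\<^esub> x \<ominus>\<^bsub>M\<^esub> s \<odot>\<^bsub>M\<^esub> x"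
  by (simp add: M.minus_eq R.minus_eq smult_l_distr smult_l_minus)

definition combination :: "'i set \<Rightarrow> ('i \<Rightarrow> 'a) \<Rightarrow> ('i \<Rightarrow> 'c) \<Rightarrow> 'c"
  where "combination I c u = (\<Oplus>\<^bsub>M\<^esub>i\<in>I. c i \<odot>\<^bsub>M\<^esub> u i)"

lemma combination_closed [simp, intro]:
  "\<lbrakk>\<And>i. i \<in> I \<Longrightarrow> c i \<in> carrier R; \<And>i. i \<in> I \<Longrightarrow> u i \<in> carrier M\<rbrakk> \<Longrightarrow> combination I c u \<in> carrier M"
  unfolding combination_def by (intro M.finsum_closed) auto

lemma combination_cong:
  assumes "\<And>i. i \<in> I \<Longrightarrow> c i \<in> carrier R" "\<And>i. i \<in> I \<Longrightarrow> u i \<in> carrier M"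
    "\<And>i. i \<in> I \<Longrightarrow> d i = c i" "\<And>i. i \<in> I \<Longrightarrow> v i = u i"
  shows "combination I d v = combination I c u"
  unfolding combination_def using assms by (intro M.finsum_cong') auto

lemma combination_empty: "combination {} c u = \<zero>\<^bsub>M\<^esub>"
  by (simp add: combination_def)

lemma combination_insert:
  assumes "finite I" "j \<notin> I" "\<And>i. i \<in> insert j I \<Longrightarrow> c i \<in> carrier R" "\<And>i. i \<in> insert j I \<Longrightarrow> u i \<in> carrier M"
  shows "combination (insert j I) c u = c j \<odot>\<^bsub>M\<^esub> u j \<oplus>\<^bsub>M\<^esub> combination I c u"
  unfolding combination_def using assms by (intro M.finsum_insert) auto

lemma combination_smult:
  assumes "a \<in> carrier R" "\<And>i. i \<in> I \<Longrightarrow> c i \<in> carrier R" "\<And>i. i \<in> I \<Longrightarrow> u i \<in> carrier M"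
  shows "combination I (\<lambda>i. a \<otimes> c i) u = a \<odot>\<^bsub>M\<^esub> combination I c u"
proof -
  have "a \<odot>\<^bsub>M\<^esub> combination I c u = (\<Oplus>\<^bsub>M\<^esub>i\<in>I. a \<odot>\<^bsub>M\<^esub> (c i \<odot>\<^bsub>M\<^esub> u i))"
    unfolding combination_def using assms by (intro finsum_smult) auto
  also have "\<dots> = combination I (\<lambda>i. a \<otimes> c i) u"
    unfolding combination_def using assms by (intro M.finsum_cong') (auto simp: smult_assoc1)
  finally show ?thesis ..
qed

lemma combination_add:
  assumes "\<And>i. i \<in> I \<Longrightarrow> c i \<in> carrier R" "\<And>i. i \<in> I \<Longrightarrow> d i \<in> carrier R" "\<And>i. i \<in> I \<Longrightarrow> u i \<in> carrier M"
  shows "combination I (\<lambda>i. c i \<oplus> d i) u = combination I c u \<oplus>\<^bsub>M\<^esub> combination I d u"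
proof -
  have "combination I (\<lambda>i. c i \<oplus> d i) u = (\<Oplus>\<^bsub>M\<^esub>i\<in>I. c i \<odot>\<^bsub>M\<^esub> u i \<oplus>\<^bsub>M\<^esub> d i \<odot>\<^bsub>M\<^esub> u i)"
    unfolding combination_def using assms by (intro M.finsum_cong') (auto simp: smult_l_distr)
  also have "\<dots> = combination I c u \<oplus>\<^bsub>M\<^esub> combination I d u"
    unfolding combination_def using assms by (intro M.finsum_addf) auto
  finally show ?thesis .
qed

lemma combination_minus:
  assumes "\<And>i. i \<in> I \<Longrightarrow> c i \<in> carrier R" "\<And>i. i \<in> I \<Longrightarrow> d i \<in> carrier R" "\<And>i. i \<in> I \<Longrightarrow> u i \<in> carrier M"
  shows "combination I (\<lambda>i. c i \<ominus> d i) u = combination I c u \<ominus>\<^bsub>M\<^esub> combination I d u"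
proof -
  have "combination I (\<lambda>i. c i \<ominus> d i) u = combination I (\<lambda>i. c i \<oplus> (\<ominus> \<one>) \<otimes> d i) u"
    using assms by (intro combination_cong) (auto simp: R.minus_eq R.l_minus)
  also have "\<dots> = combination I c u \<oplus>\<^bsub>M\<^esub> (\<ominus> \<one>) \<odot>\<^bsub>M\<^esub> combination I d u"
    using assms by (subst combination_add) (auto simp: combination_smult)
  finally show ?thesis
    using assms by (simp add: M.minus_eq smult_l_minus)
qed

lemma combination_indicator:
  assumes "finite I" "j \<in> I" "a \<in> carrier R" "\<And>i. i \<in> I \<Longrightarrow> u i \<in> carrier M"
  shows "combination I (\<lambda>i. if i = j then a else \<zero>) u = a \<odot>\<^bsub>M\<^esub> u j"
proof -
  have "combination I (\<lambda>i. if i = j then a else \<zero>) u = (\<Oplus>\<^bsub>M\<^esub>i\<in>I. if j = i then a \<odot>\<^bsub>M\<^esub> u j else \<zero>\<^bsub>M\<^esub>)"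
    unfolding combination_def using assms by (intro M.finsum_cong') auto
  also have "\<dots> = a \<odot>\<^bsub>M\<^esub> u j"
    using M.add.finprod_singleton[OF assms(2,1), of "\<lambda>i. a \<odot>\<^bsub>M\<^esub> u j"] assms by auto
  finally show ?thesis .
qed

text \<open>All multiples of w are gathered in one coefficient. In
  \<open>card_independent_le\<close> the vector w is the pivot, and this rewrites a relation between
  the reduced vectors as one between the original vectors.\<close>

lemma combination_shift:
  assumes "finite I" "w \<in> carrier M"
    "\<And>i. i \<in> I \<Longrightarrow> c i \<in> carrier R" "\<And>i. i \<in> I \<Longrightarrow> a i \<in> carrier R" "\<And>i. i \<in> I \<Longrightarrow> b i \<in> carrier R"
    "\<And>i. i \<in> I \<Longrightarrow> u i \<in> carrier M"
  shows "combination I c (\<lambda>i. a i \<odot>\<^bsub>M\<^esub> u i \<ominus>\<^bsub>M\<^esub> b i \<odot>\<^bsub>M\<^esub> w) =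
    combination I (\<lambda>i. c i \<otimes> a i) u \<oplus>\<^bsub>M\<^esub> (\<Oplus>i\<in>I. \<ominus> (c i \<otimes> b i)) \<odot>\<^bsub>M\<^esub> w"
proof -
  have "combination I c (\<lambda>i. a i \<odot>\<^bsub>M\<^esub> u i \<ominus>\<^bsub>M\<^esub> b i \<odot>\<^bsub>M\<^esub> w) =
      (\<Oplus>\<^bsub>M\<^esub>i\<in>I. (c i \<otimes> a i) \<odot>\<^bsub>M\<^esub> u i \<oplus>\<^bsub>M\<^esub> (\<ominus> (c i \<otimes> b i)) \<odot>\<^bsub>M\<^esub> w)"
    unfolding combination_def using assms
    by (intro M.finsum_cong') (auto simp: smult_minus smult_assoc1 smult_l_minus M.minus_eq[symmetric])
  also have "\<dots> = combination I (\<lambda>i. c i \<otimes> a i) u \<oplus>\<^bsub>M\<^esub> (\<Oplus>\<^bsub>M\<^esub>i\<in>I. (\<ominus> (c i \<otimes> b i)) \<odot>\<^bsub>M\<^esub> w)"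
    unfolding combination_def using assms by (intro M.finsum_addf) auto
  also have "(\<Oplus>\<^bsub>M\<^esub>i\<in>I. (\<ominus> (c i \<otimes> b i)) \<odot>\<^bsub>M\<^esub> w) = (\<Oplus>i\<in>I. \<ominus> (c i \<otimes> b i)) \<odot>\<^bsub>M\<^esub> w"
    using assms by (intro finsum_smult_r[symmetric]) auto
  finally show ?thesis .
qed

end

section \<open>Linear algebra over a residue field with denominators cleared\<close>

text \<open>The conditions say that M/N is a torsion-free module over the domain R/p. It therefore
  embeds into a vector space over the field of fractions, and N is the kernel of the map from M to
  that space.\<close>

locale residue_submodule = module R M + p?: primeideal p R
  for R (structure) and M (structure) and p +
  fixes N
  assumes N_submodule: "submodule R N M"
    and smult_prime: "\<lbrakk>r \<in> p; x \<in> carrier M\<rbrakk> \<Longrightarrow> r \<odot>\<^bsub>M\<^esub> x \<in> N"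
    and saturated: "\<lbrakk>t \<in> carrier R; t \<notin> p; x \<in> carrier M; t \<odot>\<^bsub>M\<^esub> x \<in> N\<rbrakk> \<Longrightarrow> x \<in> N"
begin

sublocale N: submodule R N M by (rule N_submodule)

text \<open>Linear independence of the images in that vector space: a relation over the field may be
  multiplied by a common denominator, and a coefficient from R is zero in the field iff it lies in
  p. In \<open>spanned\<close> the factor t is the denominator.\<close>

definition independent :: "'i set \<Rightarrow> ('i \<Rightarrow> 'c) \<Rightarrow> bool"
  where "independent I u \<longleftrightarrow>
    (\<forall>c. (\<forall>i\<in>I. c i \<in> carrier R) \<and> combination I c u \<in> N \<longrightarrow> (\<forall>i\<in>I. c i \<in> p))"

definition spanned :: "'i set \<Rightarrow> ('i \<Rightarrow> 'c) \<Rightarrow> 'c \<Rightarrow> bool"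
  where "spanned I u x \<longleftrightarrow> (\<exists>t c. t \<in> carrier R \<and> t \<notin> p \<and> (\<forall>i\<in>I. c i \<in> carrier R) \<and>
    t \<odot>\<^bsub>M\<^esub> x \<ominus>\<^bsub>M\<^esub> combination I c u \<in> N)"

lemma prime_mult_notin: "\<lbrakk>a \<in> carrier R; b \<in> carrier R; a \<notin> p; b \<notin> p\<rbrakk> \<Longrightarrow> a \<otimes> b \<notin> p"
  using p.I_prime by blast

lemma card_independent_le:
  assumes "finite J" "finite I" "\<And>j. j \<in> J \<Longrightarrow> v j \<in> carrier M" "\<And>i. i \<in> I \<Longrightarrow> u i \<in> carrier M"
    "\<And>i. i \<in> I \<Longrightarrow> spanned J v (u i)" "independent I u"
  shows "card I \<le> card J"
  using assms
proof (induction J arbitrary: I u rule: finite_induct)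
  case empty
  have "I = {}"
  proof (rule ccontr)
    assume "I \<noteq> {}"
    then obtain i where i: "i \<in> I" by auto
    obtain t where t: "t \<in> carrier R" "t \<notin> p" "t \<odot>\<^bsub>M\<^esub> u i \<ominus>\<^bsub>M\<^esub> \<zero>\<^bsub>M\<^esub> \<in> N"
      using empty.prems(4)[OF i] by (auto simp: spanned_def combination_empty)
    then have tN: "t \<odot>\<^bsub>M\<^esub> u i \<in> N"
      using empty.prems(3)[OF i] submodule_cancel[OF N_submodule t(3)] by simp
    \<comment> \<open>With no spanning vectors a multiple of \<open>u i\<close> lies in N; its
      coefficient t is outside p, against independence.\<close>
    let ?c = "\<lambda>l. if l = i then t else \<zero>"
    have "combination I ?c u = t \<odot>\<^bsub>M\<^esub> u i"
      using empty.prems i t by (intro combination_indicator) auto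
    then have "combination I ?c u \<in> N" using tN by simp
    then have "\<forall>l\<in>I. ?c l \<in> p"
      using empty.prems(5) t(1) unfolding independent_def by (elim allE[of _ ?c]) auto
    then show False using i t(2) by auto
  qed
  then show ?case by simp
next
  case (insert j J)
  note finI = \<open>finite I\<close> and u = insert.prems(3) and ind = insert.prems(5)
  have v: "v l \<in> carrier M" if "l \<in> J" for l using insert.prems(2) that by blast
  have vj: "v j \<in> carrier M" using insert.prems(2) by blast
  have "\<forall>i. \<exists>t c. i \<in> I \<longrightarrow> t \<in> carrier R \<and> t \<notin> p \<and> (\<forall>l\<in>insert j J. c l \<in> carrier R) \<and>
      t \<odot>\<^bsub>M\<^esub> u i \<ominus>\<^bsub>M\<^esub> combination (insert j J) c v \<in> N"
    using insert.prems(4) unfolding spanned_def by blast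
  then obtain t where "\<forall>i. \<exists>c. i \<in> I \<longrightarrow> t i \<in> carrier R \<and> t i \<notin> p \<and> (\<forall>l\<in>insert j J. c l \<in> carrier R) \<and>
      t i \<odot>\<^bsub>M\<^esub> u i \<ominus>\<^bsub>M\<^esub> combination (insert j J) c v \<in> N"
    by (rule choice[THEN exE])
  then obtain c where tc: "\<forall>i. i \<in> I \<longrightarrow> t i \<in> carrier R \<and> t i \<notin> p \<and> (\<forall>l\<in>insert j J. c i l \<in> carrier R) \<and>
      t i \<odot>\<^bsub>M\<^esub> u i \<ominus>\<^bsub>M\<^esub> combination (insert j J) (c i) v \<in> N"
    by (rule choice[THEN exE])
  have t: "t i \<in> carrier R" "t i \<notin> p" if "i \<in> I" for i using tc that by auto
  have c: "c i l \<in> carrier R" if "i \<in> I" "l \<in> insert j J" for i l using tc that by auto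
  define d where "d i = c i j" for i
  define L where "L i = combination J (c i) v" for i
  have d: "d i \<in> carrier R" if "i \<in> I" for i using c that by (simp add: d_def)
  have L: "L i \<in> carrier M" if "i \<in> I" for i using c that v by (auto simp: L_def)
  have rel: "t i \<odot>\<^bsub>M\<^esub> u i \<ominus>\<^bsub>M\<^esub> (d i \<odot>\<^bsub>M\<^esub> v j \<oplus>\<^bsub>M\<^esub> L i) \<in> N" if i: "i \<in> I" for i
  proof -
    have "combination (insert j J) (c i) v = d i \<odot>\<^bsub>M\<^esub> v j \<oplus>\<^bsub>M\<^esub> L i"
      unfolding d_def L_def using insert.hyps c[OF i] v vj by (intro combination_insert) auto
    then show ?thesis using tc i by auto
  qed
  show ?case
  proof (cases "\<forall>i\<in>I. d i \<in> p")
    case True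
    \<comment> \<open>All coefficients of \<open>v j\<close> lie in p, so the terms with
      \<open>v j\<close> belong to N and can be added back.\<close>
    have "spanned J v (u i)" if i: "i \<in> I" for i
    proof -
      have "t i \<odot>\<^bsub>M\<^esub> u i \<ominus>\<^bsub>M\<^esub> (d i \<odot>\<^bsub>M\<^esub> v j \<oplus>\<^bsub>M\<^esub> L i) \<oplus>\<^bsub>M\<^esub> d i \<odot>\<^bsub>M\<^esub> v j \<in> N"
        using rel[OF i] smult_prime[of "d i" "v j"] True i vj by blast
      moreover have "t i \<odot>\<^bsub>M\<^esub> u i \<ominus>\<^bsub>M\<^esub> (d i \<odot>\<^bsub>M\<^esub> v j \<oplus>\<^bsub>M\<^esub> L i) \<oplus>\<^bsub>M\<^esub> d i \<odot>\<^bsub>M\<^esub> v j = t i \<odot>\<^bsub>M\<^esub> u i \<ominus>\<^bsub>M\<^esub> L i"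
        using t[OF i] u[OF i] d[OF i] L[OF i] vj by (intro M.minus_add_cancel) auto
      ultimately show ?thesis
        using t[OF i] c[OF i] unfolding spanned_def L_def by (intro exI[of _ "t i"] exI[of _ "c i"]) auto
    qed
    then have "card I \<le> card J"
      using insert.IH[OF finI v u _ ind] by blast
    then show ?thesis using insert.hyps by simp
  next
    case False
    then obtain i0 where i0: "i0 \<in> I" "d i0 \<notin> p" by auto
    \<comment> \<open>Modulo N, \<open>t i\<close> times \<open>u i\<close> is \<open>d i\<close>
      times \<open>v j\<close> plus \<open>L i\<close>. Multiplying crosswise by \<open>d i0\<close>
      and \<open>d i\<close> cancels \<open>v j\<close> and leaves a combination over J.\<close>
    define u' where "u' i = (d i0 \<otimes> t i) \<odot>\<^bsub>M\<^esub> u i \<ominus>\<^bsub>M\<^esub> (d i \<otimes> t i0) \<odot>\<^bsub>M\<^esub> u i0" for i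
    have u': "u' i \<in> carrier M" if "i \<in> I" for i
      using that t d u i0 by (auto simp: u'_def)
    have "spanned J v (u' i)" if "i \<in> I - {i0}" for i
    proof -
      have i: "i \<in> I" using that by simp
      note m = t[OF i] t[OF i0(1)] d[OF i] d[OF i0(1)] u[OF i] u[OF i0(1)] L[OF i] L[OF i0(1)] vj
      let ?c = "\<lambda>l. d i0 \<otimes> c i l \<ominus> d i \<otimes> c i0 l"
      have "combination J ?c v = d i0 \<odot>\<^bsub>M\<^esub> L i \<ominus>\<^bsub>M\<^esub> d i \<odot>\<^bsub>M\<^esub> L i0"
        unfolding L_def using m c i i0(1) v by (subst combination_minus) (auto simp: combination_smult)
      have N: "d i0 \<odot>\<^bsub>M\<^esub> (t i \<odot>\<^bsub>M\<^esub> u i \<ominus>\<^bsub>M\<^esub> (d i \<odot>\<^bsub>M\<^esub> v j \<oplus>\<^bsub>M\<^esub> L i)) \<ominus>\<^bsub>M\<^esub>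
          d i \<odot>\<^bsub>M\<^esub> (t i0 \<odot>\<^bsub>M\<^esub> u i0 \<ominus>\<^bsub>M\<^esub> (d i0 \<odot>\<^bsub>M\<^esub> v j \<oplus>\<^bsub>M\<^esub> L i0)) \<in> N" (is "?lhs \<in> N")
        by (intro submodule_minus[OF N_submodule] N.smult_closed rel m i i0(1))
      define a b e l l0 where "a = (d i0 \<otimes> t i) \<odot>\<^bsub>M\<^esub> u i" and "b = (d i \<otimes> t i0) \<odot>\<^bsub>M\<^esub> u i0"
        and "e = (d i0 \<otimes> d i) \<odot>\<^bsub>M\<^esub> v j" and "l = d i0 \<odot>\<^bsub>M\<^esub> L i" and "l0 = d i \<odot>\<^bsub>M\<^esub> L i0"
      have abe: "a \<in> carrier M" "b \<in> carrier M" "e \<in> carrier M" "l \<in> carrier M" "l0 \<in> carrier M"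
        using m by (auto simp: a_def b_def e_def l_def l0_def)
      have e': "(d i \<otimes> d i0) \<odot>\<^bsub>M\<^esub> v j = e" using m by (simp add: e_def R.m_comm)
      have "?lhs = (a \<ominus>\<^bsub>M\<^esub> (e \<oplus>\<^bsub>M\<^esub> l)) \<ominus>\<^bsub>M\<^esub> (b \<ominus>\<^bsub>M\<^esub> (e \<oplus>\<^bsub>M\<^esub> l0))"
        using m e' by (simp add: smult_minus smult_r_distr smult_assoc1[symmetric] a_def b_def e_def l_def l0_def)
      also have "\<dots> = (a \<ominus>\<^bsub>M\<^esub> b) \<ominus>\<^bsub>M\<^esub> (l \<ominus>\<^bsub>M\<^esub> l0)"
        using abe by (intro M.minus_minus_add_cancel)
      also have "\<dots> = \<one> \<odot>\<^bsub>M\<^esub> u' i \<ominus>\<^bsub>M\<^esub> combination J ?c v"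
        using u' i \<open>combination J ?c v = _\<close> by (simp add: u'_def a_def b_def l_def l0_def)
      finally have "\<one> \<odot>\<^bsub>M\<^esub> u' i \<ominus>\<^bsub>M\<^esub> combination J ?c v \<in> N" using N by simp
      moreover have "\<one> \<notin> p" using p.one_imp_carrier p.I_notcarr by auto
      ultimately show ?thesis
        unfolding spanned_def using m c i i0(1) by (intro exI[of _ \<one>] exI[of _ ?c]) auto
    qed
    moreover have "independent (I - {i0}) u'"
      unfolding independent_def
    proof (intro allI impI ballI, elim conjE)
      fix a i
      assume a: "\<forall>i\<in>I - {i0}. a i \<in> carrier R" and aN: "combination (I - {i0}) a u' \<in> N" and i: "i \<in> I - {i0}"
      \<comment> \<open>The relation rewritten in the original vectors, with every contribution of
        the pivot collected at i0. At the other indices the factor \<open>d i0 \<otimes> t l\<close>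
        is outside p, so it can be cancelled at the end.\<close>
      define b where "b l = (if l = i0 then (\<Oplus>l\<in>I-{i0}. \<ominus> (a l \<otimes> (d l \<otimes> t i0))) else a l \<otimes> (d i0 \<otimes> t l))" for l
      have b: "b l \<in> carrier R" if "l \<in> I" for l
        using that a d t i0(1) by (auto simp: b_def intro!: R.finsum_closed)
      have "combination (I - {i0}) a u' =
          combination (I - {i0}) (\<lambda>l. a l \<otimes> (d i0 \<otimes> t l)) u \<oplus>\<^bsub>M\<^esub> b i0 \<odot>\<^bsub>M\<^esub> u i0"
        unfolding u'_def using finI a d t i0(1) u by (subst combination_shift) (auto simp: b_def)
      also have "combination (I - {i0}) (\<lambda>l. a l \<otimes> (d i0 \<otimes> t l)) u = combination (I - {i0}) b u"
        using u by (intro combination_cong b) (auto simp: b_def)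
      also have "combination (I - {i0}) b u \<oplus>\<^bsub>M\<^esub> b i0 \<odot>\<^bsub>M\<^esub> u i0 = b i0 \<odot>\<^bsub>M\<^esub> u i0 \<oplus>\<^bsub>M\<^esub> combination (I - {i0}) b u"
        using b u i0(1) by (intro M.a_comm) auto
      also have "\<dots> = combination (insert i0 (I - {i0})) b u"
        using finI b u i0(1) by (intro combination_insert[symmetric]) auto
      also have "insert i0 (I - {i0}) = I" using i0(1) by auto
      finally have "combination I b u \<in> N" using aN by simp
      then have "b i \<in> p" using ind b i unfolding independent_def by blast
      then have "a i \<otimes> (d i0 \<otimes> t i) \<in> p" using i by (auto simp: b_def)
      moreover have "d i0 \<otimes> t i \<notin> p"
        using prime_mult_notin d t i i0 by auto
      ultimately show "a i \<in> p" using p.I_prime a d t i i0(1) by (meson DiffD1 R.m_closed)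
    qed
    ultimately have "card (I - {i0}) \<le> card J"
      using insert.IH[of "I - {i0}" u'] finI v u' by auto
    then show ?thesis using insert.hyps finI i0(1) by (simp add: card_Diff_singleton_if)
  qed
qed

text \<open>If x were not spanned, adjoining it at index n would give n + 1 independent vectors in a
  space spanned by n.\<close>

lemma spanned_by_maximal_independent:
  fixes n :: nat
  assumes "\<And>i. i < n \<Longrightarrow> u i \<in> carrier M" "independent {..<n} u"
    and "\<And>i. i < n \<Longrightarrow> v i \<in> carrier M" "\<And>x. x \<in> carrier M \<Longrightarrow> spanned {..<n} v x"
    and x: "x \<in> carrier M"
  shows "spanned {..<n} u x"
proof (rule ccontr)
  assume not: "\<not> spanned {..<n} u x"
  let ?u = "u(n := x)"
  have "independent {..<Suc n} ?u"
    unfolding independent_def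
  proof (intro allI impI, elim conjE)
    fix c
    assume c: "\<forall>i\<in>{..<Suc n}. c i \<in> carrier R" and cN: "combination {..<Suc n} c ?u \<in> N"
    have S: "{..<Suc n} = insert n {..<n}" by auto
    have eq: "combination {..<Suc n} c ?u = c n \<odot>\<^bsub>M\<^esub> x \<oplus>\<^bsub>M\<^esub> combination {..<n} c u"
      unfolding S using c assms(1) x
      by (subst combination_insert) (auto intro!: arg_cong2[of _ _ _ _ "add M"] combination_cong)
    have C: "combination {..<n} c u \<in> carrier M" using c assms(1) by auto
    have "c n \<in> p"
    proof (rule ccontr)
      \<comment> \<open>Then \<open>c n\<close> is an admissible denominator and the relation
        expresses x through u.\<close>
      assume "c n \<notin> p"
      moreover have "combination {..<n} (\<lambda>i. (\<ominus> \<one>) \<otimes> c i) u = \<ominus>\<^bsub>M\<^esub> combination {..<n} c u"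
        using c C assms(1) by (subst combination_smult) (auto simp: smult_l_minus)
      then have "c n \<odot>\<^bsub>M\<^esub> x \<ominus>\<^bsub>M\<^esub> combination {..<n} (\<lambda>i. (\<ominus> \<one>) \<otimes> c i) u = combination {..<Suc n} c ?u"
        using C by (simp add: eq M.minus_eq)
      ultimately have "spanned {..<n} u x"
        using c cN unfolding spanned_def by (intro exI[of _ "c n"] exI[of _ "\<lambda>i. (\<ominus> \<one>) \<otimes> c i"]) auto
      with not show False by simp
    qed
    moreover have "combination {..<n} c u \<in> N"
    proof -
      have "c n \<odot>\<^bsub>M\<^esub> x \<in> N" using smult_prime[OF \<open>c n \<in> p\<close> x] .
      then have "combination {..<Suc n} c ?u \<ominus>\<^bsub>M\<^esub> c n \<odot>\<^bsub>M\<^esub> x \<in> N"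
        using cN submodule_minus[OF N_submodule] by blast
      moreover have "combination {..<Suc n} c ?u \<ominus>\<^bsub>M\<^esub> c n \<odot>\<^bsub>M\<^esub> x = combination {..<n} c u"
        unfolding eq using c C x by (intro M.add_minus_cancel_left) auto
      ultimately show ?thesis by simp
    qed
    ultimately show "\<forall>i\<in>{..<Suc n}. c i \<in> p"
      using assms(2) c unfolding independent_def S by auto
  qed
  moreover have "spanned {..<n} v (?u i)" "?u i \<in> carrier M" if "i \<in> {..<Suc n}" for i
    using assms(1,4) x that by (auto simp: less_Suc_eq)
  ultimately have "card {..<Suc n} \<le> card {..<n}"
    using card_independent_le[of "{..<n}" "{..<Suc n}" v ?u] assms(3) by blast
  then show False by simp
qed

end

subsection \<open>Prime ideals and residue kernels\<close>

text \<open>One application of Zorn's lemma for two purposes: with {1} for S it gives maximal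
  ideals, with a multiplicative set it gives prime ideals.\<close>

lemma (in ring) ideal_avoiding:
  assumes "ideal K R" "K \<inter> S = {}"
  shows "\<exists>P. ideal P R \<and> K \<subseteq> P \<and> P \<inter> S = {} \<and>
    (\<forall>J. ideal J R \<and> P \<subseteq> J \<and> J \<inter> S = {} \<longrightarrow> J = P)"
proof -
  let ?A = "{I. ideal I R \<and> K \<subseteq> I \<and> I \<inter> S = {}}"
  have "\<exists>P\<in>?A. \<forall>J\<in>?A. P \<subseteq> J \<longrightarrow> J = P"
  proof (rule subset_Zorn_nonempty)
    show "?A \<noteq> {}" using assms by auto
    fix C
    assume C: "C \<noteq> {}" "subset.chain ?A C"
    then have CA: "C \<subseteq> ?A" by (simp add: subset.chain_def)
    have ideals: "ideal I R" if "I \<in> C" for I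
      using CA that by auto
    have "ideal (\<Union>C) R"
    proof (rule idealI[OF ring_axioms])
      show "subgroup (\<Union>C) (add_monoid R)"
      proof (rule add.subgroupI)
        show "\<Union>C \<subseteq> carrier R"
          using ideal.Icarr[OF ideals] by auto
        obtain I where "I \<in> C" using C(1) by auto
        then show "\<Union>C \<noteq> {}"
          using additive_subgroup.zero_closed[OF ideal.axioms(1)[OF ideals]] by auto
        fix a assume "a \<in> \<Union>C"
        then obtain I where I: "I \<in> C" "a \<in> I" by auto
        then show "\<ominus> a \<in> \<Union>C"
          using additive_subgroup.a_inv_closed[OF ideal.axioms(1)[OF ideals]] by auto
        fix b assume "b \<in> \<Union>C"
        then obtain J where J: "J \<in> C" "b \<in> J" by auto
        have "I \<subseteq> J \<or> J \<subseteq> I"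
          using C(2) I(1) J(1) by (simp add: subset_chain_def)
        then obtain L where L: "L \<in> C" "a \<in> L" "b \<in> L"
        proof
          assume "I \<subseteq> J"
          then show thesis using that[OF J(1)] I J by auto
        next
          assume "J \<subseteq> I"
          then show thesis using that[OF I(1)] I J by auto
        qed
        then show "a \<oplus> b \<in> \<Union>C"
          using additive_subgroup.a_closed[OF ideal.axioms(1)[OF ideals[OF L(1)]]] by auto
      qed
    next
      fix a x assume "a \<in> \<Union>C" and x: "x \<in> carrier R"
      then obtain I where I: "I \<in> C" "a \<in> I" by auto
      show "x \<otimes> a \<in> \<Union>C" "a \<otimes> x \<in> \<Union>C"
        using ideal.I_l_closed[OF ideals[OF I(1)] I(2) x] ideal.I_r_closed[OF ideals[OF I(1)] I(2) x] I(1)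
        by auto
    qed
    moreover obtain I where "I \<in> C" using C(1) by auto
    then have "K \<subseteq> \<Union>C" using CA by auto
    moreover have "\<Union>C \<inter> S = {}" using CA by auto
    ultimately show "\<Union>C \<in> ?A" by simp
  qed
  then obtain P where P: "P \<in> ?A" "\<And>J. J \<in> ?A \<Longrightarrow> P \<subseteq> J \<Longrightarrow> J = P" by (elim bexE) simp
  show ?thesis
    by (intro exI[of _ P]) (use P in auto)
qed

context cring
begin

lemma exists_maximalideal:
  assumes "ideal K R" "\<one> \<notin> K"
  shows "\<exists>m. maximalideal m R \<and> K \<subseteq> m"
proof -
  obtain m where m: "ideal m R" "K \<subseteq> m" "m \<inter> {\<one>} = {}"
      "\<And>J. \<lbrakk>ideal J R; m \<subseteq> J; J \<inter> {\<one>} = {}\<rbrakk> \<Longrightarrow> J = m"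
    using ideal_avoiding[of K "{\<one>}"] assms by auto
  have "maximalideal m R"
  proof (rule maximalidealI[OF m(1)])
    show "carrier R \<noteq> m" using m(3) by auto
    fix J
    assume J: "ideal J R" "m \<subseteq> J"
    show "J = m \<or> J = carrier R"
      using m(4)[OF J] ideal.one_imp_carrier[OF J(1)] by auto
  qed
  with m(2) show ?thesis by blast
qed

text \<open>An ideal P maximal among those disjoint from S is prime. If a and b lie outside P,
  enlarging P by either one meets S. The product of the two meeting elements is in S, but it would
  be in P if ab were.\<close>

lemma exists_primeideal_avoiding:
  assumes S: "S \<subseteq> carrier R" "\<one> \<in> S" "\<And>s t. \<lbrakk>s \<in> S; t \<in> S\<rbrakk> \<Longrightarrow> s \<otimes> t \<in> S" "\<zero> \<notin> S"
  shows "\<exists>P. primeideal P R \<and> P \<inter> S = {}"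
proof -
  obtain P where P: "ideal P R" "P \<inter> S = {}" "\<And>J. \<lbrakk>ideal J R; P \<subseteq> J; J \<inter> S = {}\<rbrakk> \<Longrightarrow> J = P"
    using ideal_avoiding[OF zeroideal, of S] S(4) by auto
  interpret P: ideal P R by fact
  have meet: "\<exists>q\<in>P. \<exists>r\<in>carrier R. q \<oplus> r \<otimes> a \<in> S" if a: "a \<in> carrier R" "a \<notin> P" for a
  proof -
    let ?J = "P <+>\<^bsub>R\<^esub> PIdl a"
    have "ideal ?J R" using add_ideals[OF P(1) cgenideal_ideal[OF a(1)]] .
    moreover have "P \<subseteq> ?J"
    proof
      fix q assume q: "q \<in> P"
      then have "q = q \<oplus> \<zero> \<otimes> a" using a(1) by simp
      then show "q \<in> ?J" using q by (auto simp: set_add_def' cgenideal_def intro!: bexI[of _ q])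
    qed
    moreover have "a \<in> ?J"
    proof -
      have "a = \<zero> \<oplus> \<one> \<otimes> a" using a(1) by simp
      then show ?thesis using P.zero_closed by (fastforce simp: set_add_def' cgenideal_def)
    qed
    ultimately have "?J \<inter> S \<noteq> {}" using P(3) a(2) by blast
    then show ?thesis by (auto simp: set_add_def' cgenideal_def)
  qed
  have "primeideal P R"
  proof (rule primeidealI[OF P(1) is_cring])
    show "carrier R \<noteq> P" using P(2) S(1,2) by auto
    fix a b
    assume ab: "a \<in> carrier R" "b \<in> carrier R" "a \<otimes> b \<in> P"
    show "a \<in> P \<or> b \<in> P"
    proof (rule ccontr)
      assume "\<not> (a \<in> P \<or> b \<in> P)"
      then obtain q r q' r' where *: "q \<in> P" "r \<in> carrier R" "q \<oplus> r \<otimes> a \<in> S"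
          "q' \<in> P" "r' \<in> carrier R" "q' \<oplus> r' \<otimes> b \<in> S"
        using meet ab(1,2) by metis
      have c: "q \<in> carrier R" "q' \<in> carrier R" using * P.a_subset by auto
      have "(q \<oplus> r \<otimes> a) \<otimes> (q' \<oplus> r' \<otimes> b) = (q' \<oplus> r' \<otimes> b) \<otimes> q \<oplus> ((r \<otimes> a) \<otimes> q' \<oplus> (r \<otimes> r') \<otimes> (a \<otimes> b))"
        using c * ab by algebra
      also have "\<dots> \<in> P"
        using c * ab P.I_l_closed by auto
      finally show False using S(3)[OF *(3,6)] P(2) by auto
    qed
  qed
  then show ?thesis using P(2) by blast
qed

end

text \<open>The kernel of \<open>M \<rightarrow> M \<otimes> \<kappa>(p)\<close>.\<close>

definition residue_kernel :: "('r, 'm) ring_scheme \<Rightarrow> ('r, 'a, 'n) module_scheme \<Rightarrow> 'r set \<Rightarrow> 'a set"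
  where "residue_kernel R M p = {x \<in> carrier M. \<exists>t\<in>carrier R - p. t \<odot>\<^bsub>M\<^esub> x \<in> ideal_smult R M p}"

section \<open>Coordinates at a prime and residue kernels\<close>

context module
begin

lemma ideal_smult_gens: "I \<subseteq> carrier R \<Longrightarrow> {r \<odot>\<^bsub>M\<^esub> x | r x. r \<in> I \<and> x \<in> carrier M} \<subseteq> carrier M"
  by auto

lemma ideal_smult_submodule: "I \<subseteq> carrier R \<Longrightarrow> submodule R (ideal_smult R M I) M"
  unfolding ideal_smult_def by (intro span_is_submodule ideal_smult_gens)

lemma ideal_smult_mem: "\<lbrakk>I \<subseteq> carrier R; r \<in> I; x \<in> carrier M\<rbrakk> \<Longrightarrow> r \<odot>\<^bsub>M\<^esub> x \<in> ideal_smult R M I"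
  unfolding ideal_smult_def by (intro subsetD[OF in_own_span[OF ideal_smult_gens]]) auto

lemma ideal_smult_subset:
  assumes "submodule R W M" "\<And>r x. \<lbrakk>r \<in> I; x \<in> carrier M\<rbrakk> \<Longrightarrow> r \<odot>\<^bsub>M\<^esub> x \<in> W"
  shows "ideal_smult R M I \<subseteq> W"
  unfolding ideal_smult_def using assms by (intro span_is_subset) auto

lemma submoduleI':
  assumes "N \<subseteq> carrier M" "\<zero>\<^bsub>M\<^esub> \<in> N" "\<And>x y. \<lbrakk>x \<in> N; y \<in> N\<rbrakk> \<Longrightarrow> x \<oplus>\<^bsub>M\<^esub> y \<in> N"
    "\<And>r x. \<lbrakk>r \<in> carrier R; x \<in> N\<rbrakk> \<Longrightarrow> r \<odot>\<^bsub>M\<^esub> x \<in> N"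
  shows "submodule R N M"
  using assms by (intro submodule.intro module_axioms) auto

lemma residue_submodule_residue_kernel:
  assumes "primeideal p R"
  shows "residue_submodule R M p (residue_kernel R M p)"
proof -
  interpret p: primeideal p R by fact
  note I = ideal_smult_submodule[OF p.a_subset]
  interpret I: submodule R "ideal_smult R M p" M by (rule I)
  have one: "\<one> \<in> carrier R - p" using p.one_imp_carrier p.I_notcarr by auto
  have mult: "s \<otimes> t \<in> carrier R - p" if "s \<in> carrier R - p" "t \<in> carrier R - p" for s t
    using that p.I_prime by blast
  have "submodule R (residue_kernel R M p) M"
  proof (rule submoduleI')
    show "residue_kernel R M p \<subseteq> carrier M" by (auto simp: residue_kernel_def)
    show "\<zero>\<^bsub>M\<^esub> \<in> residue_kernel R M p"
      using one by (auto simp: residue_kernel_def intro!: bexI[of _ \<one>])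
  next
    fix x y
    assume "x \<in> residue_kernel R M p" "y \<in> residue_kernel R M p"
    then obtain s t where *: "x \<in> carrier M" "s \<in> carrier R - p" "s \<odot>\<^bsub>M\<^esub> x \<in> ideal_smult R M p"
       "y \<in> carrier M" "t \<in> carrier R - p" "t \<odot>\<^bsub>M\<^esub> y \<in> ideal_smult R M p"
      by (auto simp: residue_kernel_def)
    have "(s \<otimes> t) \<odot>\<^bsub>M\<^esub> (x \<oplus>\<^bsub>M\<^esub> y) = t \<odot>\<^bsub>M\<^esub> (s \<odot>\<^bsub>M\<^esub> x) \<oplus>\<^bsub>M\<^esub> s \<odot>\<^bsub>M\<^esub> (t \<odot>\<^bsub>M\<^esub> y)"
      using * by (simp add: smult_r_distr smult_assoc1[symmetric] R.m_comm)
    also have "\<dots> \<in> ideal_smult R M p" using * by auto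
    finally show "x \<oplus>\<^bsub>M\<^esub> y \<in> residue_kernel R M p"
      using * mult unfolding residue_kernel_def by blast
  next
    fix r x
    assume r: "r \<in> carrier R" and "x \<in> residue_kernel R M p"
    then obtain s where *: "x \<in> carrier M" "s \<in> carrier R - p" "s \<odot>\<^bsub>M\<^esub> x \<in> ideal_smult R M p"
      by (auto simp: residue_kernel_def)
    have "s \<odot>\<^bsub>M\<^esub> (r \<odot>\<^bsub>M\<^esub> x) = r \<odot>\<^bsub>M\<^esub> (s \<odot>\<^bsub>M\<^esub> x)"
      using * r by (simp add: smult_assoc1[symmetric] R.m_comm)
    also have "\<dots> \<in> ideal_smult R M p" using * r by auto
    finally show "r \<odot>\<^bsub>M\<^esub> x \<in> residue_kernel R M p"
      using * r unfolding residue_kernel_def by blast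
  qed
  moreover have "r \<odot>\<^bsub>M\<^esub> x \<in> residue_kernel R M p" if "r \<in> p" "x \<in> carrier M" for r x
    using that one ideal_smult_mem[OF p.a_subset that] p.a_subset
    by (auto simp: residue_kernel_def intro!: bexI[of _ \<one>])
  moreover have "x \<in> residue_kernel R M p"
    if t: "t \<in> carrier R" "t \<notin> p" and x: "x \<in> carrier M" and tx: "t \<odot>\<^bsub>M\<^esub> x \<in> residue_kernel R M p" for t x
  proof -
    obtain s where s: "s \<in> carrier R - p" "s \<odot>\<^bsub>M\<^esub> (t \<odot>\<^bsub>M\<^esub> x) \<in> ideal_smult R M p"
      using tx by (auto simp: residue_kernel_def)
    then have "(s \<otimes> t) \<odot>\<^bsub>M\<^esub> x \<in> ideal_smult R M p" using t x by (simp add: smult_assoc1)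
    then show ?thesis using mult[OF s(1), of t] t x by (auto simp: residue_kernel_def)
  qed
  ultimately show ?thesis
    by (intro residue_submodule.intro residue_submodule_axioms.intro module_axioms assms) auto
qed

lemma ideal_smult_subset_residue_kernel:
  assumes "primeideal p R"
  shows "ideal_smult R M p \<subseteq> residue_kernel R M p"
proof -
  interpret residue_submodule R M p "residue_kernel R M p"
    by (rule residue_submodule_residue_kernel[OF assms])
  show ?thesis
    by (intro ideal_smult_subset N_submodule smult_prime)
qed

lemma
  assumes "\<And>i. i < n \<Longrightarrow> c i \<in> carrier R" "\<And>i. i < n \<Longrightarrow> u i \<in> carrier M"
  shows combination_lessThan_closed: "combination {..<n::nat} c u \<in> carrier M"
    and combination_lessThan_smult: "a \<in> carrier R \<Longrightarrow>
      combination {..<n} (\<lambda>i. a \<otimes> c i) u = a \<odot>\<^bsub>M\<^esub> combination {..<n} c u"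
  using assms by (auto intro!: combination_smult)

lemma combination_lessThan_zero:
  assumes "\<And>i. i < n \<Longrightarrow> c i = \<zero>" "\<And>i. i < n \<Longrightarrow> u i \<in> carrier M"
  shows "combination {..<n::nat} c u = \<zero>\<^bsub>M\<^esub>"
proof -
  have "combination {..<n} c u = (\<Oplus>\<^bsub>M\<^esub>i\<in>{..<n}. \<zero>\<^bsub>M\<^esub>)"
    unfolding combination_def using assms by (intro M.finsum_cong') auto
  then show ?thesis by (simp add: M.finsum_zero)
qed

lemma basis_up_to_iff:
  "basis_up_to R M S n y \<longleftrightarrow> (\<forall>i<n. y i \<in> carrier M) \<and>
    (\<forall>x\<in>carrier M. \<exists>t\<in>S. \<exists>c. (\<forall>i<n. c i \<in> carrier R) \<and> t \<odot>\<^bsub>M\<^esub> x = combination {..<n} c y) \<and>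
    (\<forall>c. (\<forall>i<n. c i \<in> carrier R) \<and> combination {..<n} c y = \<zero>\<^bsub>M\<^esub> \<longrightarrow> (\<forall>i<n. \<exists>t\<in>S. t \<otimes> c i = \<zero>))"
  unfolding basis_up_to_def combination_def by (simp add: Pi_iff Bex_def Ball_def imp_conjL)

text \<open>The elements whose coordinates lie in I after clearing a denominator form a submodule,
  and it contains the products that generate IM.\<close>

lemma basis_ideal_smult:
  assumes basis: "basis_up_to R M S n y"
    and S: "S \<subseteq> carrier R" "\<one> \<in> S" "\<And>s t. \<lbrakk>s \<in> S; t \<in> S\<rbrakk> \<Longrightarrow> s \<otimes> t \<in> S"
    and I: "ideal I R" and w: "w \<in> ideal_smult R M I"
  shows "\<exists>t\<in>S. \<exists>d. (\<forall>i<n. d i \<in> I) \<and> t \<odot>\<^bsub>M\<^esub> w = combination {..<n} d y"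
proof -
  interpret I: ideal I R by fact
  have y: "y i \<in> carrier M" if "i < n" for i
    using basis that by (simp add: basis_up_to_iff)
  have Ic: "d \<in> carrier R" if "d \<in> I" for d using that I.a_subset by blast
  let ?W = "{w \<in> carrier M. \<exists>t\<in>S. \<exists>d. (\<forall>i<n. d i \<in> I) \<and> t \<odot>\<^bsub>M\<^esub> w = combination {..<n} d y}"
  have "submodule R ?W M"
  proof (rule submoduleI')
    have "combination {..<n} (\<lambda>i. \<zero>) y = \<zero>\<^bsub>M\<^esub>"
      using y by (intro combination_lessThan_zero) auto
    then show "\<zero>\<^bsub>M\<^esub> \<in> ?W"
      using S by (auto intro!: bexI[of _ \<one>] exI[of _ "\<lambda>i. \<zero>"])
  next
    fix w v
    assume "w \<in> ?W" "v \<in> ?W"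
    then obtain t d s e where *: "w \<in> carrier M" "v \<in> carrier M" "t \<in> S" "s \<in> S"
      "\<And>i. i < n \<Longrightarrow> d i \<in> I" "\<And>i. i < n \<Longrightarrow> e i \<in> I"
      and eq: "t \<odot>\<^bsub>M\<^esub> w = combination {..<n} d y" "s \<odot>\<^bsub>M\<^esub> v = combination {..<n} e y"
      by auto
    have ts: "t \<in> carrier R" "s \<in> carrier R" using * S(1) by auto
    have "(t \<otimes> s) \<odot>\<^bsub>M\<^esub> (w \<oplus>\<^bsub>M\<^esub> v) = s \<odot>\<^bsub>M\<^esub> (t \<odot>\<^bsub>M\<^esub> w) \<oplus>\<^bsub>M\<^esub> t \<odot>\<^bsub>M\<^esub> (s \<odot>\<^bsub>M\<^esub> v)"
      using ts * by (simp add: smult_r_distr smult_assoc1[symmetric] R.m_comm)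
    also have "\<dots> = combination {..<n} (\<lambda>i. s \<otimes> d i \<oplus> t \<otimes> e i) y"
      unfolding eq using ts *(5,6) Ic y by (subst combination_add) (auto simp: combination_lessThan_smult)
    finally show "w \<oplus>\<^bsub>M\<^esub> v \<in> ?W"
      using *(1,2) S(3)[OF *(3,4)] *(5,6) ts I.I_l_closed
      by (auto intro!: bexI[of _ "t \<otimes> s"] exI[of _ "\<lambda>i. s \<otimes> d i \<oplus> t \<otimes> e i"])
  next
    fix r w
    assume r: "r \<in> carrier R" and "w \<in> ?W"
    then obtain t d where *: "w \<in> carrier M" "t \<in> S" "\<And>i. i < n \<Longrightarrow> d i \<in> I"
      and eq: "t \<odot>\<^bsub>M\<^esub> w = combination {..<n} d y" by auto
    have t: "t \<in> carrier R" using * S(1) by auto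
    have "t \<odot>\<^bsub>M\<^esub> (r \<odot>\<^bsub>M\<^esub> w) = r \<odot>\<^bsub>M\<^esub> (t \<odot>\<^bsub>M\<^esub> w)"
      using t r * by (simp add: smult_assoc1[symmetric] R.m_comm)
    also have "\<dots> = combination {..<n} (\<lambda>i. r \<otimes> d i) y"
      unfolding eq using r *(3) Ic y by (simp add: combination_lessThan_smult)
    finally show "r \<odot>\<^bsub>M\<^esub> w \<in> ?W"
      using * r I.I_l_closed by (auto intro!: bexI[of _ t] exI[of _ "\<lambda>i. r \<otimes> d i"])
  qed auto
  moreover have "r \<odot>\<^bsub>M\<^esub> x \<in> ?W" if r: "r \<in> I" and x: "x \<in> carrier M" for r x
  proof -
    obtain t c where *: "t \<in> S" "\<And>i. i < n \<Longrightarrow> c i \<in> carrier R" and eq: "t \<odot>\<^bsub>M\<^esub> x = combination {..<n} c y"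
      using basis x unfolding basis_up_to_iff by blast
    have t: "t \<in> carrier R" "r \<in> carrier R" using * S(1) r Ic by auto
    have "t \<odot>\<^bsub>M\<^esub> (r \<odot>\<^bsub>M\<^esub> x) = r \<odot>\<^bsub>M\<^esub> (t \<odot>\<^bsub>M\<^esub> x)"
      using t x by (simp add: smult_assoc1[symmetric] R.m_comm)
    also have "\<dots> = combination {..<n} (\<lambda>i. r \<otimes> c i) y"
      unfolding eq using t *(2) y by (simp add: combination_lessThan_smult)
    finally show ?thesis
      using * t x r I.I_r_closed by (auto intro!: bexI[of _ t] exI[of _ "\<lambda>i. r \<otimes> c i"])
  qed
  ultimately have "ideal_smult R M I \<subseteq> ?W" by (rule ideal_smult_subset)
  with w show ?thesis by blast
qed

lemma complement_prime:
  assumes "primeideal p R"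
  shows "carrier R - p \<subseteq> carrier R" "\<one> \<in> carrier R - p"
    "\<And>s t. \<lbrakk>s \<in> carrier R - p; t \<in> carrier R - p\<rbrakk> \<Longrightarrow> s \<otimes> t \<in> carrier R - p"
proof -
  interpret p: primeideal p R by fact
  show "carrier R - p \<subseteq> carrier R" by auto
  show "\<one> \<in> carrier R - p" using p.one_imp_carrier p.I_notcarr by auto
  show "\<And>s t. \<lbrakk>s \<in> carrier R - p; t \<in> carrier R - p\<rbrakk> \<Longrightarrow> s \<otimes> t \<in> carrier R - p"
    using p.I_prime by blast
qed

text \<open>A denominator outside p is also outside the smaller prime q, so coordinates at p can be
  read modulo q. The case q = p yields \<open>basis_independent\<close>; a proper subprime may occur
  in \<open>exists_prime_residue_nonzero\<close>.\<close>

lemma basis_coordinate_mem_prime: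
  assumes p: "primeideal p R" and q: "primeideal q R" "q \<subseteq> p"
    and basis: "basis_up_to R M (carrier R - p) n y"
    and c: "\<And>i. i < n \<Longrightarrow> c i \<in> carrier R"
    and t: "t \<in> carrier R - p" and x: "x \<in> residue_kernel R M q"
    and eq: "t \<odot>\<^bsub>M\<^esub> x = combination {..<n} c y" and i: "i < n"
  shows "c i \<in> q"
proof -
  interpret q: primeideal q R by fact
  note Sp = complement_prime[OF p]
  have y: "y i \<in> carrier M" if "i < n" for i
    using basis that by (simp add: basis_up_to_iff)
  obtain v where v: "v \<in> carrier R - q" "v \<odot>\<^bsub>M\<^esub> x \<in> ideal_smult R M q" and xM: "x \<in> carrier M"
    using x by (auto simp: residue_kernel_def)
  obtain s d where s: "s \<in> carrier R - p" and d: "\<And>i. i < n \<Longrightarrow> d i \<in> q"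
    and eq': "s \<odot>\<^bsub>M\<^esub> (v \<odot>\<^bsub>M\<^esub> x) = combination {..<n} d y"
    using basis_ideal_smult[OF basis Sp q.ideal_axioms v(2)] by blast
  have dc: "d i \<in> carrier R" if "i < n" for i using d[OF that] q.a_subset by blast
  \<comment> \<open>The element \<open>(s \<otimes> v \<otimes> t) x\<close> has two expansions, one
    from \<open>eq\<close> and one with coordinates in q; \<open>?e\<close> is their
    difference.\<close>
  let ?e = "\<lambda>i. (s \<otimes> v) \<otimes> c i \<ominus> t \<otimes> d i"
  have "(s \<otimes> v) \<odot>\<^bsub>M\<^esub> (t \<odot>\<^bsub>M\<^esub> x) = t \<odot>\<^bsub>M\<^esub> (s \<odot>\<^bsub>M\<^esub> (v \<odot>\<^bsub>M\<^esub> x))"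
    using s v(1) t xM by (simp add: smult_assoc1[symmetric] R.m_ac)
  then have "combination {..<n} ?e y = \<zero>\<^bsub>M\<^esub>"
    using s v(1) t c dc y by (subst combination_minus)
      (auto simp: combination_lessThan_smult combination_lessThan_closed eq eq' M.minus_eq M.r_neg)
  moreover have "\<forall>i<n. ?e i \<in> carrier R" using s v(1) t c dc by auto
  ultimately have "\<forall>i<n. \<exists>u\<in>carrier R - p. u \<otimes> ?e i = \<zero>"
    using basis[unfolded basis_up_to_iff, THEN conjunct2, THEN conjunct2, THEN spec, of ?e] by simp
  then obtain u where u: "u \<in> carrier R - p" "u \<otimes> ?e i = \<zero>"
    using i by auto
  have ei: "?e i \<in> carrier R" using s v(1) t c dc i by auto
  \<comment> \<open>Some u outside p, hence outside q, annihilates the difference, and 0 is in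
    q.\<close>
  have "?e i \<in> q"
    using q.I_prime[of u "?e i"] u q(2) ei q.zero_closed by auto
  moreover have "t \<otimes> d i \<in> q" using q.I_l_closed d t i by auto
  ultimately have "?e i \<oplus> t \<otimes> d i \<in> q" by (rule q.a_closed)
  moreover have "?e i \<oplus> t \<otimes> d i = (s \<otimes> v) \<otimes> c i"
    using s v(1) t c dc i by (simp add: R.minus_eq R.a_assoc R.l_neg)
  ultimately have "(s \<otimes> v) \<otimes> c i \<in> q" by simp
  then show "c i \<in> q"
    using q.I_prime[of "s \<otimes> v" "c i"] q.I_prime[of s v] s v(1) c[OF i] q(2) by auto
qed

lemma basis_independent:
  assumes p: "primeideal p R" and basis: "basis_up_to R M (carrier R - p) n y"
  shows "residue_submodule.independent R M p (residue_kernel R M p) {..<n} y"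
proof -
  interpret residue_submodule R M p "residue_kernel R M p"
    by (rule residue_submodule_residue_kernel[OF p])
  show ?thesis
    unfolding independent_def
  proof (intro allI impI ballI, elim conjE)
    fix c i
    assume *: "\<forall>i\<in>{..<n}. c i \<in> carrier R" "combination {..<n} c y \<in> residue_kernel R M p" "i \<in> {..<n}"
    then show "c i \<in> p"
      using basis_coordinate_mem_prime[OF p p order_refl basis, of c \<one> "combination {..<n} c y" i]
        complement_prime(2)[OF p] N.subset by auto
  qed
qed

lemma basis_spanned:
  assumes p: "primeideal p R" and basis: "basis_up_to R M (carrier R - p) n y" and x: "x \<in> carrier M"
  shows "residue_submodule.spanned R M p (residue_kernel R M p) {..<n} y x"
proof -
  interpret residue_submodule R M p "residue_kernel R M p"
    by (rule residue_submodule_residue_kernel[OF p])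
  obtain t c where "t \<in> carrier R - p" "\<forall>i<n. c i \<in> carrier R" "t \<odot>\<^bsub>M\<^esub> x = combination {..<n} c y"
    using basis x unfolding basis_up_to_iff by blast
  moreover from this have "t \<odot>\<^bsub>M\<^esub> x \<ominus>\<^bsub>M\<^esub> combination {..<n} c y = \<zero>\<^bsub>M\<^esub>"
    using x by (metis Diff_iff M.r_neg M.minus_eq smult_closed)
  ultimately show ?thesis
    unfolding spanned_def by (intro exI[of _ t] exI[of _ c]) auto
qed

lemma common_annihilator:
  assumes p: "primeideal p R" and "finite I" "\<And>i. i \<in> I \<Longrightarrow> c i \<in> carrier R"
    "\<And>i. i \<in> I \<Longrightarrow> \<exists>t\<in>carrier R - p. t \<otimes> c i = \<zero>"
  shows "\<exists>t\<in>carrier R - p. \<forall>i\<in>I. t \<otimes> c i = \<zero>"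
  using assms(2-)
proof (induction I)
  case empty
  then show ?case using complement_prime[OF p] by auto
next
  case (insert j I)
  then obtain s where "s \<in> carrier R - p" "\<forall>i\<in>I. s \<otimes> c i = \<zero>" by auto
  moreover obtain t where "t \<in> carrier R - p" "t \<otimes> c j = \<zero>" using insert.prems(2)[of j] by auto
  ultimately have *: "s \<in> carrier R - p" "\<forall>i\<in>I. s \<otimes> c i = \<zero>" "t \<in> carrier R - p" "t \<otimes> c j = \<zero>"
    by auto
  have "(s \<otimes> t) \<otimes> c i = \<zero>" if i: "i \<in> insert j I" for i
  proof (cases "i = j")
    case True
    then show ?thesis using * insert.prems(1)[OF i] by (simp add: R.m_assoc)
  next
    case False
    then have "(s \<otimes> t) \<otimes> c i = t \<otimes> (s \<otimes> c i)"
      using * insert.prems(1)[OF i] by (simp add: R.m_ac)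
    then show ?thesis using * False i by simp
  qed
  then show ?case using complement_prime(3)[OF p *(1,3)] by blast
qed

text \<open>At a maximal ideal p above the annihilator of x, the localized x is nonzero and so has a
  coordinate that is nonzero at p. As R is reduced, this coordinate is not nilpotent there, so some
  prime inside p misses it.\<close>

lemma exists_prime_residue_nonzero:
  assumes reduced: "reduced_ring R"
    and basis: "\<And>p. primeideal p R \<Longrightarrow> \<exists>n y. basis_up_to R M (carrier R - p) n y"
    and x: "x \<in> carrier M" "x \<noteq> \<zero>\<^bsub>M\<^esub>"
  shows "\<exists>q. primeideal q R \<and> x \<notin> residue_kernel R M q"
proof -
  let ?K = "{r \<in> carrier R. r \<odot>\<^bsub>M\<^esub> x = \<zero>\<^bsub>M\<^esub>}"
  have "ideal ?K R"
  proof (rule idealI[OF R.ring_axioms])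
    show "subgroup ?K (add_monoid R)"
      using x(1) by (intro R.add.subgroupI) (auto simp: smult_l_distr smult_l_minus a_inv_def[symmetric])
  next
    fix a r
    assume "a \<in> ?K" and r: "r \<in> carrier R"
    then have a: "a \<in> carrier R" "a \<odot>\<^bsub>M\<^esub> x = \<zero>\<^bsub>M\<^esub>" by auto
    then have ra: "(r \<otimes> a) \<odot>\<^bsub>M\<^esub> x = \<zero>\<^bsub>M\<^esub>" using r x(1) by (simp add: smult_assoc1)
    then show "r \<otimes> a \<in> ?K" using a(1) r by simp
    show "a \<otimes> r \<in> ?K" using ra a(1) r by (simp add: R.m_comm)
  qed
  moreover have "\<one> \<notin> ?K" using x by simp
  ultimately obtain p where "maximalideal p R" and Kp: "?K \<subseteq> p"
    using R.exists_maximalideal[of ?K] by auto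
  then have p: "primeideal p R" by (simp add: R.maximalideal_prime)
  interpret p: primeideal p R by (rule p)
  note Sp = complement_prime[OF p]
  obtain n y where y: "basis_up_to R M (carrier R - p) n y"
    using basis[OF p] by blast
  have yM: "y i \<in> carrier M" if "i < n" for i
    using y that by (simp add: basis_up_to_iff)
  obtain t c where t: "t \<in> carrier R - p" and c: "\<And>i. i < n \<Longrightarrow> c i \<in> carrier R"
    and eq: "t \<odot>\<^bsub>M\<^esub> x = combination {..<n} c y"
    using y x(1) unfolding basis_up_to_iff by blast
  have "\<exists>i<n. \<forall>u\<in>carrier R - p. u \<otimes> c i \<noteq> \<zero>"
  proof (rule ccontr)
    assume "\<not> ?thesis"
    \<comment> \<open>If every coordinate died at p, a common annihilator u would give
      \<open>u \<otimes> t\<close> in the annihilator of x, which lies in p.\<close>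
    then obtain u where u: "u \<in> carrier R - p" "\<forall>i\<in>{..<n}. u \<otimes> c i = \<zero>"
      using common_annihilator[OF p, of "{..<n}" c] c by (auto simp: Bex_def)
    have "(u \<otimes> t) \<odot>\<^bsub>M\<^esub> x = combination {..<n} (\<lambda>i. u \<otimes> c i) y"
      using u(1) t x(1) c yM by (simp add: smult_assoc1 eq combination_lessThan_smult)
    also have "\<dots> = \<zero>\<^bsub>M\<^esub>"
      using u yM by (intro combination_lessThan_zero) auto
    finally have "u \<otimes> t \<in> p" using Kp u(1) t by auto
    then show False using Sp(3)[OF u(1) t] by simp
  qed
  then obtain i where i: "i < n" and ci: "\<And>u. u \<in> carrier R - p \<Longrightarrow> u \<otimes> c i \<noteq> \<zero>" by blast
  \<comment> \<open>Inverting this set means localizing at p and then at \<open>c i\<close>. A prime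
    disjoint from it lies in p because of the elements with k = 0 and misses \<open>c i\<close>
    because of u = 1, k = 1.\<close>
  let ?S = "{u \<otimes> c i [^] (k::nat) | u k. u \<in> carrier R - p}"
  have "\<exists>q. primeideal q R \<and> q \<inter> ?S = {}"
  proof (rule R.exists_primeideal_avoiding)
    show "?S \<subseteq> carrier R" using c[OF i] by auto
    show "\<one> \<in> ?S"
      using Sp(2) by (auto intro!: exI[of _ \<one>] exI[of _ "0::nat"])
  next
    fix a b
    assume "a \<in> ?S" "b \<in> ?S"
    then obtain u v and k l :: nat where *: "a = u \<otimes> c i [^] k" "b = v \<otimes> c i [^] l"
      "u \<in> carrier R - p" "v \<in> carrier R - p" by blast
    have "a \<otimes> b = (u \<otimes> v) \<otimes> c i [^] (k + l)"
      using * c[OF i] by (simp add: R.nat_pow_mult[symmetric] R.m_ac)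
    then show "a \<otimes> b \<in> ?S" using Sp(3)[OF *(3,4)] by blast
  next
    show "\<zero> \<notin> ?S"
    proof
      assume "\<zero> \<in> ?S"
      then obtain u and k :: nat where u: "u \<in> carrier R - p" "u \<otimes> c i [^] k = \<zero>" by auto
      \<comment> \<open>The exponent is k + 1 because for k = 0 the k-th power is 1 and has no
        factor u to split off.\<close>
      have "(u \<otimes> c i) [^] Suc k = (u [^] k \<otimes> c i) \<otimes> (u \<otimes> c i [^] k)"
        using u(1) c[OF i] by (simp add: R.nat_pow_distrib R.m_ac)
      also have "\<dots> = \<zero>" unfolding u(2) using u(1) c[OF i] by simp
      finally have "u \<otimes> c i = \<zero>"
        using reduced u(1) c[OF i] unfolding reduced_ring_def by blast
      with ci u(1) show False by blast
    qed
  qed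
  then obtain q where q: "primeideal q R" "q \<inter> ?S = {}" by blast
  have "u \<in> ?S" if "u \<in> carrier R - p" for u
    using that by (auto intro!: exI[of _ u] exI[of _ "0::nat"])
  moreover have "q \<subseteq> carrier R"
    using q(1) by (auto simp: primeideal_def dest: ideal.axioms(1) additive_subgroup.a_subset)
  ultimately have "q \<subseteq> p" using q(2) by blast
  moreover have "c i \<in> ?S"
    using Sp(2) c[OF i] by (auto intro!: exI[of _ \<one>] exI[of _ "1::nat"])
  then have "c i \<notin> q" using q(2) by blast
  ultimately have "x \<notin> residue_kernel R M q"
    using basis_coordinate_mem_prime[OF p q(1) _ y c t _ eq i] by blast
  with q(1) show ?thesis by blast
qed

end

subsection \<open>Nakayama's lemma and ideals of algebras\<close>

context module
begin

lemma combination_mem_submodule: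
  assumes "submodule R W M" "finite I" "\<And>i. i \<in> I \<Longrightarrow> c i \<in> carrier R" "\<And>i. i \<in> I \<Longrightarrow> u i \<in> W"
  shows "combination I c u \<in> W"
proof -
  interpret W: submodule R W M by fact
  have u: "u i \<in> carrier M" if "i \<in> I" for i using assms(4)[OF that] W.subset by blast
  show ?thesis
    using assms(2,3,4) u
  proof (induction I)
    case empty
    then show ?case by (simp add: combination_empty)
  next
    case (insert j I)
    then show ?case
      by (subst combination_insert) auto
  qed
qed

text \<open>Nakayama's lemma, eliminating the generators in \<open>S\<close> one at a time; \<open>U\<close> collects those that remain.\<close>

lemma nakayama:
  assumes m: "primeideal m R" and J: "submodule R J M"
    and gen: "\<And>x. x \<in> carrier M \<Longrightarrow> \<exists>j\<in>J. \<exists>w\<in>ideal_smult R M m. x = j \<oplus>\<^bsub>M\<^esub> w"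
    and "finite S" "S \<subseteq> carrier M" "submodule R U M" "J \<subseteq> U"
    and "t \<in> carrier R - m" "\<And>x W. \<lbrakk>x \<in> carrier M; submodule R W M; U \<subseteq> W; S \<subseteq> W\<rbrakk> \<Longrightarrow> t \<odot>\<^bsub>M\<^esub> x \<in> W"
  shows "\<exists>t\<in>carrier R - m. \<forall>x\<in>carrier M. t \<odot>\<^bsub>M\<^esub> x \<in> U"
  using assms(4-)
proof (induction S arbitrary: U rule: finite_induct)
  case empty
  then show ?case by blast
next
  case (insert a S)
  interpret m: primeideal m R by (rule m)
  interpret U: submodule R U M by fact
  have a: "a \<in> carrier M" using insert.prems(1) by blast
  have UM: "u \<in> carrier M" if "u \<in> U" for u using that U.subset by blast
  have mR: "\<mu> \<in> carrier R" if "\<mu> \<in> m" for \<mu> using that m.a_subset by blast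
  \<comment> \<open>The generator a is moved from S into U. The induction hypothesis then gives t
    outside m with tM inside U + Ra, and a remains to be eliminated.\<close>
  let ?U = "{u \<oplus>\<^bsub>M\<^esub> c \<odot>\<^bsub>M\<^esub> a | u c. u \<in> U \<and> c \<in> carrier R}"
  have add: "(u \<oplus>\<^bsub>M\<^esub> c \<odot>\<^bsub>M\<^esub> a) \<oplus>\<^bsub>M\<^esub> (v \<oplus>\<^bsub>M\<^esub> d \<odot>\<^bsub>M\<^esub> a) = (u \<oplus>\<^bsub>M\<^esub> v) \<oplus>\<^bsub>M\<^esub> (c \<oplus> d) \<odot>\<^bsub>M\<^esub> a"
    if "u \<in> U" "v \<in> U" "c \<in> carrier R" "d \<in> carrier R" for u v c d
    using that a UM by (simp add: smult_l_distr M.a_ac)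
  have smult: "r \<odot>\<^bsub>M\<^esub> (u \<oplus>\<^bsub>M\<^esub> c \<odot>\<^bsub>M\<^esub> a) = r \<odot>\<^bsub>M\<^esub> u \<oplus>\<^bsub>M\<^esub> (r \<otimes> c) \<odot>\<^bsub>M\<^esub> a"
    if "u \<in> U" "c \<in> carrier R" "r \<in> carrier R" for u c r
    using that a UM by (simp add: smult_r_distr smult_assoc1)
  have U': "submodule R ?U M"
  proof (rule submoduleI')
    show "?U \<subseteq> carrier M" using a UM by auto
    have "\<zero>\<^bsub>M\<^esub> = \<zero>\<^bsub>M\<^esub> \<oplus>\<^bsub>M\<^esub> \<zero> \<odot>\<^bsub>M\<^esub> a" using a by simp
    then show "\<zero>\<^bsub>M\<^esub> \<in> ?U" using U.zero_closed by blast
  next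
    fix x y assume "x \<in> ?U" "y \<in> ?U"
    then obtain u c v d where *: "u \<in> U" "v \<in> U" "c \<in> carrier R" "d \<in> carrier R"
      and "x = u \<oplus>\<^bsub>M\<^esub> c \<odot>\<^bsub>M\<^esub> a" "y = v \<oplus>\<^bsub>M\<^esub> d \<odot>\<^bsub>M\<^esub> a" by auto
    then have "x \<oplus>\<^bsub>M\<^esub> y = (u \<oplus>\<^bsub>M\<^esub> v) \<oplus>\<^bsub>M\<^esub> (c \<oplus> d) \<odot>\<^bsub>M\<^esub> a"
      using add[OF *] by simp
    then show "x \<oplus>\<^bsub>M\<^esub> y \<in> ?U" using * by blast
  next
    fix r x assume r: "r \<in> carrier R" and "x \<in> ?U"
    then obtain u c where *: "u \<in> U" "c \<in> carrier R" and "x = u \<oplus>\<^bsub>M\<^esub> c \<odot>\<^bsub>M\<^esub> a" by auto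
    then have "r \<odot>\<^bsub>M\<^esub> x = r \<odot>\<^bsub>M\<^esub> u \<oplus>\<^bsub>M\<^esub> (r \<otimes> c) \<odot>\<^bsub>M\<^esub> a"
      using smult[OF * r] by simp
    then show "r \<odot>\<^bsub>M\<^esub> x \<in> ?U" using * r by blast
  qed
  have UU': "U \<subseteq> ?U"
  proof
    fix u assume "u \<in> U"
    then have "u = u \<oplus>\<^bsub>M\<^esub> \<zero> \<odot>\<^bsub>M\<^esub> a" using a UM by simp
    then show "u \<in> ?U" using \<open>u \<in> U\<close> by blast
  qed
  have aU': "a \<in> ?U"
  proof -
    have "a = \<zero>\<^bsub>M\<^esub> \<oplus>\<^bsub>M\<^esub> \<one> \<odot>\<^bsub>M\<^esub> a" using a by simp
    then show ?thesis using U.zero_closed by blast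
  qed
  have "\<exists>t\<in>carrier R - m. \<forall>x\<in>carrier M. t \<odot>\<^bsub>M\<^esub> x \<in> ?U"
  proof (rule insert.IH)
    show "S \<subseteq> carrier M" using insert.prems(1) by blast
    show "submodule R ?U M" by (rule U')
    show "J \<subseteq> ?U" using insert.prems(3) UU' by (rule order_trans)
    show "t \<in> carrier R - m" by fact
    fix x W
    assume W: "x \<in> carrier M" "submodule R W M" "?U \<subseteq> W" "S \<subseteq> W"
    show "t \<odot>\<^bsub>M\<^esub> x \<in> W"
      by (rule insert.prems(5)[OF W(1,2) order_trans[OF UU' W(3)]])
        (rule insert_subsetI[OF subsetD[OF W(3) aU'] W(4)])
  qed
  then obtain t where t: "t \<in> carrier R - m" "\<And>x. x \<in> carrier M \<Longrightarrow> t \<odot>\<^bsub>M\<^esub> x \<in> ?U" by blast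
  \<comment> \<open>The elements w for which the coefficient of a in tw can be chosen in m. They
    form a submodule that contains all products of m with M, hence mM.\<close>
  let ?W = "{w \<in> carrier M. \<exists>u\<in>U. \<exists>\<mu>\<in>m. t \<odot>\<^bsub>M\<^esub> w = u \<oplus>\<^bsub>M\<^esub> \<mu> \<odot>\<^bsub>M\<^esub> a}"
  have "submodule R ?W M"
  proof (rule submoduleI')
    have "t \<odot>\<^bsub>M\<^esub> \<zero>\<^bsub>M\<^esub> = \<zero>\<^bsub>M\<^esub> \<oplus>\<^bsub>M\<^esub> \<zero> \<odot>\<^bsub>M\<^esub> a" using a t(1) by simp
    then show "\<zero>\<^bsub>M\<^esub> \<in> ?W" using U.zero_closed m.zero_closed by blast
  next
    fix x y assume "x \<in> ?W" "y \<in> ?W"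
    then obtain u c v d where *: "u \<in> U" "v \<in> U" "c \<in> m" "d \<in> m" "x \<in> carrier M" "y \<in> carrier M"
      and "t \<odot>\<^bsub>M\<^esub> x = u \<oplus>\<^bsub>M\<^esub> c \<odot>\<^bsub>M\<^esub> a" "t \<odot>\<^bsub>M\<^esub> y = v \<oplus>\<^bsub>M\<^esub> d \<odot>\<^bsub>M\<^esub> a" by blast
    then have "t \<odot>\<^bsub>M\<^esub> (x \<oplus>\<^bsub>M\<^esub> y) = (u \<oplus>\<^bsub>M\<^esub> v) \<oplus>\<^bsub>M\<^esub> (c \<oplus> d) \<odot>\<^bsub>M\<^esub> a"
      using add[OF *(1,2) mR mR] t(1) by (simp add: smult_r_distr)
    then show "x \<oplus>\<^bsub>M\<^esub> y \<in> ?W" using * U.m_closed m.a_closed by blast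
  next
    fix r x assume r: "r \<in> carrier R" and "x \<in> ?W"
    then obtain u c where *: "u \<in> U" "c \<in> m" "x \<in> carrier M" and eq: "t \<odot>\<^bsub>M\<^esub> x = u \<oplus>\<^bsub>M\<^esub> c \<odot>\<^bsub>M\<^esub> a" by blast
    have "t \<odot>\<^bsub>M\<^esub> (r \<odot>\<^bsub>M\<^esub> x) = r \<odot>\<^bsub>M\<^esub> (t \<odot>\<^bsub>M\<^esub> x)"
      using t(1) r * by (simp add: smult_assoc1[symmetric] R.m_comm)
    also have "\<dots> = r \<odot>\<^bsub>M\<^esub> u \<oplus>\<^bsub>M\<^esub> (r \<otimes> c) \<odot>\<^bsub>M\<^esub> a"
      unfolding eq by (rule smult[OF *(1) mR[OF *(2)] r])
    finally show "r \<odot>\<^bsub>M\<^esub> x \<in> ?W" using * r U.smult_closed m.I_l_closed smult_closed by blast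
  qed auto
  moreover have "r \<odot>\<^bsub>M\<^esub> x \<in> ?W" if r: "r \<in> m" and x: "x \<in> carrier M" for r x
  proof -
    obtain u c where *: "u \<in> U" "c \<in> carrier R" and eq: "t \<odot>\<^bsub>M\<^esub> x = u \<oplus>\<^bsub>M\<^esub> c \<odot>\<^bsub>M\<^esub> a"
      using t(2)[OF x] by blast
    have "t \<odot>\<^bsub>M\<^esub> (r \<odot>\<^bsub>M\<^esub> x) = r \<odot>\<^bsub>M\<^esub> (t \<odot>\<^bsub>M\<^esub> x)"
      using t(1) mR[OF r] x by (simp add: smult_assoc1[symmetric] R.m_comm)
    also have "\<dots> = r \<odot>\<^bsub>M\<^esub> u \<oplus>\<^bsub>M\<^esub> (r \<otimes> c) \<odot>\<^bsub>M\<^esub> a"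
      unfolding eq by (rule smult[OF * mR[OF r]])
    finally show ?thesis
      using * r x mR[OF r] U.smult_closed[OF mR[OF r] *(1)] m.I_r_closed[OF r *(2)] by blast
  qed
  ultimately have mM: "ideal_smult R M m \<subseteq> ?W" by (rule ideal_smult_subset)
  obtain j w where jw: "j \<in> J" "w \<in> ideal_smult R M m" "a = j \<oplus>\<^bsub>M\<^esub> w"
    using gen[OF a] by blast
  then obtain u \<mu> where u: "u \<in> U" "\<mu> \<in> m" and eq: "t \<odot>\<^bsub>M\<^esub> w = u \<oplus>\<^bsub>M\<^esub> \<mu> \<odot>\<^bsub>M\<^esub> a" and w: "w \<in> carrier M"
    using mM by blast
  have j: "j \<in> U" using jw(1) insert.prems(3) by blast
  \<comment> \<open>Decomposing a = j + w with w in mM gives ta = tj + u + \<mu>a, so t - \<mu>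
    carries a into U. It is outside m, since t is and \<mu> lies in m.\<close>
  define s where "s = t \<ominus> \<mu>"
  have s: "s \<in> carrier R" using t(1) u mR by (auto simp: s_def)
  have "s \<notin> m"
  proof
    assume "s \<in> m"
    then have "s \<oplus> \<mu> \<in> m" using u(2) m.a_closed by blast
    moreover have "s \<oplus> \<mu> = t"
      using t(1) mR[OF u(2)] by (simp add: s_def R.minus_eq R.a_assoc R.l_neg)
    ultimately show False using t(1) by simp
  qed
  have sa: "s \<odot>\<^bsub>M\<^esub> a \<in> U"
  proof -
    have "t \<odot>\<^bsub>M\<^esub> a = t \<odot>\<^bsub>M\<^esub> j \<oplus>\<^bsub>M\<^esub> (u \<oplus>\<^bsub>M\<^esub> \<mu> \<odot>\<^bsub>M\<^esub> a)"
      using arg_cong[OF jw(3), of "smult M t"] t(1) w UM[OF j] by (simp add: smult_r_distr eq)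
    then have "s \<odot>\<^bsub>M\<^esub> a = t \<odot>\<^bsub>M\<^esub> j \<oplus>\<^bsub>M\<^esub> (u \<oplus>\<^bsub>M\<^esub> \<mu> \<odot>\<^bsub>M\<^esub> a) \<ominus>\<^bsub>M\<^esub> \<mu> \<odot>\<^bsub>M\<^esub> a"
      using t(1) mR[OF u(2)] a by (simp add: s_def minus_smult)
    also have "\<dots> = t \<odot>\<^bsub>M\<^esub> j \<oplus>\<^bsub>M\<^esub> u"
      using t(1) mR[OF u(2)] a UM[OF u(1)] UM[OF j] by (simp add: M.minus_eq M.a_assoc M.r_neg)
    also have "\<dots> \<in> U" using t(1) j u by auto
    finally show ?thesis .
  qed
  \<comment> \<open>The factor t brings x into U + Ra, and s then brings the multiple of a into
    U.\<close>
  have "(s \<otimes> t) \<odot>\<^bsub>M\<^esub> x \<in> U" if x: "x \<in> carrier M" for x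
  proof -
    obtain v c where *: "v \<in> U" "c \<in> carrier R" and eq: "t \<odot>\<^bsub>M\<^esub> x = v \<oplus>\<^bsub>M\<^esub> c \<odot>\<^bsub>M\<^esub> a"
      using t(2)[OF x] by blast
    have "(s \<otimes> t) \<odot>\<^bsub>M\<^esub> x = s \<odot>\<^bsub>M\<^esub> v \<oplus>\<^bsub>M\<^esub> c \<odot>\<^bsub>M\<^esub> (s \<odot>\<^bsub>M\<^esub> a)"
      using s t(1) x * a UM smult[OF * s] by (simp add: smult_assoc1 eq) (simp add: smult_assoc1[symmetric] R.m_comm)
    also have "\<dots> \<in> U" using s * sa by auto
    finally show ?thesis .
  qed
  moreover have "s \<otimes> t \<in> carrier R - m"
    using complement_prime(3)[OF m, of s t] s \<open>s \<notin> m\<close> t(1) by blast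
  ultimately show ?case by blast
qed

end

section \<open>Two-sided ideals of an algebra as submodules\<close>

context assoc_algebra
begin

lemma one_smult_mult: "\<lbrakk>r \<in> carrier R; x \<in> carrier A\<rbrakk> \<Longrightarrow> (r \<odot>\<^bsub>A\<^esub> \<one>\<^bsub>A\<^esub>) \<otimes>\<^bsub>A\<^esub> x = r \<odot>\<^bsub>A\<^esub> x"
  by (simp add: smult_mult_left)

lemma mult_one_smult: "\<lbrakk>r \<in> carrier R; x \<in> carrier A\<rbrakk> \<Longrightarrow> x \<otimes>\<^bsub>A\<^esub> (r \<odot>\<^bsub>A\<^esub> \<one>\<^bsub>A\<^esub>) = r \<odot>\<^bsub>A\<^esub> x"
  by (simp add: smult_mult_right)

text \<open>Scalars act through multiplication by the elements \<open>r \<odot> \<one>\<close>, so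
  absorption gives closure under scalars.\<close>

lemma ideal_submodule:
  assumes "ideal J A"
  shows "submodule R J A"
proof -
  interpret J: ideal J A by fact
  have "r \<odot>\<^bsub>A\<^esub> x \<in> J" if "r \<in> carrier R" "x \<in> J" for r x
    using J.I_l_closed[OF that(2), of "r \<odot>\<^bsub>A\<^esub> \<one>\<^bsub>A\<^esub>"] that J.a_subset by (auto simp: one_smult_mult)
  then show ?thesis
    using J.a_subset J.zero_closed J.a_closed by (intro submoduleI') auto
qed

lemma submodule_ideal:
  assumes "submodule R W A"
    and "\<And>a w. \<lbrakk>a \<in> carrier A; w \<in> W\<rbrakk> \<Longrightarrow> a \<otimes>\<^bsub>A\<^esub> w \<in> W" "\<And>a w. \<lbrakk>a \<in> carrier A; w \<in> W\<rbrakk> \<Longrightarrow> w \<otimes>\<^bsub>A\<^esub> a \<in> W"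
  shows "ideal W A"
proof (rule idealI[OF A.ring_axioms])
  interpret W: submodule R W A by fact
  show "subgroup W (add_monoid A)"
  proof (rule M.add.subgroupI)
    show "W \<subseteq> carrier A" by (rule W.subset)
    show "W \<noteq> {}" using W.zero_closed by (metis empty_iff)
  next
    fix w assume w: "w \<in> W"
    then have "\<zero>\<^bsub>A\<^esub> \<ominus>\<^bsub>A\<^esub> w = \<ominus>\<^bsub>A\<^esub> w"
      using subsetD[OF W.subset w] by (simp add: M.minus_eq)
    then show "\<ominus>\<^bsub>A\<^esub> w \<in> W"
      using submodule_minus[OF assms(1) W.zero_closed w] by simp
  next
    fix v w assume "v \<in> W" "w \<in> W"
    then show "v \<oplus>\<^bsub>A\<^esub> w \<in> W" by (rule W.m_closed)
  qed
qed (simp_all add: assms(2,3))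

lemma ideal_ideal_smult:
  assumes I: "I \<subseteq> carrier R"
  shows "ideal (ideal_smult R A I) A"
proof (rule submodule_ideal[OF ideal_smult_submodule[OF I]])
  note sub = ideal_smult_submodule[OF I]
  interpret I: submodule R "ideal_smult R A I" A by (rule sub)
  fix a w
  assume a: "a \<in> carrier A" and w: "w \<in> ideal_smult R A I"
  let ?W = "{w \<in> carrier A. a \<otimes>\<^bsub>A\<^esub> w \<in> ideal_smult R A I \<and> w \<otimes>\<^bsub>A\<^esub> a \<in> ideal_smult R A I}"
  have "ideal_smult R A I \<subseteq> ?W"
  proof (rule ideal_smult_subset)
    show "submodule R ?W A"
      using a by (intro submoduleI') (auto simp: A.r_distr A.l_distr smult_mult_left smult_mult_right)
    show "r \<odot>\<^bsub>A\<^esub> x \<in> ?W" if "r \<in> I" "x \<in> carrier A" for r x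
      using that a I ideal_smult_mem[OF I that(1)] by (auto simp: smult_mult_left smult_mult_right subsetD)
  qed
  then show "a \<otimes>\<^bsub>A\<^esub> w \<in> ideal_smult R A I" "w \<otimes>\<^bsub>A\<^esub> a \<in> ideal_smult R A I" using w by auto
qed

lemma ideal_residue_kernel:
  assumes p: "primeideal p R"
  shows "ideal (residue_kernel R A p) A"
proof -
  interpret p: primeideal p R by (rule p)
  interpret residue_submodule R A p "residue_kernel R A p"
    by (rule residue_submodule_residue_kernel[OF p])
  interpret I: ideal "ideal_smult R A p" A by (rule ideal_ideal_smult[OF p.a_subset])
  show ?thesis
  proof (rule submodule_ideal[OF N_submodule])
    fix a w
    assume a: "a \<in> carrier A" and "w \<in> residue_kernel R A p"
    then obtain t where t: "w \<in> carrier A" "t \<in> carrier R - p" "t \<odot>\<^bsub>A\<^esub> w \<in> ideal_smult R A p"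
      by (auto simp: residue_kernel_def)
    have "t \<odot>\<^bsub>A\<^esub> (a \<otimes>\<^bsub>A\<^esub> w) \<in> ideal_smult R A p" "t \<odot>\<^bsub>A\<^esub> (w \<otimes>\<^bsub>A\<^esub> a) \<in> ideal_smult R A p"
      using I.I_l_closed[OF t(3) a] I.I_r_closed[OF t(3) a] t a
      by (simp_all add: smult_mult_left smult_mult_right)
    then show "a \<otimes>\<^bsub>A\<^esub> w \<in> residue_kernel R A p" "w \<otimes>\<^bsub>A\<^esub> a \<in> residue_kernel R A p"
      using t a by (auto simp: residue_kernel_def)
  qed
qed

text \<open>Faithfulness excludes rank 0: an empty basis would make some t outside p kill 1 and
  hence all of A. In positive rank, 1 in the kernel would put every element there, against
  independence of the basis.\<close>

lemma one_notin_residue_kernel: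
  assumes faithful: "faithful_module R A" and p: "primeideal p R"
    and basis: "basis_up_to R A (carrier R - p) n y"
  shows "\<one>\<^bsub>A\<^esub> \<notin> residue_kernel R A p"
proof
  assume one: "\<one>\<^bsub>A\<^esub> \<in> residue_kernel R A p"
  interpret p: primeideal p R by (rule p)
  interpret N: ideal "residue_kernel R A p" A by (rule ideal_residue_kernel[OF p])
  have y: "y i \<in> carrier A" if "i < n" for i
    using basis that by (simp add: basis_up_to_iff)
  show False
  proof (cases n)
    case 0
    obtain t c where t: "t \<in> carrier R - p" "t \<odot>\<^bsub>A\<^esub> \<one>\<^bsub>A\<^esub> = combination {..<n} c y"
      using basis A.one_closed unfolding basis_up_to_iff by blast
    then have t1: "t \<odot>\<^bsub>A\<^esub> \<one>\<^bsub>A\<^esub> = \<zero>\<^bsub>A\<^esub>" using 0 by (simp add: combination_empty)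
    have "t \<odot>\<^bsub>A\<^esub> x = \<zero>\<^bsub>A\<^esub>" if "x \<in> carrier A" for x
      using one_smult_mult[of t x] t1 t(1) that by simp
    then have "t = \<zero>" using faithful t(1) unfolding faithful_module_def by blast
    then show False using t(1) p.zero_closed by simp
  next
    case (Suc k)
    then have n: "0 < n" by simp
    have carr: "residue_kernel R A p = carrier A" using N.one_imp_carrier[OF one] .
    \<comment> \<open>The coefficient 1 at index 0 exists because n is positive, and it is not in
      p.\<close>
    let ?c = "\<lambda>i. if i = 0 then \<one> else \<zero>"
    interpret N': residue_submodule R A p "residue_kernel R A p"
      by (rule residue_submodule_residue_kernel[OF p])
    have "combination {..<n} ?c y \<in> residue_kernel R A p"
      unfolding carr using y by (intro combination_lessThan_closed) auto
    then have "\<forall>i\<in>{..<n}. ?c i \<in> p"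
      using basis_independent[OF p basis] unfolding N'.independent_def by (elim allE[of _ ?c]) simp
    from bspec[OF this, of 0] n have "\<one> \<in> p" by simp
    then show False using complement_prime(2)[OF p] by simp
  qed
qed

end

subsection \<open>Azumaya algebras\<close>

lemma quot_algebra_simps:
  "carrier (quot_algebra R A I) = carrier (A Quot ideal_smult R A I)"
  "mult (quot_algebra R A I) = mult (A Quot ideal_smult R A I)"
  "\<one>\<^bsub>quot_algebra R A I\<^esub> = \<one>\<^bsub>A Quot ideal_smult R A I\<^esub>"
  "\<zero>\<^bsub>quot_algebra R A I\<^esub> = \<zero>\<^bsub>A Quot ideal_smult R A I\<^esub>"
  "add (quot_algebra R A I) = add (A Quot ideal_smult R A I)"
  "smult (quot_algebra R A I) = (\<lambda>c X. \<Union>r\<in>c. \<Union>x\<in>X. ideal_smult R A I +>\<^bsub>A\<^esub> (r \<odot>\<^bsub>A\<^esub> x))"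
  by (simp_all add: quot_algebra_def Let_def ring.defs module.defs)

lemma ring_hom_finsum:
  assumes "ring A" "ring B" "h \<in> ring_hom A B" "finite I" "\<And>i. i \<in> I \<Longrightarrow> f i \<in> carrier A"
  shows "h (\<Oplus>\<^bsub>A\<^esub>i\<in>I. f i) = (\<Oplus>\<^bsub>B\<^esub>i\<in>I. h (f i))"
  using assms(4,5)
proof (induction I)
  case empty
  interpret A: ring A by fact
  interpret B: ring B by fact
  show ?case using ring_hom_zero[OF assms(3,1,2)] by simp
next
  case (insert j I)
  interpret A: ring A by fact
  interpret B: ring B by fact
  show ?case
    using insert ring_hom_closed[OF assms(3)]
    by (simp add: ring_hom_add[OF assms(3)] Pi_def)
qed

lemma (in ideal) rcos_eq_iff: "\<lbrakk>a \<in> carrier R; b \<in> carrier R\<rbrakk> \<Longrightarrow> I +> a = I +> b \<longleftrightarrow> a \<ominus> b \<in> I"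
  using quotient_eq_iff_same_a_r_cos[OF ideal_axioms] by simp

lemma (in ideal) rcos_eq_zero_iff: "a \<in> carrier R \<Longrightarrow> I +> a = \<zero>\<^bsub>R Quot I\<^esub> \<longleftrightarrow> a \<in> I"
  using rcos_eq_iff[of a \<zero>] a_coset_add_zero[OF a_subset] by (simp add: FactRing_def minus_eq)

lemma (in ideal) carrier_Quot: "carrier (R Quot I) = (+>) I ` carrier R"
  by (auto simp: FactRing_def A_RCOSETS_def')

lemma lift_pairs:
  assumes "set qs \<subseteq> h ` C \<times> h ` C"
  shows "\<exists>ps. set ps \<subseteq> C \<times> C \<and> map (map_prod h h) ps = qs"
  using assms
proof (induction qs)
  case (Cons q qs)
  then obtain ps a b where "set ps \<subseteq> C \<times> C" "map (map_prod h h) ps = qs" "a \<in> C" "b \<in> C" "q = (h a, h b)"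
    by auto
  then show ?case by (intro exI[of _ "(a, b) # ps"]) auto
qed simp

section \<open>The fibre of an Azumaya algebra at a maximal ideal\<close>

locale azumaya = assoc_algebra +
  assumes azumaya: "azumaya_algebra R A"
begin

lemma faithful: "faithful_module R A"
  using azumaya by (simp add: azumaya_algebra_def)

lemma central_simple_quotient:
  "maximalideal m R \<Longrightarrow> central_simple_algebra (R Quot m) (quot_algebra R A m)"
  using azumaya by (simp add: azumaya_algebra_def)

context
  fixes m
  assumes m: "maximalideal m R"
begin

abbreviation "mA \<equiv> ideal_smult R A m"
abbreviation "B \<equiv> quot_algebra R A m"

lemma m_prime: "primeideal m R"
  using m by (rule R.maximalideal_prime)

lemma m_subset: "m \<subseteq> carrier R"
  using m by (auto simp: maximalideal_def dest: ideal.axioms(1) additive_subgroup.a_subset)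

lemma mA_ideal: "ideal mA A"
  by (rule ideal_ideal_smult[OF m_subset])

lemma B_simple: "simple_ring B"
  using central_simple_quotient[OF m] by (simp add: central_simple_algebra_def)

lemma B_ring: "ring B"
  using B_simple by (simp add: simple_ring_def)

lemma rcos_hom: "(+>\<^bsub>A\<^esub>) mA \<in> ring_hom A B"
  using ideal.rcos_ring_hom[OF mA_ideal] by (simp add: ring_hom_def quot_algebra_simps)

lemma carrier_B: "carrier B = (+>\<^bsub>A\<^esub>) mA ` carrier A"
  using ideal.carrier_Quot[OF mA_ideal] by (simp add: quot_algebra_simps)

lemma rcos_zero_iff: "a \<in> carrier A \<Longrightarrow> mA +>\<^bsub>A\<^esub> a = \<zero>\<^bsub>B\<^esub> \<longleftrightarrow> a \<in> mA"
  using ideal.rcos_eq_zero_iff[OF mA_ideal] by (simp add: quot_algebra_simps)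

text \<open>The central elements of the fibre are scalars from R/m; choosing a representative lifts
  each of them to a scalar from R.\<close>

lemma center_B:
  assumes "z \<in> ring_center B"
  shows "\<exists>r\<in>carrier R. z = mA +>\<^bsub>A\<^esub> (r \<odot>\<^bsub>A\<^esub> \<one>\<^bsub>A\<^esub>)"
proof -
  interpret m: ideal m R using m by (simp add: maximalideal_def)
  interpret mA: ideal mA A by (rule mA_ideal)
  have "ring_center B = {c \<odot>\<^bsub>B\<^esub> \<one>\<^bsub>B\<^esub> | c. c \<in> carrier (R Quot m)}"
    using central_simple_quotient[OF m] by (simp add: central_simple_algebra_def)
  then obtain r where r: "r \<in> carrier R" "z = (m +>\<^bsub>R\<^esub> r) \<odot>\<^bsub>B\<^esub> \<one>\<^bsub>B\<^esub>"
    using assms by (auto simp: m.carrier_Quot)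
  \<comment> \<open>A coset acts as a union over representatives of both factors, so all
    representatives must be shown to contribute the same coset.\<close>
  have inner: "mA +>\<^bsub>A\<^esub> (s \<odot>\<^bsub>A\<^esub> x) = mA +>\<^bsub>A\<^esub> (r \<odot>\<^bsub>A\<^esub> \<one>\<^bsub>A\<^esub>)"
    if s: "s \<in> m +>\<^bsub>R\<^esub> r" and x: "x \<in> mA +>\<^bsub>A\<^esub> \<one>\<^bsub>A\<^esub>" for s x
  proof -
    obtain \<mu> j where \<mu>: "\<mu> \<in> m" "s = \<mu> \<oplus> r" and j: "j \<in> mA" "x = j \<oplus>\<^bsub>A\<^esub> \<one>\<^bsub>A\<^esub>"
      using s x by (auto simp: a_r_coset_def r_coset_def)
    have c: "\<mu> \<in> carrier R" "j \<in> carrier A" using \<mu> j m.a_subset mA.a_subset by auto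
    have "s \<odot>\<^bsub>A\<^esub> x \<ominus>\<^bsub>A\<^esub> r \<odot>\<^bsub>A\<^esub> \<one>\<^bsub>A\<^esub> = s \<odot>\<^bsub>A\<^esub> j \<oplus>\<^bsub>A\<^esub> \<mu> \<odot>\<^bsub>A\<^esub> \<one>\<^bsub>A\<^esub>"
      using c r(1) unfolding \<mu>(2) j(2)
      by (simp add: smult_r_distr smult_l_distr M.minus_eq M.a_assoc M.r_neg)
    also have "\<dots> \<in> mA"
      using submodule.smult_closed[OF ideal_submodule[OF mA_ideal] _ j(1), of s] c r(1) \<mu>(2)
        ideal_smult_mem[OF m.a_subset \<mu>(1) A.one_closed] by (auto intro: mA.a_closed)
    finally show ?thesis
      using c r(1) \<mu>(2) j(2) by (subst mA.rcos_eq_iff) auto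
  qed
  have "z = (\<Union>s\<in>m +>\<^bsub>R\<^esub> r. \<Union>x\<in>mA +>\<^bsub>A\<^esub> \<one>\<^bsub>A\<^esub>. mA +>\<^bsub>A\<^esub> (s \<odot>\<^bsub>A\<^esub> x))"
    using r(2) by (simp add: quot_algebra_simps FactRing_def)
  also have "\<dots> = mA +>\<^bsub>A\<^esub> (r \<odot>\<^bsub>A\<^esub> \<one>\<^bsub>A\<^esub>)"
  proof -
    have "(\<Union>x\<in>mA +>\<^bsub>A\<^esub> \<one>\<^bsub>A\<^esub>. mA +>\<^bsub>A\<^esub> (s \<odot>\<^bsub>A\<^esub> x)) = mA +>\<^bsub>A\<^esub> (r \<odot>\<^bsub>A\<^esub> \<one>\<^bsub>A\<^esub>)" if "s \<in> m +>\<^bsub>R\<^esub> r" for s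
      using inner[OF that] mA.a_rcos_self[OF A.one_closed] by (intro UN_constant_eq) auto
    then show ?thesis
      using m.a_rcos_self[OF r(1)] by (intro UN_constant_eq) auto
  qed
  finally show ?thesis using r(1) by blast
qed

text \<open>A basis at m is independent over the centre of the fibre, because a central relation
  lifts to one with coefficients in R. The dual sandwich maps of the simple ring B then exist, and
  their finitely many coefficients lift to A.\<close>

lemma dual_sandwiches:
  assumes basis: "basis_up_to R A (carrier R - m) n y"
  shows "\<exists>ps. \<forall>i<n. set (ps i) \<subseteq> carrier A \<times> carrier A \<and>
    (\<forall>l<n. mA +>\<^bsub>A\<^esub> sandwich A (ps i) (y l) = (if l = i then \<one>\<^bsub>B\<^esub> else \<zero>\<^bsub>B\<^esub>))"
proof -
  interpret B: ring B by (rule B_ring)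
  interpret m: primeideal m R by (rule m_prime)
  interpret N: residue_submodule R A m "residue_kernel R A m"
    by (rule residue_submodule_residue_kernel[OF m_prime])
  let ?\<pi> = "(+>\<^bsub>A\<^esub>) mA"
  note hom = rcos_hom
  have y: "y i \<in> carrier A" if "i < n" for i
    using basis that by (simp add: basis_up_to_iff)
  have \<pi>y: "?\<pi> (y i) \<in> carrier B" if "i \<in> {..<n}" for i
    using ring_hom_closed[OF hom] y that by auto
  have "\<forall>i\<in>{..<n}. z i = \<zero>\<^bsub>B\<^esub>"
    if z: "z \<in> {..<n} \<rightarrow> ring_center B" and sum: "(\<Oplus>\<^bsub>B\<^esub>i\<in>{..<n}. z i \<otimes>\<^bsub>B\<^esub> ?\<pi> (y i)) = \<zero>\<^bsub>B\<^esub>" for z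
  proof -
    have "\<forall>i\<in>{..<n}. \<exists>r. r \<in> carrier R \<and> z i = ?\<pi> (r \<odot>\<^bsub>A\<^esub> \<one>\<^bsub>A\<^esub>)"
      using center_B z by blast
    then obtain c where c: "\<And>i. i < n \<Longrightarrow> c i \<in> carrier R" "\<And>i. i < n \<Longrightarrow> z i = ?\<pi> (c i \<odot>\<^bsub>A\<^esub> \<one>\<^bsub>A\<^esub>)"
      by (auto dest!: bchoice)
    have "?\<pi> (combination {..<n} c y) = (\<Oplus>\<^bsub>B\<^esub>i\<in>{..<n}. ?\<pi> (c i \<odot>\<^bsub>A\<^esub> y i))"
      unfolding combination_def using c y by (intro ring_hom_finsum[OF A.ring_axioms B_ring hom]) auto
    also have "\<dots> = (\<Oplus>\<^bsub>B\<^esub>i\<in>{..<n}. z i \<otimes>\<^bsub>B\<^esub> ?\<pi> (y i))"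
    proof (rule B.finsum_cong')
      have eq: "?\<pi> (c i \<odot>\<^bsub>A\<^esub> y i) = z i \<otimes>\<^bsub>B\<^esub> ?\<pi> (y i)" if "i < n" for i
        using c[OF that] y[OF that] by (simp add: ring_hom_mult[OF hom, symmetric] one_smult_mult)
      then show "?\<pi> (c i \<odot>\<^bsub>A\<^esub> y i) = z i \<otimes>\<^bsub>B\<^esub> ?\<pi> (y i)" if "i \<in> {..<n}" for i
        using that by simp
      have "?\<pi> (c i \<odot>\<^bsub>A\<^esub> y i) \<in> carrier B" if "i < n" for i
        using c(1)[OF that] y[OF that] by (intro ring_hom_closed[OF hom]) simp
      then show "(\<lambda>i. z i \<otimes>\<^bsub>B\<^esub> ?\<pi> (y i)) \<in> {..<n} \<rightarrow> carrier B"
        using eq by simp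
    qed simp
    also have "\<dots> = \<zero>\<^bsub>B\<^esub>" by (rule sum)
    finally have "combination {..<n} c y \<in> mA"
      using c y by (subst (asm) rcos_zero_iff) (auto intro!: combination_lessThan_closed)
    then have "combination {..<n} c y \<in> residue_kernel R A m"
      using ideal_smult_subset_residue_kernel[OF m_prime] by blast
    \<comment> \<open>Lying in mA forces the lifted coefficients into m, so the central elements
      they represent are zero in B.\<close>
    then have cm: "\<forall>i\<in>{..<n}. c i \<in> m"
      using basis_independent[OF m_prime basis] c(1) unfolding N.independent_def by (elim allE[of _ c]) simp
    then show ?thesis
      using c(2) ideal_smult_mem[OF m_subset _ A.one_closed] rcos_zero_iff c(1) by simp
  qed
  then obtain f where f: "\<forall>i\<in>{..<n}. sandwich_map B (f i) \<and>
      (\<forall>l\<in>{..<n}. f i (?\<pi> (y l)) = (if l = i then \<one>\<^bsub>B\<^esub> else \<zero>\<^bsub>B\<^esub>))"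
    using B.simple_ring_dual_sandwich_maps[OF B_simple, of "{..<n}" "\<lambda>i. ?\<pi> (y i)"] \<pi>y by auto
  have "\<exists>ps. set ps \<subseteq> carrier A \<times> carrier A \<and>
      (\<forall>l<n. ?\<pi> (sandwich A ps (y l)) = (if l = i then \<one>\<^bsub>B\<^esub> else \<zero>\<^bsub>B\<^esub>))" if i: "i < n" for i
  proof -
    have sm: "sandwich_map B (f i)" using f i by simp
    obtain qs where qs: "set qs \<subseteq> carrier B \<times> carrier B" "\<And>x. x \<in> carrier B \<Longrightarrow> f i x = sandwich B qs x"
      by (rule B.sandwich_mapE[OF sm]) (rule that)
    then obtain ps where ps: "set ps \<subseteq> carrier A \<times> carrier A" "map (map_prod ?\<pi> ?\<pi>) ps = qs"
      using lift_pairs[of qs ?\<pi> "carrier A"] by (auto simp: carrier_B)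
    have "?\<pi> (sandwich A ps (y l)) = (if l = i then \<one>\<^bsub>B\<^esub> else \<zero>\<^bsub>B\<^esub>)" if l: "l < n" for l
      using ring_hom_sandwich[OF A.ring_axioms B_ring hom ps(1) y[OF l]] ps(2) qs(2)[OF \<pi>y, of l] f i l
      by simp
    then show ?thesis using ps(1) by blast
  qed
  then show ?thesis by metis
qed

text \<open>The image of J in the simple ring B is zero or all of B; these are the two
  alternatives.\<close>

lemma ideal_le_mA_or_comaximal:
  assumes J: "ideal J A"
  shows "J \<subseteq> mA \<or> (\<forall>x\<in>carrier A. \<exists>j\<in>J. \<exists>w\<in>mA. x = j \<oplus>\<^bsub>A\<^esub> w)"
proof -
  interpret B: ring B by (rule B_ring)
  interpret J: ideal J A by (rule J)
  interpret mA: ideal mA A by (rule mA_ideal)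
  let ?\<pi> = "(+>\<^bsub>A\<^esub>) mA"
  note hom = rcos_hom
  have "ideal (?\<pi> ` J) B"
  proof (rule idealI[OF B_ring])
    show "subgroup (?\<pi> ` J) (add_monoid B)"
    proof (rule B.add.subgroupI)
      show "?\<pi> ` J \<subseteq> carrier B" using J.a_subset by (auto simp: carrier_B)
      show "?\<pi> ` J \<noteq> {}" using J.zero_closed by blast
      fix a assume "a \<in> ?\<pi> ` J"
      then obtain j where j: "j \<in> J" "a = ?\<pi> j" by blast
      have jc: "j \<in> carrier A" using j J.a_subset by blast
      have "?\<pi> (\<ominus>\<^bsub>A\<^esub> j) \<oplus>\<^bsub>B\<^esub> ?\<pi> j = \<zero>\<^bsub>B\<^esub>"
        using jc ring_hom_zero[OF hom A.ring_axioms B_ring]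
        by (simp add: ring_hom_add[OF hom, symmetric] M.l_neg)
      then have "\<ominus>\<^bsub>B\<^esub> a = ?\<pi> (\<ominus>\<^bsub>A\<^esub> j)"
        using jc ring_hom_closed[OF hom] j(2) by (intro B.minus_equality) auto
      then show "\<ominus>\<^bsub>B\<^esub> a \<in> ?\<pi> ` J" using j by blast
      fix b assume "b \<in> ?\<pi> ` J"
      then obtain k where k: "k \<in> J" "b = ?\<pi> k" by blast
      then have "a \<oplus>\<^bsub>B\<^esub> b = ?\<pi> (j \<oplus>\<^bsub>A\<^esub> k)" using j J.a_subset by (simp add: ring_hom_add[OF hom] subsetD)
      then show "a \<oplus>\<^bsub>B\<^esub> b \<in> ?\<pi> ` J" using j k by blast
    qed
  next
    fix a x assume "a \<in> ?\<pi> ` J" "x \<in> carrier B"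
    then obtain j u where j: "j \<in> J" "a = ?\<pi> j" and u: "u \<in> carrier A" "x = ?\<pi> u"
      by (auto simp: carrier_B)
    have jc: "j \<in> carrier A" using j J.a_subset by blast
    have "x \<otimes>\<^bsub>B\<^esub> a = ?\<pi> (u \<otimes>\<^bsub>A\<^esub> j)" "a \<otimes>\<^bsub>B\<^esub> x = ?\<pi> (j \<otimes>\<^bsub>A\<^esub> u)"
      using j u jc by (simp_all add: ring_hom_mult[OF hom])
    then show "x \<otimes>\<^bsub>B\<^esub> a \<in> ?\<pi> ` J" "a \<otimes>\<^bsub>B\<^esub> x \<in> ?\<pi> ` J"
      using J.I_l_closed[OF j(1) u(1)] J.I_r_closed[OF j(1) u(1)] by auto
  qed
  then consider "?\<pi> ` J = {\<zero>\<^bsub>B\<^esub>}" | "?\<pi> ` J = carrier B"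
    using B_simple unfolding simple_ring_def by blast
  then show ?thesis
  proof cases
    case 1
    then have "j \<in> mA" if "j \<in> J" for j
      using that J.a_subset rcos_zero_iff[of j] by blast
    then show ?thesis by blast
  next
    case 2
    have "\<exists>j\<in>J. \<exists>w\<in>mA. x = j \<oplus>\<^bsub>A\<^esub> w" if x: "x \<in> carrier A" for x
    proof -
      have "?\<pi> x \<in> ?\<pi> ` J" using 2 x by (simp add: carrier_B)
      then obtain j where j: "j \<in> J" "?\<pi> x = ?\<pi> j" by blast
      have jc: "j \<in> carrier A" using j J.a_subset by blast
      have "x \<ominus>\<^bsub>A\<^esub> j \<in> mA" using mA.rcos_eq_iff[OF x jc] j(2) by simp
      moreover have "x = j \<oplus>\<^bsub>A\<^esub> (x \<ominus>\<^bsub>A\<^esub> j)"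
        using x jc by (simp add: M.minus_eq M.a_lcomm[of j x] M.r_neg)
      ultimately show ?thesis using j(1) by blast
    qed
    then show ?thesis by blast
  qed
qed

end

text \<open>Take m above the ideal of all r with \<open>r \<odot> \<one>\<close> in J. If J were not
  inside mA, the fibre would be covered by J, and Nakayama's lemma would put
  \<open>t \<odot> \<one>\<close> in J for some t outside m, against the choice of m.\<close>

lemma proper_ideal_le_maximal:
  assumes J: "ideal J A" and proper: "\<one>\<^bsub>A\<^esub> \<notin> J"
  shows "\<exists>m. maximalideal m R \<and> J \<subseteq> ideal_smult R A m"
proof -
  interpret J: ideal J A by (rule J)
  note sub = ideal_submodule[OF J]
  interpret JM: submodule R J A by (rule sub)
  let ?K = "{r \<in> carrier R. r \<odot>\<^bsub>A\<^esub> \<one>\<^bsub>A\<^esub> \<in> J}"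
  have "ideal ?K R"
  proof (rule idealI[OF R.ring_axioms])
    show "subgroup ?K (add_monoid R)"
      by (intro R.add.subgroupI) (auto simp: smult_l_distr smult_l_minus intro!: exI[of _ \<zero>])
  next
    fix a r
    assume "a \<in> ?K" and r: "r \<in> carrier R"
    then have a: "a \<in> carrier R" "a \<odot>\<^bsub>A\<^esub> \<one>\<^bsub>A\<^esub> \<in> J" by auto
    then have ra: "(r \<otimes> a) \<odot>\<^bsub>A\<^esub> \<one>\<^bsub>A\<^esub> \<in> J" using r by (simp add: smult_assoc1)
    then show "r \<otimes> a \<in> ?K" using a(1) r by simp
    show "a \<otimes> r \<in> ?K" using ra a(1) r by (simp add: R.m_comm)
  qed
  moreover have "\<one> \<notin> ?K" using proper by simp
  ultimately obtain m where m: "maximalideal m R" "?K \<subseteq> m"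
    using R.exists_maximalideal[of ?K] by auto
  have "J \<subseteq> ideal_smult R A m"
  proof (rule ccontr)
    assume "\<not> ?thesis"
    then have comax: "\<And>x. x \<in> carrier A \<Longrightarrow> \<exists>j\<in>J. \<exists>w\<in>ideal_smult R A m. x = j \<oplus>\<^bsub>A\<^esub> w"
      using ideal_le_mA_or_comaximal[OF m(1) J] by blast
    obtain S where S: "finite S" "S \<subseteq> carrier A" "span S = carrier A"
      using azumaya by (auto simp: azumaya_algebra_def fin_gen_module_def)
    have mp: "primeideal m R" using m(1) by (rule R.maximalideal_prime)
    have "\<exists>t\<in>carrier R - m. \<forall>x\<in>carrier A. t \<odot>\<^bsub>A\<^esub> x \<in> J"
    \<comment> \<open>The start of the elimination: U is J itself, S generates A, and t is
      1.\<close>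
    proof (rule nakayama[OF mp sub comax S(1,2) sub order_refl complement_prime(2)[OF mp]])
      fix x W
      assume "x \<in> carrier A" "submodule R W A" "S \<subseteq> W"
      then show "\<one> \<odot>\<^bsub>A\<^esub> x \<in> W"
        using span_is_subset[of S W] S(3) by auto
    qed
    then obtain t where "t \<in> carrier R - m" "t \<odot>\<^bsub>A\<^esub> \<one>\<^bsub>A\<^esub> \<in> J"
      using A.one_closed by blast
    then show False using m(2) by blast
  qed
  with m(1) show ?thesis by blast
qed

end

subsection \<open>Homomorphisms of Azumaya algebras\<close>

lemma basis_from_constant_rank:
  assumes "module R M" "has_constant_rank R M n" "primeideal p R"
  shows "\<exists>y. basis_up_to R M (carrier R - p) n y"
proof -
  interpret module R M by fact
  interpret p: primeideal p R by fact
  interpret D: denominators_module R M "carrier R - p"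
    by (intro denominators_module.intro denominators.intro denominators_axioms.intro
        module_axioms R.is_cring complement_prime[OF assms(3)])
  show ?thesis
    using assms(2,3) by (intro D.basis_up_to_denominators) (auto simp: has_constant_rank_def has_rank_at_def)
qed

locale azumaya_hom = A: azumaya R A + A': azumaya R' A'
  for R :: "('r, 'm) ring_scheme" and A :: "('r, 'a, 'n) module_scheme"
    and R' :: "('s, 'k) ring_scheme" and A' :: "('s, 'b, 'l) module_scheme" +
  fixes \<phi> :: "'a \<Rightarrow> 'b" and r r' :: nat
  assumes hom: "\<phi> \<in> ring_hom A A'"
    and rank: "has_constant_rank R A r" and rank': "has_constant_rank R' A' r'"
begin

text \<open>The y are a basis at a maximal ideal of R found through the kernel of the map from A to
  D. A relation between their images has central coefficients in D, and one coefficient outside p is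
  a nonzerodivisor because the residue kernel is saturated.\<close>

lemma independent_image:
  assumes p: "primeideal p R'"
  shows "\<exists>y. (\<forall>i<r. y i \<in> carrier A) \<and>
    residue_submodule.independent R' A' p (residue_kernel R' A' p) {..<r} (\<lambda>i. \<phi> (y i))"
proof -
  interpret N: residue_submodule R' A' p "residue_kernel R' A' p"
    by (rule A'.residue_submodule_residue_kernel[OF p])
  let ?N = "residue_kernel R' A' p"
  interpret NI: ideal ?N A' by (rule A'.ideal_residue_kernel[OF p])
  let ?D = "A' Quot ?N"
  interpret D: ring ?D by (rule NI.quotient_is_ring)
  let ?\<rho> = "(+>\<^bsub>A'\<^esub>) ?N"
  note \<rho> = NI.rcos_ring_hom
  define \<psi> where "\<psi> a = ?\<rho> (\<phi> a)" for a
  have \<phi>_closed: "\<phi> a \<in> carrier A'" if "a \<in> carrier A" for a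
    using ring_hom_closed[OF hom that] .
  have \<psi>: "\<psi> \<in> ring_hom A ?D"
    unfolding \<psi>_def[abs_def]
    using ring_hom_trans[OF hom \<rho>] by (simp add: comp_def)
  have \<psi>_zero_iff: "\<psi> a = \<zero>\<^bsub>?D\<^esub> \<longleftrightarrow> \<phi> a \<in> ?N" if "a \<in> carrier A" for a
    unfolding \<psi>_def using NI.rcos_eq_zero_iff[OF \<phi>_closed[OF that]] .
  obtain y' where y': "basis_up_to R' A' (carrier R' - p) r' y'"
    using basis_from_constant_rank[OF A'.module_axioms rank' p] by blast
  let ?J = "a_kernel A ?D \<psi>"
  have J: "ideal ?J A"
    by (rule ring_hom_ring.kernel_is_ideal[OF ring_hom_ringI2[OF A.A.ring_axioms D.ring_axioms \<psi>]])
  have J_iff: "a \<in> ?J \<longleftrightarrow> a \<in> carrier A \<and> \<phi> a \<in> ?N" for a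
    unfolding a_kernel_def' mem_Collect_eq using \<psi>_zero_iff by (rule conj_cong[OF refl])
  have "\<one>\<^bsub>A\<^esub> \<notin> ?J"
    using A'.one_notin_residue_kernel[OF A'.faithful p y'] ring_hom_one[OF hom] by (simp add: J_iff)
  \<comment> \<open>With the kernel of \<psi> inside mA, whatever vanishes in D also vanishes in the
    fibre. This is the only link between the fibre at m and D.\<close>
  then obtain m where m: "maximalideal m R" "?J \<subseteq> ideal_smult R A m"
    using A.proper_ideal_le_maximal[OF J] by blast
  obtain y where y: "basis_up_to R A (carrier R - m) r y"
    using basis_from_constant_rank[OF A.module_axioms rank A.m_prime[OF m(1)]] by blast
  have yA: "y i \<in> carrier A" if "i < r" for i
    using y that by (simp add: A.basis_up_to_iff)
  let ?B = "quot_algebra R A m" and ?\<pi> = "(+>\<^bsub>A\<^esub>) (ideal_smult R A m)"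
  obtain ps where "\<forall>i<r. set (ps i) \<subseteq> carrier A \<times> carrier A \<and>
      (\<forall>l<r. ?\<pi> (sandwich A (ps i) (y l)) = (if l = i then \<one>\<^bsub>?B\<^esub> else \<zero>\<^bsub>?B\<^esub>))"
    using A.dual_sandwiches[OF m(1) y] ..
  then have ps: "set (ps i) \<subseteq> carrier A \<times> carrier A"
    "l < r \<Longrightarrow> ?\<pi> (sandwich A (ps i) (y l)) = (if l = i then \<one>\<^bsub>?B\<^esub> else \<zero>\<^bsub>?B\<^esub>)" if "i < r" for i l
    using that by simp_all
  have "N.independent {..<r} (\<lambda>i. \<phi> (y i))"
    unfolding N.independent_def
  proof (intro allI impI ballI, elim conjE, rule ccontr)
    fix c i0
    assume c: "\<forall>i\<in>{..<r}. c i \<in> carrier R'"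
      and sum: "A'.combination {..<r} c (\<lambda>i. \<phi> (y i)) \<in> ?N"
      and i0: "i0 \<in> {..<r}" "c i0 \<notin> p"
    \<comment> \<open>Multiplication by \<open>c i\<close> in the module becomes multiplication by a
      central element of the ring D, the form in which the elimination lemma takes its
      coefficients.\<close>
    define \<gamma> where "\<gamma> i = ?\<rho> (c i \<odot>\<^bsub>A'\<^esub> \<one>\<^bsub>A'\<^esub>)" for i
    have \<gamma>_mult: "\<gamma> i \<otimes>\<^bsub>?D\<^esub> ?\<rho> x = ?\<rho> (c i \<odot>\<^bsub>A'\<^esub> x)" "?\<rho> x \<otimes>\<^bsub>?D\<^esub> \<gamma> i = ?\<rho> (c i \<odot>\<^bsub>A'\<^esub> x)"
      if "i < r" "x \<in> carrier A'" for i x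
      using that c
      by (simp_all add: \<gamma>_def ring_hom_mult[OF \<rho>, symmetric] A'.one_smult_mult A'.mult_one_smult)
    have "(\<Oplus>\<^bsub>?D\<^esub>i\<in>{..<r}. \<gamma> i \<otimes>\<^bsub>?D\<^esub> \<psi> (y i)) \<noteq> \<zero>\<^bsub>?D\<^esub>"
    proof (rule no_relation_if_dual_sandwich_maps[OF A.A.ring_axioms A.B_ring[OF m(1)] D.ring_axioms
          A.rcos_hom[OF m(1)] \<psi>, where ps = ps and ?i0.0 = i0])
      show "?\<pi> a = \<zero>\<^bsub>?B\<^esub>" if "a \<in> carrier A" "\<psi> a = \<zero>\<^bsub>?D\<^esub>" for a
        using that m(2) J_iff[of a] \<psi>_zero_iff A.rcos_zero_iff[OF m(1)] by auto
      show "\<one>\<^bsub>?B\<^esub> \<noteq> \<zero>\<^bsub>?B\<^esub>"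
        using A.B_simple[OF m(1)] by (simp add: simple_ring_def)
      show "\<gamma> i \<in> ring_center ?D" if "i \<in> {..<r}" for i
        using that \<gamma>_mult[of i] c ring_hom_closed[OF \<rho>, of "c i \<odot>\<^bsub>A'\<^esub> \<one>\<^bsub>A'\<^esub>"]
        by (auto simp: ring_center_def NI.carrier_Quot \<gamma>_def)
      show "d = \<zero>\<^bsub>?D\<^esub>" if d: "d \<in> carrier ?D" "\<gamma> i0 \<otimes>\<^bsub>?D\<^esub> d = \<zero>\<^bsub>?D\<^esub>" for d
      proof -
        obtain x where x: "x \<in> carrier A'" "d = ?\<rho> x" using d(1) by (auto simp: NI.carrier_Quot)
        have c0: "c i0 \<in> carrier R'" using c i0(1) by blast
        have "?\<rho> (c i0 \<odot>\<^bsub>A'\<^esub> x) = \<zero>\<^bsub>?D\<^esub>"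
          using d(2) x i0(1) \<gamma>_mult(1)[of i0 x] by simp
        then have "c i0 \<odot>\<^bsub>A'\<^esub> x \<in> ?N"
          using NI.rcos_eq_zero_iff c0 x(1) by simp
        then have "x \<in> ?N" by (rule N.saturated[OF c0 i0(2) x(1)])
        then show ?thesis using x NI.rcos_eq_zero_iff by simp
      qed
    qed (use ps yA i0 in auto)
    moreover have "(\<Oplus>\<^bsub>?D\<^esub>i\<in>{..<r}. \<gamma> i \<otimes>\<^bsub>?D\<^esub> \<psi> (y i)) = \<zero>\<^bsub>?D\<^esub>"
    proof -
      have cl: "c i \<odot>\<^bsub>A'\<^esub> \<phi> (y i) \<in> carrier A'" if "i < r" for i
        using that c \<phi>_closed[OF yA] by simp
      have "(\<Oplus>\<^bsub>?D\<^esub>i\<in>{..<r}. \<gamma> i \<otimes>\<^bsub>?D\<^esub> \<psi> (y i)) = (\<Oplus>\<^bsub>?D\<^esub>i\<in>{..<r}. ?\<rho> (c i \<odot>\<^bsub>A'\<^esub> \<phi> (y i)))"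
        using \<gamma>_mult(1) \<phi>_closed[OF yA] ring_hom_closed[OF \<rho> cl]
        by (intro D.finsum_cong') (auto simp: \<psi>_def)
      also have "\<dots> = ?\<rho> (A'.combination {..<r} c (\<lambda>i. \<phi> (y i)))"
        unfolding A'.combination_def
        using cl by (intro ring_hom_finsum[OF A'.A.ring_axioms D.ring_axioms \<rho>, symmetric]) auto
      also have "\<dots> = \<zero>\<^bsub>?D\<^esub>"
        using sum NI.rcos_eq_zero_iff NI.a_subset by blast
      finally show ?thesis .
    qed
    ultimately show False by simp
  qed
  then show ?thesis using yA by blast
qed

text \<open>Independent images of r elements lie in a space spanned by a basis of r'
  elements.\<close>

lemma rank_le:
  assumes p: "primeideal p R'"
  shows "r \<le> r'"
proof -
  interpret N: residue_submodule R' A' p "residue_kernel R' A' p"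
    by (rule A'.residue_submodule_residue_kernel[OF p])
  obtain y where y: "\<And>i. i < r \<Longrightarrow> y i \<in> carrier A" "N.independent {..<r} (\<lambda>i. \<phi> (y i))"
    using independent_image[OF p] by blast
  obtain y' where y': "basis_up_to R' A' (carrier R' - p) r' y'"
    using basis_from_constant_rank[OF A'.module_axioms rank' p] by blast
  have "card {..<r} \<le> card {..<r'}"
  proof (rule N.card_independent_le)
    show "y' j \<in> carrier A'" if "j \<in> {..<r'}" for j
      using y' that by (simp add: A'.basis_up_to_iff)
    show \<phi>y: "\<phi> (y i) \<in> carrier A'" if "i \<in> {..<r}" for i
      using ring_hom_closed[OF hom y(1)] that by simp
    show "N.spanned {..<r'} y' (\<phi> (y i))" if "i \<in> {..<r}" for i
      using A'.basis_spanned[OF p y' \<phi>y[OF that]] .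
  qed (simp_all add: y(2))
  then show ?thesis by simp
qed

text \<open>For equal ranks the independent images \<phi>(y) also span. As z is central, \<phi>(z)
  commutes with them, hence modulo the residue kernel with everything they span.\<close>

lemma commutator_mem_residue_kernel:
  assumes p: "primeideal p R'" and "r = r'" and z: "z \<in> ring_center A" and x: "x \<in> carrier A'"
  shows "\<phi> z \<otimes>\<^bsub>A'\<^esub> x \<ominus>\<^bsub>A'\<^esub> x \<otimes>\<^bsub>A'\<^esub> \<phi> z \<in> residue_kernel R' A' p"
proof -
  interpret N: residue_submodule R' A' p "residue_kernel R' A' p"
    by (rule A'.residue_submodule_residue_kernel[OF p])
  let ?N = "residue_kernel R' A' p"
  interpret NI: ideal ?N A' by (rule A'.ideal_residue_kernel[OF p])
  obtain y where y: "\<And>i. i < r \<Longrightarrow> y i \<in> carrier A" "N.independent {..<r} (\<lambda>i. \<phi> (y i))"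
    using independent_image[OF p] by blast
  obtain y' where y': "basis_up_to R' A' (carrier R' - p) r y'"
    using basis_from_constant_rank[OF A'.module_axioms rank' p] \<open>r = r'\<close> by blast
  have \<phi>y: "\<phi> (y i) \<in> carrier A'" if "i < r" for i
    using ring_hom_closed[OF hom y(1)[OF that]] .
  have "N.spanned {..<r} (\<lambda>i. \<phi> (y i)) x"
  proof (rule N.spanned_by_maximal_independent)
    show "y' i \<in> carrier A'" if "i < r" for i
      using y' that by (simp add: A'.basis_up_to_iff)
    show "N.spanned {..<r} y' v" if "v \<in> carrier A'" for v
      using A'.basis_spanned[OF p y' that] .
  qed (fact \<phi>y y(2) x)+
  then obtain t c where t: "t \<in> carrier R'" "t \<notin> p" and c: "\<forall>i\<in>{..<r}. c i \<in> carrier R'"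
    and tx: "t \<odot>\<^bsub>A'\<^esub> x \<ominus>\<^bsub>A'\<^esub> A'.combination {..<r} c (\<lambda>i. \<phi> (y i)) \<in> ?N"
    unfolding N.spanned_def by blast
  have zA: "z \<in> carrier A" "\<And>a. a \<in> carrier A \<Longrightarrow> z \<otimes>\<^bsub>A\<^esub> a = a \<otimes>\<^bsub>A\<^esub> z"
    using z by (auto simp: ring_center_def)
  have f: "\<phi> z \<in> carrier A'" using ring_hom_closed[OF hom zA(1)] .
  \<comment> \<open>The centralizer of \<phi>(z) modulo N. It is a submodule and contains N, since N
    is a two-sided ideal; so membership of \<open>t x\<close> follows from that of the
    combination.\<close>
  let ?W = "{w \<in> carrier A'. \<phi> z \<otimes>\<^bsub>A'\<^esub> w \<ominus>\<^bsub>A'\<^esub> w \<otimes>\<^bsub>A'\<^esub> \<phi> z \<in> ?N}"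
  have W: "submodule R' ?W A'"
  proof (rule A'.submoduleI')
    show "\<zero>\<^bsub>A'\<^esub> \<in> ?W" using f NI.zero_closed by (simp add: A'.M.minus_eq)
  next
    fix v w assume vw: "v \<in> ?W" "w \<in> ?W"
    have "\<phi> z \<otimes>\<^bsub>A'\<^esub> (v \<oplus>\<^bsub>A'\<^esub> w) \<ominus>\<^bsub>A'\<^esub> (v \<oplus>\<^bsub>A'\<^esub> w) \<otimes>\<^bsub>A'\<^esub> \<phi> z =
        (\<phi> z \<otimes>\<^bsub>A'\<^esub> v \<ominus>\<^bsub>A'\<^esub> v \<otimes>\<^bsub>A'\<^esub> \<phi> z) \<oplus>\<^bsub>A'\<^esub> (\<phi> z \<otimes>\<^bsub>A'\<^esub> w \<ominus>\<^bsub>A'\<^esub> w \<otimes>\<^bsub>A'\<^esub> \<phi> z)"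
      using vw f by (simp add: A'.A.r_distr A'.A.l_distr A'.M.add_minus_add)
    also have "\<dots> \<in> ?N" using vw by (intro NI.a_closed) auto
    finally show "v \<oplus>\<^bsub>A'\<^esub> w \<in> ?W" using vw by simp
  next
    fix s w assume s: "s \<in> carrier R'" and w: "w \<in> ?W"
    have "\<phi> z \<otimes>\<^bsub>A'\<^esub> (s \<odot>\<^bsub>A'\<^esub> w) \<ominus>\<^bsub>A'\<^esub> (s \<odot>\<^bsub>A'\<^esub> w) \<otimes>\<^bsub>A'\<^esub> \<phi> z =
        s \<odot>\<^bsub>A'\<^esub> (\<phi> z \<otimes>\<^bsub>A'\<^esub> w \<ominus>\<^bsub>A'\<^esub> w \<otimes>\<^bsub>A'\<^esub> \<phi> z)"
      using s w f by (simp add: A'.smult_mult_left A'.smult_mult_right A'.smult_minus)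
    also have "\<dots> \<in> ?N" using s w by auto
    finally show "s \<odot>\<^bsub>A'\<^esub> w \<in> ?W" using s w by simp
  qed (rule Collect_restrict)
  have "\<phi> (y i) \<in> ?W" if "i < r" for i
  proof -
    have "\<phi> z \<otimes>\<^bsub>A'\<^esub> \<phi> (y i) = \<phi> (y i) \<otimes>\<^bsub>A'\<^esub> \<phi> z"
      using y(1)[OF that] zA by (simp add: ring_hom_mult[OF hom, symmetric])
    then show ?thesis
      using \<phi>y[OF that] f NI.zero_closed by (simp add: A'.M.minus_eq A'.M.r_neg)
  qed
  then have "A'.combination {..<r} c (\<lambda>i. \<phi> (y i)) \<in> ?W"
    using c by (intro A'.combination_mem_submodule[OF W]) auto
  moreover have "?N \<subseteq> ?W"
  proof
    fix w assume w: "w \<in> ?N"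
    have "\<phi> z \<otimes>\<^bsub>A'\<^esub> w \<ominus>\<^bsub>A'\<^esub> w \<otimes>\<^bsub>A'\<^esub> \<phi> z \<in> ?N"
      by (intro A'.submodule_minus[OF N.N_submodule] NI.I_l_closed NI.I_r_closed w f)
    then show "w \<in> ?W" using w NI.a_subset by blast
  qed
  ultimately have "t \<odot>\<^bsub>A'\<^esub> x \<in> ?W"
    using t x by (intro A'.submodule_cancel[OF W subsetD[OF _ tx]]) auto
  then have tN: "t \<odot>\<^bsub>A'\<^esub> (\<phi> z \<otimes>\<^bsub>A'\<^esub> x \<ominus>\<^bsub>A'\<^esub> x \<otimes>\<^bsub>A'\<^esub> \<phi> z) \<in> ?N"
    using t x f by (simp add: A'.smult_mult_left A'.smult_mult_right A'.smult_minus)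
  show ?thesis
    \<comment> \<open>Saturation removes the denominator t.\<close>
    by (rule N.saturated[OF t _ tN]) (simp add: x f)
qed

lemma image_center:
  assumes "r = r'" and reduced: "reduced_ring R'"
  shows "\<phi> ` ring_center A \<subseteq> ring_center A'"
proof
  fix w
  assume "w \<in> \<phi> ` ring_center A"
  then obtain z where z: "z \<in> ring_center A" "w = \<phi> z" by blast
  have basis: "\<exists>n y. basis_up_to R' A' (carrier R' - p) n y" if "primeideal p R'" for p
    using basis_from_constant_rank[OF A'.module_axioms rank' that] by (rule exI)
  have w: "w \<in> carrier A'"
    using z ring_hom_closed[OF hom] by (simp add: ring_center_def)
  have "w \<otimes>\<^bsub>A'\<^esub> x = x \<otimes>\<^bsub>A'\<^esub> w" if x: "x \<in> carrier A'" for x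
  \<comment> \<open>A nonzero commutator would be visible at some prime of the reduced ring R', but
    it lies in the residue kernel at every prime.\<close>
  proof (rule ccontr)
    assume neq: "w \<otimes>\<^bsub>A'\<^esub> x \<noteq> x \<otimes>\<^bsub>A'\<^esub> w"
    have d: "w \<otimes>\<^bsub>A'\<^esub> x \<ominus>\<^bsub>A'\<^esub> x \<otimes>\<^bsub>A'\<^esub> w \<in> carrier A'"
      "w \<otimes>\<^bsub>A'\<^esub> x \<ominus>\<^bsub>A'\<^esub> x \<otimes>\<^bsub>A'\<^esub> w \<noteq> \<zero>\<^bsub>A'\<^esub>"
      using w x neq by simp_all
    then obtain q where "primeideal q R'" "w \<otimes>\<^bsub>A'\<^esub> x \<ominus>\<^bsub>A'\<^esub> x \<otimes>\<^bsub>A'\<^esub> w \<notin> residue_kernel R' A' q"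
      using A'.exists_prime_residue_nonzero[OF reduced basis d] by blast
    then show False
      using commutator_mem_residue_kernel[OF _ assms(1) z(1) x] z(2) by blast
  qed
  with w show "w \<in> ring_center A'" by (simp add: ring_center_def)
qed

end

theorem theorem4p1:
  fixes R :: "('r, 'm) ring_scheme" and R' :: "('s, 'k) ring_scheme"
    and A :: "('r, 'a, 'n) module_scheme" and A' :: "('s, 'b, 'l) module_scheme"
    and \<phi> :: "'a \<Rightarrow> 'b" and r r' :: nat
  assumes "cring R" and "\<one>\<^bsub>R\<^esub> \<noteq> \<zero>\<^bsub>R\<^esub>"
    and "cring R'" and "\<one>\<^bsub>R'\<^esub> \<noteq> \<zero>\<^bsub>R'\<^esub>"
    and "azumaya_algebra R A" and "has_constant_rank R A r"
    and "azumaya_algebra R' A'" and "has_constant_rank R' A' r'"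
    and "\<phi> \<in> ring_hom A A'"
  shows "r \<le> r' \<and>
    (r = r' \<and> reduced_ring R' \<longrightarrow> \<phi> ` ring_center A \<subseteq> ring_center A')"
proof -
  interpret R': cring R' by fact
  interpret azumaya_hom R A R' A' \<phi> r r'
    using assms
    by (intro azumaya_hom.intro azumaya_hom_axioms.intro azumaya.intro azumaya_axioms.intro)
      (simp_all add: azumaya_algebra_def)
  \<comment> \<open>A single prime of R' is enough for the rank inequality; it exists because R' is
    nonzero.\<close>
  obtain p where "maximalideal p R'"
    using R'.exists_maximalideal[OF R'.zeroideal] assms(4) by auto
  then have "primeideal p R'" by (rule R'.maximalideal_prime)
  then show ?thesis using rank_le image_center by blast
qed

end
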